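(* There is an absolute constant $c>0$ (independent of $\sigma,\beta,\kappa$ below) such that the following holds. Fix $\sigma\in(1/2,1)$, $\beta\in(0,1)$ and $0<\kappa<\min(\sigma-1/2,\,1-\beta)$. Then there exists a function $\upsilon:(1/2,1)\to\mathbb{R}_+$ satisfying $$\upsilon(\sigma)>c\,\min\left\{1,\ (e^2-e)\,\frac{|\log(2\sigma-1)|}{|\log(2\sigma-1)|+1}\right\}$$ so that for all sufficiently large $T$ $$\max_{t\in[T^{\beta},T]}-\log|\zeta(\sigma+it)|\ \ge\ \upsilon(\sigma)\,\frac{\kappa^{1-\sigma}}{\sqrt{|\log(2\sigma-1)|}}\,\frac{(\log T)^{1-\sigma}}{(\log_2 T)^{\sigma}}.$$
   Context: $\zeta$ is the Riemann zeta function and $\log_2 T=\log\log T$. The quantity $-\log|\zeta(\sigma+it)|$ is read as $+\infty$ at zeros of $\zeta$; the inequality "$\max_{t\in[T^\beta,T]}\ldots\ge X$" means that some $t\in[T^\beta,T]$ has the quantity at least $X$. *)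

theory Defs
  imports "HOL-Complex_Analysis.Complex_Analysis" "HOL-Real_Asymp.Real_Asymp"
begin

text \<open>
  The Riemann zeta function, as the analytic continuation of its Dirichlet series to the plane
  punctured at 1. The value at the pole is set to 0 so that the description is unique;
  existence and uniqueness are proved in \<open>ex1_riemann_zeta\<close>.
\<close>

definition riemann_zeta :: "complex \<Rightarrow> complex" where
  "riemann_zeta = (THE f. f holomorphic_on -{1} \<and>
     (\<forall>s. 1 < Re s \<longrightarrow> (\<lambda>n. of_nat (Suc n) powr (-s)) sums f s) \<and> f 1 = 0)"

text \<open>
  \<open>- log \<bar>z\<bar>\<close> with the value \<open>\<infinity>\<close> at \<open>z = 0\<close>; extended reals are needed because \<open>ln 0 = 0\<close> in HOL.
\<close>

definition neg_log_norm :: "complex \<Rightarrow> ereal" where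
  "neg_log_norm z = (if z = 0 then \<infinity> else ereal (- ln (norm z)))"

lemma powr_Taylor_bound:
  fixes a :: complex and x :: real
  assumes "0 \<le> x" "x \<le> 1"
  shows "norm ((1 + of_real x) powr a - (\<Sum>k\<le>M. (a gchoose k) * of_real x ^ k))
           \<le> (\<Prod>j\<le>M. norm a + real j) * 2 powr norm a * x ^ Suc M"
proof -
  define f where "f = (\<lambda>i (z::complex). (\<Prod>j<i. a - of_nat j) * (1 + z) powr (a - of_nat i))"
  define S where "S = complex_of_real ` {0..1}"
  have S: "S = closed_segment 0 1"
    unfolding S_def closed_segment_def by (auto simp: scaleR_conv_of_real image_iff intro!: bexI)
  have pos: "1 + z \<notin> \<real>\<^sub>\<le>\<^sub>0" if "z \<in> S" for z
    using that by (auto simp: S_def complex_nonpos_Reals_iff)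
  have B: "norm (f (Suc M) z) \<le> (\<Prod>j\<le>M. norm a + real j) * 2 powr norm a" if z: "z \<in> S" for z
  proof -
    obtain y where "y \<in> {0..1}" "z = complex_of_real y"
      using z unfolding S_def by blast
    then have y: "z = of_real y" "0 \<le> y" "y \<le> 1" by auto
    have "norm ((1 + z) powr (a - of_nat (Suc M))) = (1 + y) powr (Re a - real (Suc M))"
      using y norm_powr_real_powr[of "1 + z"] by simp
    also have "\<dots> \<le> (1 + y) powr norm a"
      using y complex_Re_le_cmod[of a] by (intro powr_mono) auto
    also have "\<dots> \<le> 2 powr norm a"
      using y by (intro powr_mono2) auto
    finally have 1: "norm ((1 + z) powr (a - of_nat (Suc M))) \<le> 2 powr norm a" .
    have 2: "norm (\<Prod>j<Suc M. a - of_nat j) \<le> (\<Prod>j\<le>M. norm a + real j)"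
      unfolding lessThan_Suc_atMost
      by (subst prod_norm[symmetric], intro prod_mono)
         (auto intro: order.trans[OF norm_triangle_ineq4])
    show ?thesis
      unfolding f_def norm_mult using 1 2 by (intro mult_mono) (auto intro!: prod_nonneg)
  qed
  have "norm (f 0 (of_real x) - (\<Sum>i\<le>M. f i 0 * (of_real x - 0) ^ i / fact i))
          \<le> ((\<Prod>j\<le>M. norm a + real j) * 2 powr norm a) * norm (of_real x - 0 :: complex) ^ Suc M / fact M"
  proof (rule field_Taylor[where S = S])
    show "convex S" "0 \<in> S" "of_real x \<in> S"
      using assms by (auto simp: S S_def) (auto simp: S[symmetric] S_def)
    show "(f i has_field_derivative f (Suc i) z) (at z within S)" if "z \<in> S" "i \<le> M" for i z
      unfolding f_def using pos[OF that(1)]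
      by (auto intro!: derivative_eq_intros simp: algebra_simps)
  qed (use B in auto)
  also have "\<dots> \<le> ((\<Prod>j\<le>M. norm a + real j) * 2 powr norm a) * x ^ Suc M"
  proof -
    have "0 \<le> ((\<Prod>j\<le>M. norm a + real j) * 2 powr norm a) * x ^ Suc M"
      using assms by (intro mult_nonneg_nonneg prod_nonneg) auto
    then have "((\<Prod>j\<le>M. norm a + real j) * 2 powr norm a) * x ^ Suc M / fact M
       \<le> ((\<Prod>j\<le>M. norm a + real j) * 2 powr norm a) * x ^ Suc M / 1"
      by (intro divide_left_mono) (auto simp: fact_ge_1)
    then show ?thesis using assms by simp
  qed
  finally show ?thesis
    by (simp add: f_def gbinomial_prod_rev atLeast0LessThan)
qed

text \<open>
  With \<open>a = 1 - s\<close> and \<open>N = n + 1\<close>, this is minus the remainder of the binomial expansion of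
  \<open>N\<^sup>a (1 + 1/N)\<^sup>a\<close> after the terms of order \<open>k \<le> M\<close>. Summing over \<open>n\<close> telescopes, and
  expresses \<open>(s - 1) \<zeta>(s)\<close> through \<open>\<zeta>(s + 1), \<dots>, \<zeta>(s + M - 1)\<close> and a function holomorphic for
  \<open>Re s > 1 - M\<close>.
\<close>

definition tail_term :: "nat \<Rightarrow> nat \<Rightarrow> complex \<Rightarrow> complex" where
  "tail_term M n s = of_nat (Suc n) powr (1 - s) - of_nat (Suc (Suc n)) powr (1 - s)
     + (\<Sum>k=1..M. ((1 - s) gchoose k) * of_nat (Suc n) powr (- (s + of_nat k - 1)))"

lemma tail_term_bound:
  assumes "norm s \<le> r"
  shows "norm (tail_term M n s)
    \<le> (\<Prod>j\<le>M. 1 + r + real j) * 2 powr (1 + r) * real (Suc n) powr (- Re s - real M)"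
proof -
  define N where "N = real (Suc n)"
  define a where "a = 1 - s"
  have N: "N \<ge> 1" "of_nat (Suc n) = complex_of_real N" "of_nat (Suc (Suc n)) = complex_of_real (N + 1)"
    by (auto simp: N_def)
  have na: "norm a \<le> 1 + r"
    using assms norm_triangle_ineq4[of 1 s] by (simp add: a_def)
  have r: "0 \<le> r" using assms norm_ge_zero[of s] by linarith
  have e1: "complex_of_real (N + 1) powr a = of_real N powr a * (1 + of_real (1 / N)) powr a"
  proof -
    have "complex_of_real (N + 1) = of_real N * of_real (1 + 1 / N)"
      using N(1) by (simp flip: of_real_mult add: field_simps)
    then show ?thesis using N(1) by (simp add: powr_times_real del: of_real_add)  simp
  qed
  have e2: "of_real N powr (- (s + of_nat k - 1)) = of_real N powr a * complex_of_real (1 / N) ^ k" for k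
  proof -
    have "of_real N powr (- (s + of_nat k - 1)) = complex_of_real N powr (a - of_nat k)"
      by (simp add: a_def algebra_simps)
    then show ?thesis using N(1) by (simp add: powr_diff powr_nat' power_divide)
  qed
  have "tail_term M n s = - (of_real N powr a * ((1 + of_real (1 / N)) powr a
          - (\<Sum>k\<le>M. (a gchoose k) * of_real (1 / N) ^ k)))"
  proof -
    have "{..M} = insert 0 {1..M}" by auto
    then have "(\<Sum>k\<le>M. (a gchoose k) * complex_of_real (1 / N) ^ k)
      = 1 + (\<Sum>k=1..M. (a gchoose k) * complex_of_real (1 / N) ^ k)" by simp
    then show ?thesis
      unfolding tail_term_def N(2,3) e2 a_def[symmetric] e1
      by (simp add: algebra_simps sum_distrib_left)
  qed
  then have "norm (tail_term M n s) = N powr Re a * norm ((1 + of_real (1 / N)) powr a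
          - (\<Sum>k\<le>M. (a gchoose k) * of_real (1 / N) ^ k))"
    using N(1) by (simp add: norm_mult norm_powr_real_powr)
  also have "\<dots> \<le> N powr Re a * ((\<Prod>j\<le>M. norm a + real j) * 2 powr norm a * (1 / N) ^ Suc M)"
    using N(1) by (intro mult_left_mono powr_Taylor_bound) auto
  also have "\<dots> \<le> N powr Re a * ((\<Prod>j\<le>M. 1 + r + real j) * 2 powr (1 + r) * (1 / N) ^ Suc M)"
    using N(1) na r by (intro mult_left_mono mult_right_mono mult_mono prod_mono powr_mono)
                      (auto intro!: prod_nonneg)
  also have "\<dots> = (\<Prod>j\<le>M. 1 + r + real j) * 2 powr (1 + r) * (N powr Re a * N powr (- real (Suc M)))"
    using N(1) by (simp add: powr_minus powr_realpow power_divide divide_simps del: of_nat_Suc power_Suc)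
  also have "N powr Re a * N powr (- real (Suc M)) = N powr (- Re s - real M)"
    by (simp flip: powr_add add: a_def algebra_simps)
  finally show ?thesis by (simp add: N_def)
qed

lemma summable_Suc_powr: "summable (\<lambda>n. real (Suc n) powr x) \<longleftrightarrow> x < -1"
  using summable_Suc_iff[of "\<lambda>n. real n powr x"] summable_real_powr_iff[of x] by simp

lemma sums_of_bound_holomorphic:
  fixes g :: "nat \<Rightarrow> complex \<Rightarrow> complex"
  assumes hol: "\<And>n. g n holomorphic_on {s. c < Re s}"
    and bound: "\<And>r n s. c < Re s \<Longrightarrow> norm s \<le> r \<Longrightarrow> norm (g n s) \<le> C r * real (Suc n) powr (- Re s + c - 1)"
    and C: "\<And>r. r \<ge> 0 \<Longrightarrow> 0 \<le> C r"
  shows "(\<lambda>s. \<Sum>n. g n s) holomorphic_on {s. c < Re s}"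
    and "c < Re s \<Longrightarrow> (\<lambda>n. g n s) sums (\<Sum>n. g n s)"
proof -
  show "(\<lambda>n. g n s) sums (\<Sum>n. g n s)" if "c < Re s"
  proof (rule summable_sums[OF summable_comparison_test'[where N = 0]])
    show "summable (\<lambda>n. C (norm s) * real (Suc n) powr (- Re s + c - 1))"
      using that by (intro summable_mult) (subst summable_Suc_powr, simp)
    show "norm (g n s) \<le> C (norm s) * real (Suc n) powr (- Re s + c - 1)" for n
      by (rule bound[OF that order_refl])
  qed
  show "(\<lambda>s. \<Sum>n. g n s) holomorphic_on {s. c < Re s}"
  proof (rule holomorphic_uniform_sequence[where f = "\<lambda>N s. \<Sum>n<N. g n s"])
    show "open {s. c < Re s}" by (rule open_halfspace_Re_gt)
    show "(\<lambda>s. \<Sum>n<N. g n s) holomorphic_on {s. c < Re s}" for N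
      by (intro holomorphic_intros hol)
    fix z assume z: "z \<in> {s. c < Re s}"
    define d where "d = (Re z - c) / 2"
    define r where "r = norm z + d"
    have d: "d > 0" "r \<ge> 0" using z by (auto simp: d_def r_def intro!: add_nonneg_nonneg)
    have *: "c + d \<le> Re s" "norm s \<le> r" if "s \<in> cball z d" for s
    proof -
      have "norm (s - z) \<le> d" using that by (simp add: dist_norm norm_minus_commute)
      moreover have "\<bar>Re (s - z)\<bar> \<le> norm (s - z)" by (rule abs_Re_le_cmod)
      moreover have "norm s \<le> norm z + norm (s - z)" using norm_triangle_ineq[of z "s - z"] by simp
      ultimately show "c + d \<le> Re s" "norm s \<le> r" by (auto simp: d_def r_def field_simps)
    qed
    have "uniform_limit (cball z d) (\<lambda>N s. \<Sum>n<N. g n s) (\<lambda>s. \<Sum>n. g n s) sequentially"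
    proof (rule Weierstrass_m_test[where M = "\<lambda>n. C r * real (Suc n) powr (- d - 1)"])
      show "summable (\<lambda>n. C r * real (Suc n) powr (- d - 1))"
        using d by (intro summable_mult) (subst summable_Suc_powr, simp)
      fix n s assume s: "s \<in> cball z d"
      have "norm (g n s) \<le> C r * real (Suc n) powr (- Re s + c - 1)"
        using *[OF s] d by (intro bound) auto
      also have "\<dots> \<le> C r * real (Suc n) powr (- d - 1)"
        using *[OF s] d C[of r] by (intro mult_left_mono powr_mono) auto
      finally show "norm (g n s) \<le> C r * real (Suc n) powr (- d - 1)" .
    qed
    moreover have "cball z d \<subseteq> {s. c < Re s}" using * d by force
    ultimately show "\<exists>d>0. cball z d \<subseteq> {s. c < Re s} \<and>
        uniform_limit (cball z d) (\<lambda>N s. \<Sum>n<N. g n s) (\<lambda>s. \<Sum>n. g n s) sequentially"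
      using d by blast
  qed
qed

definition dirichlet_sum :: "complex \<Rightarrow> complex" where
  "dirichlet_sum s = (\<Sum>n. of_nat (Suc n) powr (- s))"

lemma dirichlet_sum:
  shows "dirichlet_sum holomorphic_on {s. 1 < Re s}"
    and "1 < Re s \<Longrightarrow> (\<lambda>n. of_nat (Suc n) powr (- s)) sums dirichlet_sum s"
proof -
  have b: "norm (of_nat (Suc n) powr (- s) :: complex) \<le> 1 * real (Suc n) powr (- Re s + 1 - 1)" for n s
    using norm_powr_real_powr[of "of_nat (Suc n)" "-s"] by simp
  have h: "(\<lambda>s. of_nat (Suc n) powr (- s)) holomorphic_on {s. 1 < Re s}" for n
    by (intro holomorphic_intros) (auto simp del: of_nat_Suc)
  note * = sums_of_bound_holomorphic[where g = "\<lambda>n s. of_nat (Suc n) powr (- s)" and c = 1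
      and C = "\<lambda>_. 1", OF h b]
  show "dirichlet_sum holomorphic_on {s. 1 < Re s}"
    using *(1) unfolding dirichlet_sum_def by simp
  show "1 < Re s \<Longrightarrow> (\<lambda>n. of_nat (Suc n) powr (- s)) sums dirichlet_sum s"
    using *(2) unfolding dirichlet_sum_def by simp
qed

lemma tail_term_sums:
  shows "(\<lambda>s. \<Sum>n. tail_term M n s) holomorphic_on {s. 1 - real M < Re s}"
    and "1 - real M < Re s \<Longrightarrow> (\<lambda>n. tail_term M n s) sums (\<Sum>n. tail_term M n s)"
proof -
  have b: "norm (tail_term M n s) \<le> (\<Prod>j\<le>M. 1 + r + real j) * 2 powr (1 + r) * real (Suc n) powr (- Re s + (1 - real M) - 1)"
    if "norm s \<le> r" for r n s
  proof -
    have e: "- Re s + (1 - real M) - 1 = - Re s - real M" by simp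
    show ?thesis unfolding e by (rule tail_term_bound[OF that])
  qed
  have h: "tail_term M n holomorphic_on {s. 1 - real M < Re s}" for n
    unfolding tail_term_def gbinomial_pochhammer
    by (intro holomorphic_intros) (auto simp del: of_nat_Suc)
  note * = sums_of_bound_holomorphic[where g = "tail_term M" and c = "1 - real M"
      and C = "\<lambda>r. (\<Prod>j\<le>M. 1 + r + real j) * 2 powr (1 + r)", OF h b]
  show "(\<lambda>s. \<Sum>n. tail_term M n s) holomorphic_on {s. 1 - real M < Re s}"
    by (rule *(1)) (auto intro!: mult_nonneg_nonneg prod_nonneg)
  show "(\<lambda>n. tail_term M n s) sums (\<Sum>n. tail_term M n s)" if "1 - real M < Re s"
    by (rule *(2)[OF _ _ that]) (auto intro!: mult_nonneg_nonneg prod_nonneg)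
qed

lemma tail_term_suminf:
  assumes "1 < Re s"
  shows "(\<Sum>n. tail_term M n s) = 1 + (\<Sum>k=1..M. ((1 - s) gchoose k) * dirichlet_sum (s + of_nat k - 1))"
proof -
  have "(\<lambda>n. real (Suc n) powr (1 - Re s)) \<longlonglongrightarrow> 0"
    using assms by real_asymp
  then have "(\<lambda>n. of_nat (Suc n) powr (1 - s) :: complex) \<longlonglongrightarrow> 0"
    by (subst tendsto_norm_zero_iff[symmetric]) (simp add: norm_powr_real_powr del: of_nat_Suc)
  from telescope_sums'[OF this]
  have 1: "(\<lambda>n. of_nat (Suc n) powr (1 - s) - of_nat (Suc (Suc n)) powr (1 - s)) sums (1 :: complex)"
    by simp
  have 2: "(\<lambda>n. \<Sum>k=1..M. ((1 - s) gchoose k) * of_nat (Suc n) powr (- (s + of_nat k - 1)))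
          sums (\<Sum>k=1..M. ((1 - s) gchoose k) * dirichlet_sum (s + of_nat k - 1))"
    using assms by (intro sums_sum sums_mult dirichlet_sum(2)) auto
  show ?thesis
    using sums_add[OF 1 2] unfolding tail_term_def by (simp add: sums_iff)
qed

lemma gchoose_shift:
  "((1 - s) gchoose Suc k) = - (((1 - s) gchoose k) * (s + of_nat k - 1) / of_nat (Suc k))"
  for s :: complex
  by (simp add: gbinomial_prod_rev atLeast0LessThan divide_simps del: of_nat_Suc)
     (simp add: algebra_simps)

lemma zeta_continuation_step:
  "\<exists>Z. Z holomorphic_on {s. 1 - real m < Re s} \<and> (\<forall>s. 1 < Re s \<longrightarrow> Z s = (s - 1) * dirichlet_sum s)"
proof (induction m)
  case 0
  show ?case
    by (rule exI[of _ "\<lambda>s. (s - 1) * dirichlet_sum s"])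
       (auto intro!: holomorphic_intros dirichlet_sum(1))
next
  case (Suc m)
  then obtain Z where Z: "Z holomorphic_on {s. 1 - real m < Re s}"
    "\<And>s. 1 < Re s \<Longrightarrow> Z s = (s - 1) * dirichlet_sum s" by blast
  define Z' where "Z' = (\<lambda>s. 1 - (\<Sum>n. tail_term (Suc m) n s)
     - (\<Sum>k=1..m. ((1 - s) gchoose k) * Z (s + of_nat k) / of_nat (Suc k)))"
  have "Z' holomorphic_on {s. 1 - real (Suc m) < Re s}"
    unfolding Z'_def gbinomial_pochhammer
    by (intro holomorphic_intros tail_term_sums(1)
          holomorphic_on_compose_gen[OF _ Z(1), unfolded o_def]) auto
  moreover have "Z' s = (s - 1) * dirichlet_sum s" if s: "1 < Re s" for s
  proof -
    have "(\<Sum>n. tail_term (Suc m) n s)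
       = 1 + (\<Sum>k=0..m. ((1 - s) gchoose Suc k) * dirichlet_sum (s + of_nat k))"
      unfolding tail_term_suminf[OF s]
      using sum.shift_bounds_cl_Suc_ivl[of "\<lambda>k. ((1 - s) gchoose k) * dirichlet_sum (s + of_nat k - 1)" 0 m]
      by (simp add: add_ac)
    also have "(\<Sum>k=0..m. ((1 - s) gchoose Suc k) * dirichlet_sum (s + of_nat k))
       = (1 - s) * dirichlet_sum s + (\<Sum>k=1..m. ((1 - s) gchoose Suc k) * dirichlet_sum (s + of_nat k))"
      by (simp add: sum.atLeast_Suc_atMost)
    also have "(\<Sum>k=1..m. ((1 - s) gchoose Suc k) * dirichlet_sum (s + of_nat k))
       = - (\<Sum>k=1..m. ((1 - s) gchoose k) * Z (s + of_nat k) / of_nat (Suc k))"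
      unfolding sum_negf[symmetric]
    proof (rule sum.cong)
      fix k
      have "Z (s + of_nat k) = (s + of_nat k - 1) * dirichlet_sum (s + of_nat k)"
        using s by (intro Z(2)) auto
      then show "((1 - s) gchoose Suc k) * dirichlet_sum (s + of_nat k)
         = - (((1 - s) gchoose k) * Z (s + of_nat k) / of_nat (Suc k))"
        by (simp add: gchoose_shift)
    qed auto
    finally show ?thesis unfolding Z'_def by (simp add: algebra_simps)
  qed
  ultimately show ?case by blast
qed

lemma zeta_entire:
  "\<exists>Z. Z holomorphic_on UNIV \<and> (\<forall>s. 1 < Re s \<longrightarrow> Z s = (s - 1) * dirichlet_sum s)"
proof -
  obtain Z where Z: "\<And>m. Z m holomorphic_on {s. 1 - real m < Re s}"
    "\<And>m s. 1 < Re s \<Longrightarrow> Z m s = (s - 1) * dirichlet_sum s"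
    using zeta_continuation_step by metis
  have eq: "Z m s = Z n s" if "m \<le> n" "1 - real m < Re s" for m n s
  proof (rule analytic_continuation_open[where f = "Z m" and g = "Z n" and s = "{s. 1 < Re s}" and s' = "{s. 1 - real m < Re s}"])
    have "2 \<in> {s. 1 < Re s}" by simp
    then show "{s. 1 < Re s} \<noteq> {}" by blast
    show "connected {s. 1 - real m < Re s}"
      by (intro convex_connected convex_halfspace_Re_gt)
    show "Z n holomorphic_on {s. 1 - real m < Re s}"
      by (rule holomorphic_on_subset[OF Z(1)]) (use that in auto)
  qed (use that Z in \<open>auto simp: open_halfspace_Re_gt\<close>)
  define F where "F s = Z (nat \<lceil>2 - Re s\<rceil>) s" for s
  have F: "F s = Z m s" if "1 - real m < Re s" for m s
  proof -
    have "1 - real (nat \<lceil>2 - Re s\<rceil>) < Re s" by linarith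
    then show ?thesis
      unfolding F_def using eq that by (metis nat_le_linear)
  qed
  have "F holomorphic_on (\<Union>m. {s. 1 - real m < Re s})"
  proof (rule holomorphic_on_UN_open)
    show "F holomorphic_on {s. 1 - real m < Re s}" for m
      using Z(1)[of m] by (subst holomorphic_cong[OF refl F]) auto
  qed (auto simp: open_halfspace_Re_gt)
  also have "(\<Union>m. {s. 1 - real m < Re s}) = UNIV"
  proof -
    have "\<exists>m. 1 - real m < Re s" for s
      using reals_Archimedean2[of "1 - Re s"] by (auto simp: algebra_simps)
    then show ?thesis by auto
  qed
  finally have "F holomorphic_on UNIV" .
  moreover have "F s = (s - 1) * dirichlet_sum s" if "1 < Re s" for s
    using F[of 0 s] Z(2)[OF that] that by simp
  ultimately show ?thesis by blast
qed

lemma ex1_riemann_zeta: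
  "\<exists>!f. f holomorphic_on -{1} \<and>
     (\<forall>s. 1 < Re s \<longrightarrow> (\<lambda>n. of_nat (Suc n) powr (-s)) sums f s) \<and> f 1 = (0 :: complex)"
proof (rule ex_ex1I)
  obtain Z where Z: "Z holomorphic_on UNIV" "\<And>s. 1 < Re s \<Longrightarrow> Z s = (s - 1) * dirichlet_sum s"
    using zeta_entire by blast
  have "(\<lambda>s. Z s / (s - 1)) holomorphic_on -{1}"
    by (intro holomorphic_intros holomorphic_on_subset[OF Z(1)]) auto
  moreover have "(\<lambda>n. of_nat (Suc n) powr (-s)) sums (Z s / (s - 1))" if "1 < Re s" for s
    using dirichlet_sum(2)[OF that] Z(2)[OF that] that by (cases "s = 1") auto
  ultimately show "\<exists>f. f holomorphic_on -{1} \<and>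
     (\<forall>s. 1 < Re s \<longrightarrow> (\<lambda>n. of_nat (Suc n) powr (-s)) sums f s) \<and> f 1 = (0 :: complex)"
    by (intro exI[of _ "\<lambda>s. Z s / (s - 1)"]) auto
next
  fix f g :: "complex \<Rightarrow> complex"
  assume f: "f holomorphic_on -{1} \<and> (\<forall>s. 1 < Re s \<longrightarrow> (\<lambda>n. of_nat (Suc n) powr (-s)) sums f s) \<and> f 1 = 0"
  assume g: "g holomorphic_on -{1} \<and> (\<forall>s. 1 < Re s \<longrightarrow> (\<lambda>n. of_nat (Suc n) powr (-s)) sums g s) \<and> g 1 = 0"
  have "f s = g s" if "s \<noteq> 1" for s
  proof (rule analytic_continuation_open[where f = f and g = g and s = "{s. 1 < Re s}" and s' = "-{1}"])
    have "2 \<in> {s. 1 < Re s}" by simp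
    then show "{s. 1 < Re s} \<noteq> {}" by blast
    show "connected (-{1::complex})"
      by (rule connected_punctured_universe) simp
    show "f s = g s" if "s \<in> {s. 1 < Re s}" for s
      using f g that by (blast intro: sums_unique2)
  qed (use f g that in \<open>auto simp: open_halfspace_Re_gt\<close>)
  then show "f = g"
    using f g by (intro ext) metis
qed

lemma riemann_zeta:
  shows riemann_zeta_holomorphic: "riemann_zeta holomorphic_on -{1}"
    and riemann_zeta_sums: "1 < Re s \<Longrightarrow> (\<lambda>n. of_nat (Suc n) powr (-s)) sums riemann_zeta s"
  using theI'[OF ex1_riemann_zeta] unfolding riemann_zeta_def[symmetric] by auto

end

theory Submission
  imports Defs "HOL-Number_Theory.Prime_Powers" "HOL-Computational_Algebra.Squarefree"
    "HOL-Probability.Sinc_Integral"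
begin

text \<open>
  For \<open>Re s > 1\<close> one has \<open>log \<zeta>(s) = \<Sum> a(n) n\<^sup>-\<^sup>s\<close> with \<open>a(n) = \<Lambda>(n) / log n \<ge> 0\<close>, supported on prime
  powers. The pigeonhole principle produces many \<open>t\<close> for which \<open>cos (t log n) \<ge> 1/2\<close> at all prime
  powers \<open>n\<close> of a prescribed range (\<open>simultaneous_cos_ge_half\<close>); by itself this favours large values of
  \<open>|\<zeta>|\<close>. Following Montgomery, the sign is reversed by averaging \<open>log |\<zeta>(\<sigma> + i(t + u))|\<close> over \<open>u\<close> with the
  nonnegative weight \<open>K(u) = (1 - cos (u log Y)) F(u)\<close>, where the Fejer kernel \<open>F\<close> has a triangle of
  bounded width as its Fourier transform. Apart from boundedly many small \<open>n\<close>, the transform of \<open>K\<close> at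
  \<open>log n\<close> is minus one half of a triangle centred at \<open>log Y\<close>. Hence the average of \<open>- log |\<zeta>|\<close> is, up to
  \<open>O(1)\<close>, half the sum of \<open>a(n) n\<^sup>-\<^sup>\<sigma> cos (t log n)\<close> against this triangle: only \<open>n\<close> within a constant
  factor of \<open>Y\<close> matter, and all of them push in the same direction
  (\<open>smoothed_log_zeta_inequality\<close>). Chebyshev's bounds make the sum of order \<open>Y\<^sup>1\<^sup>-\<^sup>\<sigma> / log Y\<close>.

  The size of \<open>Y\<close> is limited by the pigeonhole principle. Among the multiples of a fixed step in
  \<open>[0, T]\<close> it loses a factor \<open>6\<close> for each of the \<open>O(Y / log Y)\<close> prime powers near \<open>Y\<close>. With \<open>Y\<close> a small
  multiple of \<open>\<kappa> log T log log T\<close>, about \<open>T\<^sup>1\<^sup>-\<^sup>\<kappa>\<^sup>/\<^sup>8\<close> points survive. That is more than \<open>T\<^sup>\<beta>\<close> since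
  \<open>\<kappa> < 1 - \<beta>\<close>, and \<open>Y\<^sup>1\<^sup>-\<^sup>\<sigma> / log Y\<close> is then of the order
  \<open>\<kappa>\<^sup>1\<^sup>-\<^sup>\<sigma> (log T)\<^sup>1\<^sup>-\<^sup>\<sigma> / (log log T)\<^sup>\<sigma>\<close> with an absolute constant.

  The averaging formula needs a holomorphic \<open>log \<zeta>\<close> on a box around \<open>\<sigma> + it\<close> whose height is a power of
  \<open>log T\<close>. Put \<open>\<eta> = (\<sigma> - 1/2) / 2\<close>. Boxes that contain a zero with real part at least \<open>1/2 + \<eta>\<close> number
  \<open>O(T\<^sup>1\<^sup>-\<^sup>\<eta>\<^sup>/\<^sup>4)\<close> (\<open>zero_density\<close>), so \<open>\<kappa> < \<sigma> - 1/2 = 2\<eta>\<close> leaves surviving points in zero-free boxes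
  (\<open>good_point_exists\<close>). It matters that the exponent saves a multiple of \<open>\<eta>\<close> and not of \<open>\<eta>\<^sup>2\<close>, because
  the constant must be uniform as \<open>\<sigma>\<close> tends to \<open>1/2\<close>. To get this, multiply \<open>\<zeta>\<close> by
  \<open>M(s) = \<Sum>\<^sub>n\<^sub>\<le>\<^sub>X \<mu>(n) n\<^sup>-\<^sup>s\<close>: the function \<open>f = \<zeta>M - 1\<close> equals \<open>-1\<close> at a zero of \<open>\<zeta>\<close> and is tiny far to the
  right, so Cauchy's formula with a weight \<open>W\<^sup>s\<^sup>-\<^sup>\<rho>\<close> forces the integral of \<open>|f|\<close> over the critical line
  near \<open>\<rho>\<close> to be large. The first power of \<open>|f|\<close> is at most \<open>1 + |\<zeta>|\<^sup>2 + |M|\<^sup>2\<close>, and both mean squares are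
  \<open>O(T\<^sup>1\<^sup>+\<^sup>\<epsilon>)\<close>: for \<open>M\<close> by the mean value theorem for Dirichlet polynomials, and for \<open>\<zeta>\<close> because
  \<open>(1 - 2\<^sup>1\<^sup>-\<^sup>s) \<zeta>(s)\<close> is an alternating series whose tail Euler's transformation makes negligible.

  Finally \<open>min 1 ((e\<^sup>2 - e) l / (l + 1))\<close> is at most \<open>9 \<surd>l\<close>, so the factor \<open>\<upsilon>(\<sigma>) / \<surd>l\<close> of the claim is
  bounded by an absolute constant when \<open>\<upsilon>\<close> is twice its prescribed lower bound.
\<close>

section \<open>Chebyshev bounds and the number of prime powers\<close>

definition chebyshev_psi :: "nat \<Rightarrow> real" where
  "chebyshev_psi n = (\<Sum>d=1..n. mangoldt d)"

text \<open>
  The upper summation limit is decoupled from \<open>n\<close> so that the factorials of \<open>n\<close> and \<open>2n\<close> can be compared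
  over the same range.
\<close>

lemma ln_fact_mangoldt:
  assumes "n \<le> N"
  shows "ln (fact n) = (\<Sum>d=1..N. mangoldt d * real (n div d))"
  using assms
proof (induction n)
  case (Suc n)
  have "(\<Sum>d=1..N. mangoldt d * real (Suc n div d))
    = (\<Sum>d=1..N. mangoldt d * real (n div d) + (if d dvd Suc n then mangoldt d else 0))"
    by (intro sum.cong refl) (auto simp: div_Suc mod_eq_0_iff_dvd algebra_simps)
  also have "\<dots> = (\<Sum>d=1..N. mangoldt d * real (n div d)) + (\<Sum>d | d dvd Suc n. mangoldt d)"
  proof -
    have "(\<Sum>d=1..N. if d dvd Suc n then mangoldt d else (0::real)) = (\<Sum>d | d dvd Suc n. mangoldt d)"
      using Suc.prems by (intro sum.mono_neutral_cong_right) (auto intro: order.trans[OF dvd_imp_le] intro!: Suc_leI Nat.gr0I)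
    then show ?thesis by (simp add: sum.distrib)
  qed
  also have "\<dots> = ln (fact n) + ln (real (Suc n))"
    using Suc by (subst mangoldt_sum) auto
  also have "\<dots> = ln (fact (Suc n))"
    by (simp add: ln_mult algebra_simps del: of_nat_Suc)
  finally show ?case by simp
qed simp

lemma ln_central_binomial:
  "ln (real (2 * n choose n)) = (\<Sum>d=1..2*n. mangoldt d * (real (2 * n div d) - 2 * real (n div d)))"
proof -
  have "real (2 * n choose n) = fact (2 * n) / (fact n * fact n)"
    by (subst binomial_fact) auto
  then have "ln (real (2 * n choose n)) = ln (fact (2 * n)) - 2 * ln (fact n)"
    by (simp add: ln_div ln_mult)
  also have "\<dots> = (\<Sum>d=1..2*n. mangoldt d * (real (2 * n div d) - 2 * real (n div d)))"
    by (subst (1 2) ln_fact_mangoldt[of _ "2 * n"])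
       (auto simp: sum_subtractf sum_distrib_left algebra_simps)
  finally show ?thesis .
qed

lemma double_div_bounds:
  fixes n d :: nat
  assumes "d > 0"
  shows "2 * real (n div d) \<le> real (2 * n div d)" "real (2 * n div d) \<le> 2 * real (n div d) + 1"
proof -
  have "n = d * (n div d) + n mod d" and "n mod d < d" using assms by auto
  have 1: "2 * n = d * (2 * (n div d)) + 2 * (n mod d)"
    using arg_cong[OF \<open>n = _\<close>, of "\<lambda>x. 2 * x"] by (simp only: distrib_left mult.left_commute)
  have "2 * n div d = 2 * (n div d) + 2 * (n mod d) div d"
    by (subst 1) (use assms in simp)
  moreover have "2 * (n mod d) div d < 2"
    using \<open>n mod d < d\<close> by (simp only: div_less_iff_less_mult assms)
  ultimately have "2 * (n div d) \<le> 2 * n div d" "2 * n div d \<le> 2 * (n div d) + 1" by linarith+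
  then show "2 * real (n div d) \<le> real (2 * n div d)" "real (2 * n div d) \<le> 2 * real (n div d) + 1"
    by linarith+
qed

text \<open>
  Chebyshev's argument: in the logarithm of the central binomial coefficient every prime power is
  weighted by \<open>0\<close> or \<open>1\<close>, and by exactly \<open>1\<close> if it lies in \<open>(n, 2n]\<close>. The two observations give the
  lower bound here and the upper bound in the next lemma.
\<close>

lemma chebyshev_psi_double_lower:
  assumes "n > 0"
  shows "2 * real n * ln 2 - ln (2 * real n) \<le> chebyshev_psi (2 * n)"
proof -
  have "2 * real n * ln 2 - ln (2 * real n) = ln (4 ^ n / (2 * real n))"
  proof -
    have "ln (4::real) = 2 * ln 2" using ln_realpow[of 2 2] by simp
    then show ?thesis using assms by (simp add: ln_div ln_realpow)
  qed
  also have "\<dots> \<le> ln (real (2 * n choose n))"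
    using central_binomial_lower_bound[OF assms] assms by (intro ln_mono) auto
  also have "\<dots> \<le> chebyshev_psi (2 * n)"
    unfolding ln_central_binomial chebyshev_psi_def
  proof (intro sum_mono)
    fix d assume "d \<in> {1..2 * n}"
    then have "real (2 * n div d) - 2 * real (n div d) \<le> 1"
      using double_div_bounds(2)[of d n] by auto
    then show "mangoldt d * (real (2 * n div d) - 2 * real (n div d)) \<le> mangoldt d"
      using mangoldt_nonneg[of d] by (metis mult.commute mult_left_le_one_le mult_left_mono mult.right_neutral)
  qed
  finally show ?thesis .
qed

lemma chebyshev_psi_double_diff:
  "chebyshev_psi (2 * n) - chebyshev_psi n \<le> 2 * real n * ln 2"
proof -
  have "chebyshev_psi (2 * n) - chebyshev_psi n = (\<Sum>d\<in>{n<..2*n}. mangoldt d)"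
  proof -
    have "{1..2*n} = {1..n} \<union> {n<..2*n}" by auto
    then have "chebyshev_psi (2 * n) = chebyshev_psi n + (\<Sum>d\<in>{n<..2*n}. mangoldt d)"
      unfolding chebyshev_psi_def by (simp add: sum.union_disjoint Int_def)
    then show ?thesis by simp
  qed
  also have "\<dots> = (\<Sum>d\<in>{n<..2*n}. mangoldt d * (real (2 * n div d) - 2 * real (n div d)))"
  proof (intro sum.cong refl)
    fix d assume d: "d \<in> {n<..2*n}"
    then have "n div d = 0" "2 * n div d = 1"
      by (auto simp: div_eq_0_iff intro!: div_nat_eqI)
    then show "mangoldt d = mangoldt d * (real (2 * n div d) - 2 * real (n div d))" by simp
  qed
  also have "\<dots> \<le> (\<Sum>d=1..2*n. mangoldt d * (real (2 * n div d) - 2 * real (n div d)))"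
  proof (intro sum_mono2)
    fix d assume "d \<in> {1..2 * n} - {n<..2*n}"
    then have "2 * real (n div d) \<le> real (2 * n div d)"
      using double_div_bounds(1)[of d n] by auto
    then show "0 \<le> mangoldt d * (real (2 * n div d) - 2 * real (n div d))"
      using mangoldt_nonneg[of d] by (intro mult_nonneg_nonneg) auto
  qed auto
  also have "\<dots> = ln (real (2 * n choose n))" by (rule ln_central_binomial[symmetric])
  also have "\<dots> \<le> ln (2 ^ (2 * n))"
  proof -
    have "real (2 * n choose n) \<le> real (2 ^ (2 * n))"
      using binomial_le_pow2[of "2*n" n] of_nat_le_iff by blast
    then show ?thesis by (intro ln_mono) (auto simp: zero_less_binomial)
  qed
  also have "\<dots> = 2 * real n * ln 2" by (simp add: ln_realpow)
  finally show ?thesis .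
qed

lemma chebyshev_psi_le: "chebyshev_psi n \<le> 3 * real n"
proof (induction n rule: less_induct)
  case (less n)
  have ln2: "ln (2::real) \<le> 0.7" by (rule ln2_le_25_over_36[THEN order.trans]) simp
  consider "n = 0" | k where "n = 2 * k" "k > 0" | k where "n = Suc (2 * k)"
    by (metis evenE oddE Suc_eq_plus1 mult_eq_0_iff not_gr0)
  then show ?case
  proof cases
    case 1 then show ?thesis by (simp add: chebyshev_psi_def)
  next
    case (2 k)
    have "chebyshev_psi k \<le> 3 * real k" using 2 by (intro less) auto
    moreover have "2 * real k * ln 2 \<le> 2 * real k * 0.7" using ln2 by (intro mult_left_mono) auto
    ultimately show ?thesis using chebyshev_psi_double_diff[of k] unfolding 2(1) of_nat_mult of_nat_numeral by linarith
  next
    case (3 k)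
    have "chebyshev_psi k \<le> 3 * real k"
      by (cases "k = 0") (use 3 in \<open>auto intro!: less\<close>, simp add: chebyshev_psi_def)
    moreover have "2 * real k * ln 2 \<le> 2 * real k * 0.7" using ln2 by (intro mult_left_mono) auto
    moreover have "chebyshev_psi n = chebyshev_psi (2 * k) + mangoldt n"
      using 3 by (simp add: chebyshev_psi_def)
    moreover have "mangoldt n \<le> ln (real n)" using 3 by (intro mangoldt_le) auto
    moreover have "ln (real n) \<le> real k + 1"
    proof -
      have "ln (real n / 2) \<le> real n / 2 - 1" using 3 by (intro ln_le_minus_one) auto
      then show ?thesis using 3 ln2 by (simp add: ln_div)
    qed
    moreover have "real n = 2 * real k + 1" using 3 by simp
    ultimately show ?thesis using chebyshev_psi_double_diff[of k] by linarith
  qed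
qed

text \<open>
  The ratio \<open>16\<close> is large enough for the crude constants \<open>2/3 \<le> log 2\<close> below and \<open>3\<close> above.
\<close>

lemma chebyshev_psi_16_diff: "\<forall>\<^sub>F m in sequentially. 7 * real m \<le> chebyshev_psi (16 * m) - chebyshev_psi m"
proof -
  have "\<forall>\<^sub>F m in sequentially. 10 * real m \<le> 0.66 * (16 * real m) - ln (16 * real m)" by real_asymp
  then show ?thesis using eventually_gt_at_top[of 0]
  proof eventually_elim
    case (elim m)
    have "(0.66::real) \<le> ln 2" using ln2_ge_two_thirds by simp
    then have "0.66 * (16 * real m) \<le> ln 2 * (16 * real m)" by (intro mult_right_mono) auto
    moreover have "ln 2 * (16 * real m) - ln (16 * real m) \<le> chebyshev_psi (16 * m)"
      using chebyshev_psi_double_lower[of "8 * m"] elim by (simp add: mult_ac)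
    ultimately show ?case
      using elim chebyshev_psi_le[of m] by linarith
  qed
qed

text \<open>
  Each prime above \<open>\<surd>x\<close> contributes at least \<open>(log x) / 2\<close> to \<open>\<psi>(x)\<close>. Everything else is at most \<open>\<surd>x\<close>, or a
  power \<open>q\<^sup>k\<close> with \<open>q \<le> \<surd>x\<close> and \<open>k \<le> log\<^sub>2 x\<close>.
\<close>

lemma card_primepow_le:
  "\<forall>\<^sub>F x in sequentially. real (card {n\<in>{1..x}. primepow n}) \<le> 7 * real x / ln (real x)"
proof -
  have A: "real (card {n\<in>{1..x}. primepow n})
      \<le> 6 * real x / ln (real x) + sqrt (real x) + sqrt (real x) * (ln (real x) / ln 2)" if x: "x > 1" for x :: nat
  proof -
    define s where "s = sqrt (real x)"
    have s: "s > 1" "s ^ 2 = real x" using x by (auto simp: s_def)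
    define r where "r = nat \<lfloor>s\<rfloor>"
    have r: "real r \<le> s" using s by (simp add: r_def)
    have lerI: "q \<le> r" if "real q \<le> s" for q using that s by (simp add: r_def le_nat_floor)
    define l where "l = nat \<lfloor>ln (real x) / ln 2\<rfloor>"
    have l: "real l \<le> ln (real x) / ln 2" using x by (simp add: l_def)
    define P1 where "P1 = {p. prime p \<and> p \<le> x \<and> s < real p}"
    define P3 where "P3 = (\<lambda>(q,k). q ^ k) ` ({1..r} \<times> {1..l})"
    have fin: "finite P1" "finite P3" by (auto simp: P1_def P3_def)
    have "{n\<in>{1..x}. primepow n} \<subseteq> P1 \<union> ({1..r} \<union> P3)"
    proof
      fix n assume n: "n \<in> {n\<in>{1..x}. primepow n}"
      then obtain p k where pk: "prime p" "k > 0" "n = p ^ k" by (auto simp: primepow_def)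
      show "n \<in> P1 \<union> ({1..r} \<union> P3)"
      proof (cases "k = 1")
        case True
        then show ?thesis using n pk lerI[of n] by (cases "s < real n") (auto simp only: P1_def, auto)
      next
        case False
        have p: "p \<ge> 2" using pk prime_ge_2_nat by blast
        have "p ^ 2 \<le> p ^ k" using False pk p by (intro power_increasing) auto
        then have "p ^ 2 \<le> x" using n pk by auto
        then have "real (p ^ 2) \<le> real x" by (simp only: of_nat_le_iff)
        then have "(real p) ^ 2 \<le> s ^ 2" using s(2) by simp
        then have "real p \<le> s" by (rule power2_le_imp_le) (use s(1) in linarith)
        moreover have "k \<le> l"
        proof -
          have "2 ^ k \<le> p ^ k" using p by (intro power_mono) auto
          then have "2 ^ k \<le> x" by (rule order.trans) (use n pk in auto)
          then have "(2::real) ^ k \<le> real x" by (metis of_nat_le_iff of_nat_numeral of_nat_power)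
          then have "ln ((2::real) ^ k) \<le> ln (real x)" by (intro ln_mono) auto
          then have "real k \<le> ln (real x) / ln 2" by (simp add: ln_realpow field_simps)
          then show ?thesis using x by (simp add: l_def le_nat_floor)
        qed
        ultimately have "(p, k) \<in> {1..r} \<times> {1..l}"
          using lerI[of p] p pk(2) by simp
        then have "p ^ k \<in> P3" unfolding P3_def by (rule image_eqI[rotated]) simp
        then show ?thesis using pk(3) by simp
      qed
    qed
    then have "card {n\<in>{1..x}. primepow n} \<le> card (P1 \<union> ({1..r} \<union> P3))"
      using fin by (intro card_mono) auto
    also have "\<dots> \<le> card P1 + (card {1..r} + card P3)"
      by (meson add_left_mono card_Un_le order_trans)
    also have "card P3 \<le> r * l"
      unfolding P3_def using card_image_le[of "{1..r} \<times> {1..l}"] by fastforce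
    finally have 1: "real (card {n\<in>{1..x}. primepow n}) \<le> real (card P1) + (real r + real r * real l)"
      by (simp flip: of_nat_mult of_nat_add)
    have "real (card P1) * (ln (real x) / 2) = (\<Sum>p\<in>P1. ln (real x) / 2)" by simp
    also have "\<dots> \<le> (\<Sum>p\<in>P1. mangoldt p)"
    proof (intro sum_mono)
      fix p assume p: "p \<in> P1"
      then have "ln s \<le> ln (real p)" using s by (intro ln_mono) (auto simp: P1_def)
      then show "ln (real x) / 2 \<le> mangoldt p" using p x by (simp add: P1_def s_def ln_sqrt)
    qed
    also have "\<dots> \<le> chebyshev_psi x" unfolding chebyshev_psi_def
      by (intro sum_mono2) (auto simp: P1_def mangoldt_nonneg intro!: Suc_leI prime_gt_0_nat)
    also have "\<dots> \<le> 3 * real x" by (rule chebyshev_psi_le)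
    finally have "real (card P1) \<le> 6 * real x / ln (real x)" using x by (simp add: field_simps)
    moreover have "real r * real l \<le> s * (ln (real x) / ln 2)"
      using r l s x by (intro mult_mono) auto
    ultimately show ?thesis using 1 r unfolding s_def by linarith
  qed
  have "\<forall>\<^sub>F x in sequentially. 6 * real x / ln (real x) + sqrt (real x) + sqrt (real x) * (ln (real x) / ln 2)
     \<le> 7 * real x / ln (real x)" by real_asymp
  then show ?thesis using eventually_gt_at_top[of 1]
    by eventually_elim (use A in force)
qed

section \<open>The Moebius function and products with zeta\<close>

definition moebius_mu :: "nat \<Rightarrow> real" where
  "moebius_mu n = (if squarefree n then (-1) ^ card (prime_factors n) else 0)"

lemma abs_moebius_mu_le: "\<bar>moebius_mu n\<bar> \<le> 1"
  by (simp add: moebius_mu_def)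

lemma moebius_mu_1 [simp]: "moebius_mu (Suc 0) = 1"
  by (simp add: moebius_mu_def)

lemma moebius_mu_prime_times:
  assumes "prime p" "\<not> p dvd e"
  shows "moebius_mu (p * e) = - moebius_mu e"
proof -
  have "e \<noteq> 0" using assms(2) by (metis dvd_0_right)
  have "coprime p e" using assms by (simp add: prime_imp_coprime)
  then have "squarefree (p * e) \<longleftrightarrow> squarefree e"
    using assms squarefree_mult_coprime[of p e] squarefree_prime[of p] squarefree_multD by auto
  moreover have "prime_factors (p * e) = insert p (prime_factors e)"
    using assms \<open>e \<noteq> 0\<close> by (simp add: prime_factors_product prime_prime_factors)
  moreover have "p \<notin> prime_factors e" using assms by auto
  ultimately show ?thesis by (simp add: moebius_mu_def)
qed

text \<open>
  For a prime \<open>p\<close> dividing \<open>n\<close>, the divisors prime to \<open>p\<close> cancel against their multiples by \<open>p\<close>; the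
  remaining divisors are divisible by \<open>p\<^sup>2\<close>.
\<close>

lemma sum_moebius_mu_divisors:
  assumes "n > 1"
  shows "(\<Sum>d | d dvd n. moebius_mu d) = 0"
proof -
  obtain p where p: "prime p" "p dvd n" using assms prime_factor_nat[of n] by auto
  define k where "k = multiplicity p n"
  obtain m where m: "n = p ^ k * m" "\<not> p dvd m"
  proof (rule that)
    show "n = p ^ k * (n div p ^ k)" unfolding k_def by (simp add: multiplicity_dvd)
    show "\<not> p dvd n div p ^ k" unfolding k_def
      using p assms by (intro multiplicity_decompose) (auto simp: prime_nat_iff)
  qed
  have k: "k > 0" using p m by (metis not_gr0 power_0 mult_1)
  have "m > 0" using m assms by (auto intro: Nat.gr0I)
  have fin: "finite {e. e dvd m}" using \<open>m > 0\<close> by auto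
  have "(\<Sum>d | d dvd n. moebius_mu d) = (\<Sum>d\<in>{e. e dvd m} \<union> (*) p ` {e. e dvd m}. moebius_mu d)"
  proof (rule sum.mono_neutral_right)
    show "finite {d. d dvd n}" using assms by auto
    show "{e. e dvd m} \<union> (*) p ` {e. e dvd m} \<subseteq> {d. d dvd n}"
    proof -
      have "p * e dvd n" if "e dvd m" for e
        unfolding m(1) using k that by (intro mult_dvd_mono) (auto intro: dvd_power)
      then show ?thesis using m by auto
    qed
    have dvdm: "e dvd m" if "e dvd n" "\<not> p dvd e" for e
    proof -
      have "coprime p e" using that(2) p by (simp add: prime_imp_coprime)
      then have "coprime e (p ^ k)" by (simp add: coprime_commute)
      then show ?thesis using that m by (simp add: coprime_dvd_mult_right_iff)
    qed
    show "\<forall>d\<in>{d. d dvd n} - ({e. e dvd m} \<union> (*) p ` {e. e dvd m}). moebius_mu d = 0"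
    proof
      fix d assume d: "d \<in> {d. d dvd n} - ({e. e dvd m} \<union> (*) p ` {e. e dvd m})"
      then have "p dvd d" using dvdm by auto
      then obtain e where e: "d = p * e" by auto
      have "p dvd e"
      proof (rule ccontr)
        assume "\<not> p dvd e"
        then have "e dvd m" using d e dvdm[of e] dvd_mult_right by blast
        then show False using d e by auto
      qed
      then have "p ^ 2 dvd d" using e by (auto simp: power2_eq_square)
      then have "\<not> squarefree d" using p by (auto simp: squarefree_def)
      then show "moebius_mu d = 0" by (simp add: moebius_mu_def)
    qed
  qed
  also have "\<dots> = (\<Sum>d | d dvd m. moebius_mu d) + (\<Sum>d\<in>(*) p ` {e. e dvd m}. moebius_mu d)"
    using fin m(2) by (intro sum.union_disjoint) auto
  also have "(\<Sum>d\<in>(*) p ` {e. e dvd m}. moebius_mu d) = (\<Sum>e | e dvd m. moebius_mu (p * e))"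
    using p by (subst sum.reindex) (auto simp: inj_on_def)
  also have "\<dots> = (\<Sum>e | e dvd m. - moebius_mu e)"
    using p m(2) by (intro sum.cong refl moebius_mu_prime_times) auto
  finally show ?thesis by (simp add: sum_negf)
qed

text \<open>
  Restricting the zeta series to multiples of \<open>d\<close> is a reindexing. Finite combinations of it express
  the product of zeta with a Dirichlet polynomial, with no rearrangement of a double series.
\<close>

lemma sums_zeta_multiples:
  assumes "1 < Re s" "d > 0"
  shows "(\<lambda>n. if d dvd Suc n then of_nat (Suc n) powr (-s) else 0) sums (of_nat d powr (-s) * riemann_zeta s)"
proof -
  define g where "g = (\<lambda>k. d * Suc k - 1)"
  have g: "Suc (g k) = d * Suc k" for k using assms by (simp add: g_def)
  have mono: "strict_mono g" unfolding strict_mono_Suc_iff using assms by (auto simp: g_def)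
  have rng: "n \<in> range g" if dv: "d dvd Suc n" for n
  proof -
    obtain k where k: "Suc n = d * k" using dv by (elim dvdE)
    then obtain j where "k = Suc j" by (cases k) auto
    then have "n = g j" using k g[of j] by simp
    then show ?thesis by auto
  qed
  have "(\<lambda>k. of_nat d powr (-s) * of_nat (Suc k) powr (-s)) sums (of_nat d powr (-s) * riemann_zeta s)"
    by (intro sums_mult riemann_zeta_sums assms)
  also have "(\<lambda>k. of_nat d powr (-s) * of_nat (Suc k) powr (-s))
    = (\<lambda>k. if d dvd Suc (g k) then of_nat (Suc (g k)) powr (-s) else (0::complex))"
  proof
    fix k
    have "complex_of_nat (d * Suc k) powr (-s) = of_nat d powr (-s) * of_nat (Suc k) powr (-s)"
      unfolding of_nat_mult by (rule powr_times_real) auto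
    then show "of_nat d powr (-s) * of_nat (Suc k) powr (-s)
      = (if d dvd Suc (g k) then of_nat (Suc (g k)) powr (-s) else (0::complex))" unfolding g by simp
  qed
  finally show ?thesis
    using rng by (subst (asm) sums_mono_reindex[OF mono]) auto
qed

lemma sums_zeta_times_dirichlet_poly:
  fixes b :: "nat \<Rightarrow> real"
  assumes "1 < Re s"
  shows "(\<lambda>n. of_real (\<Sum>d | d dvd Suc n \<and> d \<le> D. b d) * of_nat (Suc n) powr (-s)) sums
     (riemann_zeta s * (\<Sum>d=1..D. of_real (b d) * of_nat d powr (-s)))"
proof -
  have "(\<lambda>n. \<Sum>d=1..D. of_real (b d) * (if d dvd Suc n then of_nat (Suc n) powr (-s) else 0)) sums
     (\<Sum>d=1..D. of_real (b d) * (of_nat d powr (-s) * riemann_zeta s))"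
    using assms by (intro sums_sum sums_mult sums_zeta_multiples) auto
  also have "(\<lambda>n. \<Sum>d=1..D. of_real (b d) * (if d dvd Suc n then of_nat (Suc n) powr (-s) else 0))
    = (\<lambda>n. of_real (\<Sum>d | d dvd Suc n \<and> d \<le> D. b d) * of_nat (Suc n) powr (-s))"
  proof
    fix n
    have "(\<Sum>d=1..D. of_real (b d) * (if d dvd Suc n then of_nat (Suc n) powr (-s) else 0))
      = (\<Sum>d | d dvd Suc n \<and> d \<le> D. of_real (b d) * of_nat (Suc n) powr (-s))"
      by (intro sum.mono_neutral_cong_right) (auto intro!: Suc_leI Nat.gr0I)
    then show "(\<Sum>d=1..D. of_real (b d) * (if d dvd Suc n then of_nat (Suc n) powr (-s) else 0))
      = of_real (\<Sum>d | d dvd Suc n \<and> d \<le> D. b d) * of_nat (Suc n) powr (-s)"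
      by (simp add: sum_distrib_right)
  qed
  also have "(\<Sum>d=1..D. of_real (b d) * (of_nat d powr (-s) * riemann_zeta s))
    = riemann_zeta s * (\<Sum>d=1..D. of_real (b d) * of_nat d powr (-s))"
    by (simp add: sum_distrib_left mult_ac)
  finally show ?thesis .
qed

section \<open>The logarithm of zeta to the right of 1\<close>

lemma norm_Suc_powr: "norm (of_nat (Suc n) powr s :: complex) = real (Suc n) powr Re s"
  using norm_powr_real_powr[of "of_nat (Suc n)" s] by simp

lemma dirichlet_series_deriv:
  fixes b :: "nat \<Rightarrow> real"
  assumes b: "\<And>n. \<bar>b n\<bar> \<le> 1"
  obtains g g' where
    "\<And>s. 1 < Re s \<Longrightarrow> (\<lambda>n. of_real (b n) * of_nat (Suc n) powr (-s)) sums g s"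
    "\<And>s. 1 < Re s \<Longrightarrow> (\<lambda>n. - of_real (b n * ln (real (Suc n))) * of_nat (Suc n) powr (-s)) sums g' s"
    "\<And>s. 1 < Re s \<Longrightarrow> (g has_field_derivative g' s) (at s)"
proof -
  have "\<exists>g g'. \<forall>x\<in>{s. 1 < Re s}. ((\<lambda>n. of_real (b n) * of_nat (Suc n) powr (-x)) sums g x) \<and>
     ((\<lambda>n. - of_real (b n * ln (real (Suc n))) * of_nat (Suc n) powr (-x)) sums g' x) \<and>
     (g has_field_derivative g' x) (at x)"
  proof (rule series_and_derivative_comparison_local)
    show "open {s. 1 < Re s}" by (rule open_halfspace_Re_gt)
    show "((\<lambda>x. of_real (b n) * of_nat (Suc n) powr - x) has_field_derivative
         - of_real (b n * ln (real (Suc n))) * of_nat (Suc n) powr - x) (at x)" for n and x :: complex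
    proof -
      have Ln: "Ln (of_nat (Suc n)) = of_real (ln (real (Suc n)))"
        by (subst Ln_of_nat) auto
      have deriv: "((\<lambda>x. of_nat (Suc n) powr x) has_field_derivative Ln (of_nat (Suc n)) * complex_of_nat (Suc n) powr (- x)) (at (- x))"
        by (rule has_field_derivative_powr_right) (simp del: of_nat_Suc)
      have "(uminus has_field_derivative - 1) (at x)" by (auto intro!: derivative_eq_intros)
      from DERIV_chain2[of "(powr) (complex_of_nat (Suc n))" _ uminus x "-1" UNIV, OF deriv this]
      have "((\<lambda>x. of_nat (Suc n) powr - x) has_field_derivative - (of_real (ln (real (Suc n))) * of_nat (Suc n) powr - x)) (at (x::complex))"
        unfolding Ln by (auto intro!: derivative_eq_intros simp del: of_nat_Suc)
      from DERIV_cmult[OF this, of "of_real (b n)"] show ?thesis by (simp add: mult_ac del: of_nat_Suc)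
    qed
    fix x :: complex assume x: "x \<in> {s. 1 < Re s}"
    define d where "d = (Re x - 1) / 2"
    have d: "d > 0" using x by (simp add: d_def)
    have "norm (of_real (b n) * of_nat (Suc n) powr - y) \<le> real (Suc n) powr (- 1 - d)"
      if "y \<in> ball x d" for n y
    proof -
      have "\<bar>Re (y - x)\<bar> < d" using that abs_Re_le_cmod[of "y - x"]
        by (simp add: dist_norm norm_minus_commute)
      then have "- Re y \<le> - 1 - d" unfolding d_def minus_complex.sel by argo
      then have "real (Suc n) powr (- Re y) \<le> real (Suc n) powr (- 1 - d)" by (intro powr_mono) auto
      moreover have "norm (of_real (b n) * of_nat (Suc n) powr - y) \<le> 1 * real (Suc n) powr (- Re y)"
        unfolding norm_mult norm_Suc_powr using b[of n] by (intro mult_mono) auto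
      ultimately show ?thesis by simp
    qed
    moreover have "summable (\<lambda>n. real (Suc n) powr (- 1 - d))"
      using d by (subst summable_Suc_powr) simp
    ultimately show "\<exists>d h. 0 < d \<and> summable h \<and>
         (\<forall>\<^sub>F n in sequentially. \<forall>y\<in>ball x d \<inter> {s. 1 < Re s}. norm (of_real (b n) * of_nat (Suc n) powr - y) \<le> h n)"
      using d by (intro exI[of _ d] exI[of _ "\<lambda>n. real (Suc n) powr (- 1 - d)"]) auto
  qed
  then show ?thesis using that by blast
qed

definition log_zeta_coeff :: "nat \<Rightarrow> real" where
  "log_zeta_coeff n = mangoldt n / ln (real n)"

lemma log_zeta_coeff_bounds: "0 \<le> log_zeta_coeff n" "log_zeta_coeff n \<le> 1"
proof -
  consider "n = 0" | "n = 1" | "n > 1" by linarith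
  then have "0 \<le> log_zeta_coeff n \<and> log_zeta_coeff n \<le> 1"
  proof cases
    case 3
    then show ?thesis using mangoldt_nonneg[of n] mangoldt_le[of n]
      by (simp add: log_zeta_coeff_def)
  qed (auto simp: log_zeta_coeff_def)
  then show "0 \<le> log_zeta_coeff n" "log_zeta_coeff n \<le> 1" by auto
qed

definition log_zeta :: "complex \<Rightarrow> complex" where
  "log_zeta s = (\<Sum>n. of_real (log_zeta_coeff (Suc n)) * of_nat (Suc n) powr (-s))"

lemma log_zeta_sums:
  assumes "1 < Re s"
  shows "(\<lambda>n. of_real (log_zeta_coeff (Suc n)) * of_nat (Suc n) powr (-s)) sums log_zeta s"
proof -
  obtain g g' where "\<And>s. 1 < Re s \<Longrightarrow> (\<lambda>n. of_real (log_zeta_coeff (Suc n)) * of_nat (Suc n) powr (-s)) sums g s"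
    using dirichlet_series_deriv[of "\<lambda>n. log_zeta_coeff (Suc n)"] log_zeta_coeff_bounds
    by (metis abs_of_nonneg)
  then show ?thesis using assms unfolding log_zeta_def by (metis sums_unique)
qed

text \<open>
  Exponential decay in \<open>Re s\<close>, used to identify limits as the real part tends to infinity.
\<close>

lemma norm_series_tail_bound:
  fixes b :: "nat \<Rightarrow> complex"
  assumes "\<And>n. norm (b n) \<le> 1" "2 \<le> Re s"
    and "(\<lambda>n. b n * of_nat (Suc n) powr (-s)) sums S"
  shows "norm (S - b 0) \<le> 4 * 2 powr (- Re s) * (\<Sum>n. 1 / real (Suc n) ^ 2)"
proof -
  have b2: "norm (b (Suc n) * of_nat (Suc (Suc n)) powr (-s)) \<le> 4 * 2 powr (- Re s) * (1 / real (Suc (Suc n)) ^ 2)" for n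
  proof -
    have "norm (b (Suc n) * of_nat (Suc (Suc n)) powr (-s)) \<le> 1 * real (Suc (Suc n)) powr (- Re s)"
      unfolding norm_mult norm_Suc_powr using assms(1)[of "Suc n"] by (intro mult_mono) auto
    also have "\<dots> = real (Suc (Suc n)) powr (- 2) * real (Suc (Suc n)) powr (- (Re s - 2))"
      by (simp flip: powr_add)
    also have "\<dots> \<le> real (Suc (Suc n)) powr (- 2) * 2 powr (- (Re s - 2))"
      using assms(2) by (intro mult_left_mono powr_mono2') auto
    also have "2 powr (- (Re s - 2)) = 4 * 2 powr (- Re s)"
      using powr_add[of 2 2 "- Re s"] by simp
    also have "real (Suc (Suc n)) powr (- 2) = 1 / real (Suc (Suc n)) ^ 2"
      by (simp add: powr_minus divide_inverse del: of_nat_Suc)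
    finally show ?thesis by (simp add: mult_ac)
  qed
  have s2: "summable (\<lambda>n. 1 / real (Suc n) ^ 2)" using inverse_power_summable[of 2, where 'a = real]
    by (subst summable_Suc_iff) (simp add: divide_inverse)
  have s3: "summable (\<lambda>n. 1 / real (Suc (Suc n)) ^ 2)" using s2 by (subst summable_Suc_iff)
  have "(\<lambda>n. b (Suc n) * of_nat (Suc (Suc n)) powr (-s)) sums (S - b 0 * of_nat (Suc 0) powr (-s))"
    using assms(3) by (subst sums_Suc_iff) simp
  then have "(\<lambda>n. b (Suc n) * of_nat (Suc (Suc n)) powr (-s)) sums (S - b 0)" by simp
  then have "norm (S - b 0) \<le> (\<Sum>n. 4 * 2 powr (- Re s) * (1 / real (Suc (Suc n)) ^ 2))"
    unfolding sums_iff using norm_suminf_le[OF b2 summable_mult[OF s3]] by (elim conjE) (simp only:)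
  also have "\<dots> = 4 * 2 powr (- Re s) * (\<Sum>n. 1 / real (Suc (Suc n)) ^ 2)"
    by (rule suminf_mult[OF s3])
  also have "(\<Sum>n. 1 / real (Suc (Suc n)) ^ 2) \<le> (\<Sum>n. 1 / real (Suc n) ^ 2)"
    using suminf_split_head[OF s2] by simp
  finally show ?thesis by (simp add: mult_left_mono)
qed

text \<open>
  The identity \<open>\<zeta>' = \<zeta> \<cdot> (log \<zeta>)'\<close> is \<open>\<Lambda> * 1 = log\<close> in terms of coefficients. Cutting the series of
  \<open>(log \<zeta>)'\<close> at \<open>D\<close> leaves coefficients between \<open>0\<close> and \<open>log n\<close> in the product, which are exact for
  \<open>n \<le> D\<close>; so the defect is at most a tail of \<open>\<Sum> log n \<cdot> n\<^sup>-\<^sup>\<sigma>\<close>.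
\<close>

lemma log_zeta_derivs:
  assumes s: "1 < Re s"
  shows "\<exists>l. (log_zeta has_field_derivative l) (at s) \<and> (riemann_zeta has_field_derivative riemann_zeta s * l) (at s)"
proof -
  let ?S = "\<lambda>D. \<Sum>d=1..D. of_real (mangoldt d) * of_nat d powr (-s)"
  obtain g g' where g:
    "\<And>s. 1 < Re s \<Longrightarrow> (\<lambda>n. of_real 1 * of_nat (Suc n) powr (-s)) sums g s"
    "\<And>s. 1 < Re s \<Longrightarrow> (\<lambda>n. - of_real (1 * ln (real (Suc n))) * of_nat (Suc n) powr (-s)) sums g' s"
    "\<And>s. 1 < Re s \<Longrightarrow> (g has_field_derivative g' s) (at s)"
    by (rule dirichlet_series_deriv[of "\<lambda>_. 1"]) (simp, blast)
  obtain h h' where h: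
    "\<And>s. 1 < Re s \<Longrightarrow> (\<lambda>n. of_real (log_zeta_coeff (Suc n)) * of_nat (Suc n) powr (-s)) sums h s"
    "\<And>s. 1 < Re s \<Longrightarrow> (\<lambda>n. - of_real (log_zeta_coeff (Suc n) * ln (real (Suc n))) * of_nat (Suc n) powr (-s)) sums h' s"
    "\<And>s. 1 < Re s \<Longrightarrow> (h has_field_derivative h' s) (at s)"
    by (rule dirichlet_series_deriv[of "\<lambda>n. log_zeta_coeff (Suc n)"])
       (simp add: log_zeta_coeff_bounds, blast)
  have op: "open {s. 1 < Re s}" by (rule open_halfspace_Re_gt)
  have g_eq: "g s = riemann_zeta s" if "1 < Re s" for s
    using g(1)[OF that] riemann_zeta_sums[OF that] by (simp add: sums_unique2)
  have h_eq: "h s = log_zeta s" if "1 < Re s" for s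
    using h(1)[OF that] log_zeta_sums[OF that] by (simp add: sums_unique2)
  have dz: "(riemann_zeta has_field_derivative g' s) (at s)"
    using has_field_derivative_transform_within_open[OF g(3)[OF s] op, of riemann_zeta] g_eq s by auto
  have dl: "(log_zeta has_field_derivative h' s) (at s)"
    using has_field_derivative_transform_within_open[OF h(3)[OF s] op, of log_zeta] h_eq s by auto
  have coeff: "log_zeta_coeff n * ln (real n) = mangoldt n" for n
    by (cases "n \<le> 1") (auto simp: log_zeta_coeff_def le_Suc_eq)
  have "(\<lambda>D. riemann_zeta s * ?S D) \<longlonglongrightarrow> - g' s"
  proof -
    define L where "L = (\<lambda>n. ln (real (Suc n)) * real (Suc n) powr (- Re s))"
    have Lsum: "summable L"
    proof -
      have "(\<lambda>n. real n powr (- Re s) * ln (real n)) \<in> O(\<lambda>n. real n powr (- (1 + Re s) / 2))"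
        using s by real_asymp
      then have "summable (\<lambda>n. real n powr (- Re s) * ln (real n))"
        by (rule summable_comparison_test_bigo[rotated]) (use s in \<open>simp add: summable_real_powr_iff\<close>)
      then show ?thesis unfolding L_def
        by (subst summable_Suc_iff) (simp add: mult_ac)
    qed
    have bnd: "norm (riemann_zeta s * ?S D + g' s)
       \<le> (\<Sum>n. L (n + D))" for D
    proof -
      define c where "c n = (\<Sum>d | d dvd Suc n \<and> d \<le> D. mangoldt d :: real)" for n
      have c1: "c n = ln (real (Suc n))" if "n < D" for n
      proof -
        have "{d. d dvd Suc n \<and> d \<le> D} = {d. d dvd Suc n}"
          using that by (auto intro: order.trans[OF dvd_imp_le])
        then show ?thesis unfolding c_def using mangoldt_sum[of "Suc n", where 'a = real] by simp
      qed
      have c2: "0 \<le> c n" "c n \<le> ln (real (Suc n))" for n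
      proof -
        show "0 \<le> c n" unfolding c_def by (intro sum_nonneg mangoldt_nonneg)
        have "c n \<le> (\<Sum>d | d dvd Suc n. mangoldt d)"
          unfolding c_def by (intro sum_mono2) (auto simp: mangoldt_nonneg)
        then show "c n \<le> ln (real (Suc n))" using mangoldt_sum[of "Suc n", where 'a = real] by simp
      qed
      have 1: "(\<lambda>n. of_real (c n - ln (real (Suc n))) * of_nat (Suc n) powr (-s)) sums
          (riemann_zeta s * ?S D + g' s)"
        using sums_add[OF sums_zeta_times_dirichlet_poly[OF s, of mangoldt D] g(2)[OF s]]
        by (simp add: c_def algebra_simps)
      have "(\<lambda>n. of_real (c (n + D) - ln (real (Suc (n + D)))) * of_nat (Suc (n + D)) powr (-s)) sums
          (riemann_zeta s * ?S D + g' s)"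
        using sums_split_initial_segment[OF 1, of D] c1 by simp
      moreover have "norm (of_real (c (n + D) - ln (real (Suc (n + D)))) * of_nat (Suc (n + D)) powr (-s)) \<le> L (n + D)" for n
        unfolding norm_mult norm_Suc_powr L_def norm_of_real using c2[of "n + D"]
        by (intro mult_mono) auto
      moreover have "summable (\<lambda>n. L (n + D))" using Lsum by (simp only: summable_iff_shift)
      ultimately show ?thesis unfolding sums_iff
        using norm_suminf_le[of "\<lambda>n. of_real (c (n + D) - ln (real (Suc (n + D)))) * of_nat (Suc (n + D)) powr (-s)" "\<lambda>n. L (n + D)"]
        by (elim conjE) (simp only:)
    qed
    have lim: "(\<lambda>D. \<Sum>n. L (n + D)) \<longlonglongrightarrow> 0" by (rule suminf_exist_split2[OF Lsum])
    have "(\<lambda>D. riemann_zeta s * ?S D + g' s) \<longlonglongrightarrow> 0"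
      by (rule Lim_null_comparison[OF always_eventually[OF allI[OF bnd]] lim])
    from tendsto_diff[OF this tendsto_const[of "g' s"]] show ?thesis
      by (simp only: add_diff_cancel_right' diff_0)
  qed
  moreover have "(\<lambda>D. riemann_zeta s * ?S D) \<longlonglongrightarrow> riemann_zeta s * (- h' s)"
  proof -
    have "(\<lambda>D. \<Sum>n<D. - (- of_real (mangoldt (Suc n)) * of_nat (Suc n) powr (-s))) \<longlonglongrightarrow> - h' s"
      using sums_minus[OF h(2)[OF s]] by (simp only: sums_def coeff)
    moreover have "(\<Sum>n<D. - (- of_real (mangoldt (Suc n)) * of_nat (Suc n) powr (-s)))
       = ?S D" for D
      using sum.shift_bounds_Suc_ivl[of "\<lambda>d. of_real (mangoldt d) * of_nat d powr (-s)" 0 D]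
      by (simp add: lessThan_atLeast0 atLeastLessThanSuc_atLeastAtMost)
    ultimately show ?thesis by (intro tendsto_mult tendsto_const) simp
  qed
  ultimately have "- g' s = riemann_zeta s * (- h' s)" by (rule LIMSEQ_unique)
  then have "g' s = riemann_zeta s * h' s" by simp
  then show ?thesis using dz dl by auto
qed

text \<open>
  \<open>\<zeta> exp (- log \<zeta>)\<close> has zero derivative and tends to \<open>1\<close> along the integers.
\<close>

lemma exp_log_zeta:
  assumes s: "1 < Re s"
  shows "exp (log_zeta s) = riemann_zeta s"
proof -
  define F where "F = (\<lambda>s. riemann_zeta s * exp (- log_zeta s))"
  have "(F has_field_derivative 0) (at s)" if s: "1 < Re s" for s
  proof -
    obtain l where "(log_zeta has_field_derivative l) (at s)"
      "(riemann_zeta has_field_derivative riemann_zeta s * l) (at s)" using log_zeta_derivs[OF s] by auto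
    then show ?thesis unfolding F_def by (auto intro!: derivative_eq_intros)
  qed
  then have "\<exists>c. \<forall>s\<in>{s. 1 < Re s}. F s = c"
    by (intro has_field_derivative_zero_constant convex_halfspace_Re_gt)
       (auto intro: has_field_derivative_at_within)
  then obtain c where c: "\<And>s. 1 < Re s \<Longrightarrow> F s = c" by auto
  define K where "K = 4 * (\<Sum>n. 1 / real (Suc n) ^ 2)"
  have lim: "(\<lambda>k. K * 2 powr (- real k)) \<longlonglongrightarrow> 0" by real_asymp
  have "(\<lambda>k. riemann_zeta (of_nat k) - 1) \<longlonglongrightarrow> 0"
  proof (rule Lim_null_comparison[OF _ lim])
    show "\<forall>\<^sub>F k in sequentially. norm (riemann_zeta (of_nat k) - 1) \<le> K * 2 powr (- real k)"
      using eventually_ge_at_top[of 2]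
    proof eventually_elim
      case (elim k)
      then have "(\<lambda>n. 1 * of_nat (Suc n) powr (- of_nat k)) sums riemann_zeta (of_nat k)"
        using riemann_zeta_sums[of "of_nat k"] by simp
      from norm_series_tail_bound[OF _ _ this] elim show ?case by (simp add: K_def mult_ac)
    qed
  qed
  moreover have "(\<lambda>k. log_zeta (of_nat k)) \<longlonglongrightarrow> 0"
  proof (rule Lim_null_comparison[OF _ lim])
    show "\<forall>\<^sub>F k in sequentially. norm (log_zeta (of_nat k)) \<le> K * 2 powr (- real k)"
      using eventually_ge_at_top[of 2]
    proof eventually_elim
      case (elim k)
      then have "(\<lambda>n. of_real (log_zeta_coeff (Suc n)) * of_nat (Suc n) powr (- of_nat k)) sums log_zeta (of_nat k)"
        using log_zeta_sums[of "of_nat k"] by simp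
      from norm_series_tail_bound[OF _ _ this] elim log_zeta_coeff_bounds show ?case
        by (simp add: K_def mult_ac) (simp add: log_zeta_coeff_def)
    qed
  qed
  ultimately have "(\<lambda>k. F (of_nat k)) \<longlonglongrightarrow> 1 * exp (- 0)"
    unfolding F_def by (intro tendsto_intros) (auto simp: LIM_zero_iff)
  moreover have "\<forall>\<^sub>F k in sequentially. F (of_nat k) = c"
    using eventually_ge_at_top[of 2] by eventually_elim (auto intro!: c)
  ultimately have "(\<lambda>k::nat. c) \<longlonglongrightarrow> 1" by (auto elim: Lim_transform_eventually)
  then have "c = 1" by (simp add: LIMSEQ_const_iff)
  then have "riemann_zeta s * exp (- log_zeta s) = 1" using c[OF s] by (simp add: F_def)
  then show ?thesis by (simp add: exp_minus field_simps)
qed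

section \<open>A mean value theorem for Dirichlet polynomials\<close>

lemma has_integral_Re_cis:
  fixes d T :: real
  assumes "d \<noteq> 0" "0 \<le> T"
  shows "((\<lambda>t. Re (c * cis (d * t))) has_integral Re (c * (cis (d * T) - 1) / (\<i> * of_real d))) {0..T}"
proof -
  have "((\<lambda>t. Re (c * cis (d * t))) has_integral
      Re (c * cis (d * T) / (\<i> * of_real d)) - Re (c * cis (d * 0) / (\<i> * of_real d))) {0..T}"
  proof (rule fundamental_theorem_of_calculus[OF assms(2)])
    fix t assume "t \<in> {0..T}"
    have "((\<lambda>t. c * cis (d * t) / (\<i> * of_real d)) has_vector_derivative c * cis (d * t)) (at t within {0..T})"
    proof -
      have "((\<lambda>z. c * exp (\<i> * of_real d * z) / (\<i> * of_real d)) has_field_derivative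
          c * exp (\<i> * of_real d * of_real t)) (at (of_real t))"
        using assms(1) by (auto intro!: derivative_eq_intros)
      from has_vector_derivative_real_field[OF this] show ?thesis
        by (simp add: cis_conv_exp mult.assoc)
    qed
    then show "((\<lambda>t. Re (c * cis (d * t) / (\<i> * of_real d))) has_vector_derivative Re (c * cis (d * t))) (at t within {0..T})"
      by (rule bounded_linear.has_vector_derivative[OF bounded_linear_Re])
  qed
  then show ?thesis by (simp add: diff_divide_distrib algebra_simps)
qed

lemma norm_integral_Re_cis:
  fixes d T :: real
  assumes "d \<noteq> 0"
  shows "Re (c * (cis (d * T) - 1) / (\<i> * of_real d)) \<le> 2 * norm c / \<bar>d\<bar>"
proof -
  have "Re (c * (cis (d * T) - 1) / (\<i> * of_real d)) \<le> norm (c * (cis (d * T) - 1) / (\<i> * of_real d))"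
    by (rule complex_Re_le_cmod)
  also have "\<dots> = norm c * norm (cis (d * T) - 1) / \<bar>d\<bar>"
    by (simp add: norm_mult norm_divide)
  also have "norm (cis (d * T) - 1) \<le> 2"
    using norm_triangle_ineq4[of "cis (d * T)" 1] by simp
  then have "norm c * norm (cis (d * T) - 1) / \<bar>d\<bar> \<le> norm c * 2 / \<bar>d\<bar>"
    by (intro divide_right_mono mult_left_mono) auto
  finally show ?thesis by (simp add: mult.commute)
qed

lemma inverse_ln_diff_le:
  fixes m n N :: nat
  assumes "1 \<le> m" "m \<le> N" "1 \<le> n" "n \<le> N" "m \<noteq> n"
  shows "2 / \<bar>ln (real n) - ln (real m)\<bar> \<le> 2 * real N * (1 / \<bar>real m - real n\<bar>)"
proof -
  have *: "(real b - real a) / real N \<le> ln (real b) - ln (real a)"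
    if "1 \<le> a" "a < b" "b \<le> N" for a b :: nat
  proof -
    have "ln (real a / real b) \<le> real a / real b - 1" using that by (intro ln_le_minus_one) auto
    then have "(real b - real a) / real b \<le> ln (real b) - ln (real a)"
      using that by (simp add: ln_div diff_divide_distrib)
    moreover have "(real b - real a) / real N \<le> (real b - real a) / real b"
      using that by (intro divide_left_mono) auto
    ultimately show ?thesis by linarith
  qed
  have "\<bar>real m - real n\<bar> / real N \<le> \<bar>ln (real n) - ln (real m)\<bar>"
    using *[of m n] *[of n m] assms by (cases "m < n") auto
  moreover have "0 < \<bar>real m - real n\<bar> / real N" using assms by auto
  ultimately have "2 / \<bar>ln (real n) - ln (real m)\<bar> \<le> 2 / (\<bar>real m - real n\<bar> / real N)"
    by (intro divide_left_mono mult_pos_pos order.strict_trans2[of 0 "\<bar>real m - real n\<bar> / real N" "\<bar>ln (real n) - ln (real m)\<bar>"]) auto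
  then show ?thesis by simp
qed

lemma sum_inverse_distance_le:
  assumes "m \<in> {1..N}"
  shows "(\<Sum>n\<in>{1..N} - {m}. 1 / \<bar>real m - real n\<bar>) \<le> 2 * harm N"
proof -
  have "{1..N} - {m} = {1..<m} \<union> {m<..N}" using assms by auto
  then have "(\<Sum>n\<in>{1..N} - {m}. 1 / \<bar>real m - real n\<bar>)
     = (\<Sum>n\<in>{1..<m}. 1 / \<bar>real m - real n\<bar>) + (\<Sum>n\<in>{m<..N}. 1 / \<bar>real m - real n\<bar>)"
    by (simp add: sum.union_disjoint Int_def)
  also have "(\<Sum>n\<in>{1..<m}. 1 / \<bar>real m - real n\<bar>) = (\<Sum>k\<in>{1..<m}. 1 / real k)"
    by (rule sum.reindex_bij_witness[of _ "\<lambda>k. m - k" "\<lambda>k. m - k"]) (auto simp: of_nat_diff)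
  also have "\<dots> \<le> harm N" unfolding harm_def using assms
    by (auto simp: divide_inverse intro!: sum_mono2)
  also have "(\<Sum>n\<in>{m<..N}. 1 / \<bar>real m - real n\<bar>) = (\<Sum>k\<in>{1..N-m}. 1 / real k)"
    by (rule sum.reindex_bij_witness[of _ "\<lambda>k. m + k" "\<lambda>k. k - m"]) (auto simp: of_nat_diff)
  also have "\<dots> \<le> harm N" unfolding harm_def using assms
    by (auto simp: divide_inverse intro!: sum_mono2)
  finally show ?thesis by simp
qed

text \<open>
  After expanding the square, the diagonal gives \<open>T \<Sum> |a\<^sub>n|\<^sup>2\<close>. An off-diagonal term oscillates with
  frequency \<open>log (n/m)\<close>, at least \<open>|m - n| / N\<close> in absolute value; \<open>2|a\<^sub>m a\<^sub>n| \<le> |a\<^sub>m|\<^sup>2 + |a\<^sub>n|\<^sup>2\<close> and a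
  harmonic sum bound the total.
\<close>

lemma dirichlet_poly_mean_square:
  fixes a :: "nat \<Rightarrow> complex" and T :: real
  assumes T: "0 \<le> T"
  shows "(\<lambda>t. (norm (\<Sum>n=1..N. a n * cis (- (t * ln (real n)))))\<^sup>2) integrable_on {0..T}"
    and "integral {0..T} (\<lambda>t. (norm (\<Sum>n=1..N. a n * cis (- (t * ln (real n)))))\<^sup>2)
      \<le> (T + 4 * real N * harm N) * (\<Sum>n=1..N. (norm (a n))\<^sup>2)"
proof -
  let ?F = "\<lambda>t. (norm (\<Sum>n=1..N. a n * cis (- (t * ln (real n)))))\<^sup>2" and ?d = "\<lambda>m n :: nat. real N * (1 / \<bar>real m - real n\<bar>)"
  define V where "V m n = (if m = n then T * (norm (a m))\<^sup>2
    else Re (a m * cnj (a n) * (cis ((ln (real n) - ln (real m)) * T) - 1) / (\<i> * of_real (ln (real n) - ln (real m)))))" for m n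
  have eq: "?F t
      = (\<Sum>m=1..N. \<Sum>n=1..N. Re (a m * cnj (a n) * cis ((ln (real n) - ln (real m)) * t)))" for t
  proof -
    define S where "S = (\<Sum>n=1..N. a n * cis (- (t * ln (real n))))"
    have "(norm S)\<^sup>2 = Re (S * cnj S)" by (simp add: complex_norm_square[symmetric] complex_mult_cnj cmod_power2)
    also have "S * cnj S = (\<Sum>m=1..N. \<Sum>n=1..N. a m * cis (- (t * ln (real m))) * (cnj (a n) * cis (t * ln (real n))))"
      by (simp add: S_def sum_product cnj_sum cis_cnj)
    also have "\<dots> = (\<Sum>m=1..N. \<Sum>n=1..N. a m * cnj (a n) * cis ((ln (real n) - ln (real m)) * t))"
    proof (intro sum.cong refl)
      fix m n
      have "cis (- (t * ln (real m))) * cis (t * ln (real n)) = cis ((ln (real n) - ln (real m)) * t)"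
        by (simp add: cis_mult algebra_simps)
      then show "a m * cis (- (t * ln (real m))) * (cnj (a n) * cis (t * ln (real n)))
        = a m * cnj (a n) * cis ((ln (real n) - ln (real m)) * t)"
        by (metis mult.assoc mult.left_commute)
    qed
    finally show ?thesis by (simp add: S_def Re_sum)
  qed
  have hi: "((\<lambda>t. Re (a m * cnj (a n) * cis ((ln (real n) - ln (real m)) * t))) has_integral V m n) {0..T}"
    if "m \<in> {1..N}" "n \<in> {1..N}" for m n
  proof (cases "m = n")
    case True
    have "Re (a m * cnj (a m)) = (norm (a m))\<^sup>2" by (simp add: complex_mult_cnj cmod_power2)
    then show ?thesis using True has_integral_const_real[of "(norm (a m))\<^sup>2" 0 T] T
      by (simp add: V_def)
  next
    case False
    then have "ln (real n) - ln (real m) \<noteq> 0" using that by auto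
    from has_integral_Re_cis[OF this T, of "a m * cnj (a n)"] show ?thesis
      using False by (simp only: V_def if_False of_real_diff)
  qed
  have HI: "(?F has_integral (\<Sum>m=1..N. \<Sum>n=1..N. V m n)) {0..T}"
    unfolding eq by (intro has_integral_sum finite_atLeastAtMost hi)
  then show "?F integrable_on {0..T}"
    by (rule has_integral_integrable)
  define B where "B m n = (if m = n then T * (norm (a m))\<^sup>2
     else ((norm (a m))\<^sup>2 + (norm (a n))\<^sup>2) * ?d m n)" for m n
  have VB: "V m n \<le> B m n" if "m \<in> {1..N}" "n \<in> {1..N}" for m n
  proof (cases "m = n")
    case False
    then have d: "ln (real n) - ln (real m) \<noteq> 0" using that by auto
    have "V m n \<le> 2 * norm (a m * cnj (a n)) / \<bar>ln (real n) - ln (real m)\<bar>"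
      using norm_integral_Re_cis[OF d] False by (simp add: V_def)
    also have "\<dots> = norm (a m) * norm (a n) * (2 / \<bar>ln (real n) - ln (real m)\<bar>)"
      by (simp add: norm_mult)
    also have "\<dots> \<le> norm (a m) * norm (a n) * (2 * real N * (1 / \<bar>real m - real n\<bar>))"
      using that False by (intro mult_left_mono inverse_ln_diff_le) auto
    also have "\<dots> = (2 * norm (a m) * norm (a n)) * ?d m n" by simp
    also have "\<dots> \<le> ((norm (a m))\<^sup>2 + (norm (a n))\<^sup>2) * ?d m n"
      by (intro mult_right_mono sum_squares_bound) auto
    finally show ?thesis using False by (simp add: B_def)
  qed (simp add: V_def B_def)
  have "integral {0..T} ?F = (\<Sum>m=1..N. \<Sum>n=1..N. V m n)"
    using HI by (rule integral_unique)
  also have "\<dots> \<le> (\<Sum>m=1..N. \<Sum>n=1..N. B m n)" by (intro sum_mono VB)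
  also have "\<dots> = (\<Sum>m=1..N. T * (norm (a m))\<^sup>2
     + (\<Sum>n\<in>{1..N} - {m}. (norm (a m))\<^sup>2 * ?d m n)
     + (\<Sum>n\<in>{1..N} - {m}. (norm (a n))\<^sup>2 * ?d m n))"
  proof (intro sum.cong refl)
    fix m assume m: "m \<in> {1..N}"
    have "(\<Sum>n=1..N. B m n) = B m m + (\<Sum>n\<in>{1..N} - {m}. B m n)"
      by (rule sum.remove) (use m in auto)
    also have "(\<Sum>n\<in>{1..N} - {m}. B m n) = (\<Sum>n\<in>{1..N} - {m}. (norm (a m))\<^sup>2 * ?d m n
       + (norm (a n))\<^sup>2 * ?d m n)"
      by (intro sum.cong refl) (auto simp: B_def add_divide_distrib distrib_right)
    finally show "(\<Sum>n=1..N. B m n) = T * (norm (a m))\<^sup>2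
     + (\<Sum>n\<in>{1..N} - {m}. (norm (a m))\<^sup>2 * ?d m n)
     + (\<Sum>n\<in>{1..N} - {m}. (norm (a n))\<^sup>2 * ?d m n)"
      by (simp add: sum.distrib B_def)
  qed
  also have "\<dots> = T * (\<Sum>m=1..N. (norm (a m))\<^sup>2)
     + 2 * (\<Sum>m=1..N. \<Sum>n\<in>{1..N} - {m}. (norm (a m))\<^sup>2 * ?d m n)"
  proof -
    have "(\<Sum>m=1..N. \<Sum>n\<in>{1..N} - {m}. (norm (a n))\<^sup>2 * ?d m n)
       = (\<Sum>m=1..N. \<Sum>n=1..N. if n = m then 0 else (norm (a n))\<^sup>2 * ?d m n)"
      by (intro sum.cong refl sum.mono_neutral_cong_left) auto
    also have "\<dots> = (\<Sum>n=1..N. \<Sum>m=1..N. if n = m then 0 else (norm (a n))\<^sup>2 * ?d m n)"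
      by (rule sum.swap)
    also have "\<dots> = (\<Sum>m=1..N. \<Sum>n\<in>{1..N} - {m}. (norm (a m))\<^sup>2 * ?d m n)"
      by (intro sum.cong refl sum.mono_neutral_cong_right) (auto simp: abs_minus_commute)
    finally show ?thesis by (simp add: sum.distrib sum_distrib_left)
  qed
  also have "(\<Sum>m=1..N. \<Sum>n\<in>{1..N} - {m}. (norm (a m))\<^sup>2 * ?d m n)
     \<le> (\<Sum>m=1..N. (norm (a m))\<^sup>2 * (real N * (2 * harm N)))"
    unfolding sum_distrib_left[symmetric]
    by (intro sum_mono mult_left_mono sum_inverse_distance_le) auto
  also have "\<dots> = 2 * real N * harm N * (\<Sum>m=1..N. (norm (a m))\<^sup>2)"
    by (simp add: sum_distrib_left mult_ac)
  finally show "integral {0..T} ?F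
      \<le> (T + 4 * real N * harm N) * (\<Sum>n=1..N. (norm (a n))\<^sup>2)"
    by (simp add: algebra_simps)
qed

section \<open>Growth of zeta\<close>

lemma zeta_continuation_unique:
  assumes "F holomorphic_on {s. 0 < Re s}" "G holomorphic_on -{1}"
    and "\<And>s. 1 < Re s \<Longrightarrow> F s = G s" and "0 < Re s" "s \<noteq> 1"
  shows "F s = G s"
proof (rule analytic_continuation_open[where f = F and g = G and s = "{s. 1 < Re s}" and s' = "{s. 0 < Re s} - {1}"])
  have "2 \<in> {s. 1 < Re s}" by simp
  then show "{s. 1 < Re s} \<noteq> {}" by blast
  show "connected ({s. 0 < Re s} - {1})"
    by (intro connected_open_delete open_halfspace_Re_gt convex_connected convex_halfspace_Re_gt) auto
qed (use assms in \<open>auto simp: open_halfspace_Re_gt intro!: open_delete intro: holomorphic_on_subset\<close>)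

lemma norm_of_real_powr: "0 < x \<Longrightarrow> norm (of_real x powr s :: complex) = x powr Re s"
  using norm_powr_real_powr[of "of_real x" s] by simp

lemma has_field_derivative_powr_of_real:
  assumes "0 < x"
  shows "((\<lambda>z. z powr a) has_field_derivative a * of_real x powr (a - 1)) (at (of_real x :: complex))"
  using assms by (intro has_field_derivative_powr) (auto simp: complex_nonpos_Reals_iff)

lemma closed_segment_of_real_le:
  assumes "a \<le> b"
  shows "closed_segment (of_real a) (of_real b :: complex) = of_real ` {a..b}"
  by (simp only: closed_segment_of_real closed_segment_eq_real_ivl assms if_True)

lemma norm_powr_diff_le:
  assumes "1 \<le> x" "x \<le> y" "y \<le> x + 1" "0 \<le> Re s"
  shows "norm (of_real y powr (- s) - of_real x powr (-s) :: complex) \<le> norm s * x powr (- Re s - 1)"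
proof -
  have "norm (of_real y powr (- s) - of_real x powr (-s) :: complex)
      \<le> (norm s * x powr (- Re s - 1)) * norm (of_real y - of_real x :: complex)"
  proof (rule field_differentiable_bound[where S = "closed_segment (of_real x) (of_real y)"])
    fix z :: complex assume "z \<in> closed_segment (of_real x) (of_real y)"
    then obtain u where u: "z = of_real u" "x \<le> u" using closed_segment_of_real_le[OF assms(2)] by auto
    show "((\<lambda>z. z powr - s) has_field_derivative - s * z powr (- s - 1)) (at z within closed_segment (of_real x) (of_real y))"
      using has_field_derivative_powr_of_real[of u "-s"] u assms by (auto intro: has_field_derivative_at_within)
    have "norm (- s * z powr (- s - 1)) = norm s * u powr (- Re s - 1)"
      using u assms by (simp add: norm_mult norm_of_real_powr)
    also have "\<dots> \<le> norm s * x powr (- Re s - 1)"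
      using u assms by (intro mult_left_mono powr_mono2') auto
    finally show "norm (- s * z powr (- s - 1)) \<le> norm s * x powr (- Re s - 1)" .
  qed auto
  also have "\<dots> \<le> (norm s * x powr (- Re s - 1)) * 1"
    using assms by (intro mult_left_mono) (auto simp flip: of_real_diff)
  finally show ?thesis by simp
qed

text \<open>
  This is a first order Taylor remainder of \<open>x\<^sup>1\<^sup>-\<^sup>s\<close>, so it is small by the mean value theorem applied
  twice. The dependence on \<open>s\<close> is polynomial, as required for large imaginary parts.
\<close>

lemma norm_tail_term_1_le:
  assumes "0 \<le> Re s"
  shows "norm (tail_term 1 n s) \<le> norm (s - 1) * norm s * real (Suc n) powr (- Re s - 1)"
proof -
  define x where "x = real (Suc n)"
  have x: "1 \<le> x" "of_nat (Suc n) = complex_of_real x" "of_nat (Suc (Suc n)) = complex_of_real (x + 1)"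
    by (auto simp: x_def)
  define h where "h = (\<lambda>z. z powr (1 - s) - (1 - s) * of_real x powr (-s) * z)"
  have "norm (h (of_real x) - h (of_real (x + 1)))
     \<le> (norm (s - 1) * norm s * x powr (- Re s - 1)) * norm (of_real x - of_real (x + 1) :: complex)"
  proof (rule field_differentiable_bound[where S = "closed_segment (of_real x) (of_real (x + 1))"])
    fix z :: complex assume "z \<in> closed_segment (of_real x) (of_real (x + 1))"
    then obtain u where u: "z = of_real u" "x \<le> u" "u \<le> x + 1" using closed_segment_of_real_le[of x "x + 1"] by auto
    have "((\<lambda>z. z powr (1 - s)) has_field_derivative (1 - s) * z powr (- s)) (at z within closed_segment (of_real x) (of_real (x + 1)))"
      using has_field_derivative_powr_of_real[of u "1-s"] u x by (auto intro: has_field_derivative_at_within)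
    from DERIV_diff[OF this DERIV_cmult_Id]
    show "(h has_field_derivative (1 - s) * z powr (- s) - (1 - s) * of_real x powr (-s)) (at z within closed_segment (of_real x) (of_real (x + 1)))"
      unfolding h_def .
    have "norm ((1 - s) * z powr (- s) - (1 - s) * of_real x powr (-s)) = norm (s - 1) * norm (z powr (-s) - of_real x powr (-s))"
      by (simp add: norm_mult norm_minus_commute flip: right_diff_distrib)
    also have "\<dots> \<le> norm (s - 1) * (norm s * x powr (- Re s - 1))"
      unfolding u(1) using u x assms by (intro mult_left_mono norm_powr_diff_le) auto
    finally show "norm ((1 - s) * z powr (- s) - (1 - s) * of_real x powr (-s)) \<le> norm (s - 1) * norm s * x powr (- Re s - 1)"
      by (simp add: mult.assoc)
  qed auto
  also have "norm (of_real x - of_real (x + 1) :: complex) = 1" by simp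
  also have "h (of_real x) - h (of_real (x + 1)) = tail_term 1 n s"
    unfolding tail_term_def x h_def by (simp add: algebra_simps)
  finally show ?thesis by (simp add: x_def)
qed

text \<open>
  \<open>(s - 1) \<zeta>(s) = 1 - \<Sum>\<^sub>n tail_term 1 n s\<close> holds for \<open>Re s > 1\<close> and extends to \<open>Re s > 0\<close>.
\<close>

lemma zeta_growth:
  obtains C where "0 < C" "\<And>s. 1/2 \<le> Re s \<Longrightarrow> 1 \<le> norm (s - 1) \<Longrightarrow> norm (riemann_zeta s) \<le> C * norm s"
proof -
  define K where "K = (\<Sum>n. real (Suc n) powr (-3/2))"
  have sumK: "summable (\<lambda>n. real (Suc n) powr (-3/2))" by (subst summable_Suc_powr) simp
  have "K \<ge> 0" unfolding K_def by (intro suminf_nonneg sumK) auto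
  define F where "F = (\<lambda>s. 1 - (\<Sum>n. tail_term 1 n s))"
  have F_eq: "F s = (s - 1) * riemann_zeta s" if "0 < Re s" "s \<noteq> 1" for s
  proof (rule zeta_continuation_unique[where F = F and G = "\<lambda>s. (s - 1) * riemann_zeta s"])
    have "{s. 1 - real 1 < Re s} = {s. 0 < Re s}" by simp
    then show "F holomorphic_on {s. 0 < Re s}"
      unfolding F_def using tail_term_sums(1)[of 1] by (intro holomorphic_intros) simp
    show "(\<lambda>s. (s - 1) * riemann_zeta s) holomorphic_on - {1}"
      by (intro holomorphic_intros riemann_zeta_holomorphic)
    show "F s = (s - 1) * riemann_zeta s" if "1 < Re s" for s
    proof -
      have "dirichlet_sum s = riemann_zeta s"
        using dirichlet_sum(2)[OF that] riemann_zeta_sums[OF that] by (rule sums_unique2)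
      then show ?thesis unfolding F_def tail_term_suminf[OF that] by (simp add: algebra_simps)
    qed
  qed (use that in auto)
  have "norm (riemann_zeta s) \<le> (2 + K) * norm s" if s: "1/2 \<le> Re s" "1 \<le> norm (s - 1)" for s
  proof -
    have ns: "1/2 \<le> norm s" using s(1) complex_Re_le_cmod[of s] by linarith
    have bnd: "norm (tail_term 1 n s) \<le> norm (s - 1) * norm s * real (Suc n) powr (-3/2)" for n
    proof -
      have "norm (tail_term 1 n s) \<le> norm (s - 1) * norm s * real (Suc n) powr (- Re s - 1)"
        using s by (intro norm_tail_term_1_le) auto
      also have "\<dots> \<le> norm (s - 1) * norm s * real (Suc n) powr (-3/2)"
        using s by (intro mult_left_mono powr_mono) auto
      finally show ?thesis .
    qed
    have "norm (\<Sum>n. tail_term 1 n s) \<le> (\<Sum>n. norm (s - 1) * norm s * real (Suc n) powr (-3/2))"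
      by (rule norm_suminf_le[OF bnd summable_mult[OF sumK]])
    also have "\<dots> = norm (s - 1) * norm s * K" unfolding K_def by (rule suminf_mult[OF sumK])
    finally have "norm (F s) \<le> 1 + norm (s - 1) * norm s * K"
      unfolding F_def using norm_triangle_ineq4[of 1 "\<Sum>n. tail_term 1 n s"] by simp
    moreover have "F s = (s - 1) * riemann_zeta s" using s by (intro F_eq) auto
    ultimately have "norm (s - 1) * norm (riemann_zeta s) \<le> 1 + norm (s - 1) * norm s * K"
      by (simp add: norm_mult)
    also have "1 \<le> norm (s - 1) * (2 * norm s)"
      using mult_mono[of 1 "norm (s - 1)" 1 "2 * norm s"] s ns by simp
    finally have "norm (s - 1) * norm (riemann_zeta s) \<le> norm (s - 1) * ((2 + K) * norm s)"
      by (simp add: algebra_simps)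
    moreover have "0 < norm (s - 1)" using s by linarith
    ultimately show ?thesis by (simp only: mult_le_cancel_left_pos)
  qed
  then show ?thesis using that[of "2 + K"] \<open>K \<ge> 0\<close> by auto
qed

section \<open>Iterated differences and the eta function\<close>

fun powr_diff_iter :: "nat \<Rightarrow> complex \<Rightarrow> complex \<Rightarrow> complex" where
  "powr_diff_iter 0 s x = x powr (-s)"
| "powr_diff_iter (Suc k) s x = powr_diff_iter k s x - powr_diff_iter k s (x + 1)"

lemma has_field_derivative_powr_diff_iter:
  assumes "0 < x"
  shows "(powr_diff_iter k s has_field_derivative - s * powr_diff_iter k (s + 1) (of_real x)) (at (of_real x))"
  using assms
proof (induction k arbitrary: x)
  case 0
  have "- s - 1 = - (s + 1)" by simp
  then show ?case using has_field_derivative_powr_of_real[OF 0, of "-s"] by (simp add: fun_eq_iff)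
next
  case (Suc k)
  have "(powr_diff_iter k s has_field_derivative - s * powr_diff_iter k (s + 1) (of_real x + 1)) (at (of_real x + 1))"
    using Suc.IH[of "x + 1"] Suc.prems by simp
  then have "((\<lambda>x. powr_diff_iter k s (x + 1)) has_field_derivative - s * powr_diff_iter k (s + 1) (of_real x + 1)) (at (of_real x))"
    by (subst (asm) DERIV_shift)
  from DERIV_diff[OF Suc.IH[OF Suc.prems] this] show ?case
    by (simp add: algebra_simps)
qed

text \<open>
  Taking a difference costs a derivative, which sends \<open>x\<^sup>-\<^sup>s\<close> to \<open>- s x\<^sup>-\<^sup>s\<^sup>-\<^sup>1\<close>: every step gains a factor of
  order \<open>|s| / x\<close>.
\<close>

lemma norm_powr_diff_iter_le:
  assumes "0 < x" "0 \<le> Re s"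
  shows "norm (powr_diff_iter k s (of_real x)) \<le> (norm s + real k) ^ k * x powr (- Re s - real k)"
  using assms
proof (induction k arbitrary: x s)
  case 0
  then show ?case by (simp add: norm_of_real_powr)
next
  case (Suc k)
  define B where "B = norm s * ((norm s + real (Suc k)) ^ k * x powr (- Re s - real (Suc k)))"
  have "norm (powr_diff_iter k s (of_real x) - powr_diff_iter k s (of_real (x + 1)))
     \<le> B * norm (of_real x - of_real (x + 1) :: complex)"
  proof (rule field_differentiable_bound[where S = "closed_segment (of_real x) (of_real (x + 1))"])
    fix z :: complex assume "z \<in> closed_segment (of_real x) (of_real (x + 1))"
    then obtain u where u: "z = of_real u" "x \<le> u" "u \<le> x + 1" using closed_segment_of_real_le[of x "x + 1"] by auto
    show "(powr_diff_iter k s has_field_derivative - s * powr_diff_iter k (s + 1) z) (at z within closed_segment (of_real x) (of_real (x + 1)))"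
      unfolding u(1) using u Suc.prems
      by (intro has_field_derivative_at_within[OF has_field_derivative_powr_diff_iter]) auto
    have "norm (- s * powr_diff_iter k (s + 1) z)
       \<le> norm s * ((norm (s + 1) + real k) ^ k * u powr (- Re (s + 1) - real k))"
      unfolding u(1) norm_mult norm_minus_cancel using u Suc.prems by (intro mult_left_mono Suc.IH) auto
    also have "- Re (s + 1) - real k = - Re s - real (Suc k)" by simp
    also have "norm s * ((norm (s + 1) + real k) ^ k * u powr (- Re s - real (Suc k))) \<le> B"
      unfolding B_def using u Suc.prems norm_triangle_ineq[of s 1]
      by (intro mult_left_mono mult_mono power_mono powr_mono2') auto
    finally show "norm (- s * powr_diff_iter k (s + 1) z) \<le> B" .
  qed auto
  also have "norm (of_real x - of_real (x + 1) :: complex) = 1" by simp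
  also have "B * 1 \<le> (norm s + real (Suc k)) ^ Suc k * x powr (- Re s - real (Suc k))"
    unfolding B_def power_Suc mult.assoc mult_1_right by (intro mult_right_mono) auto
  finally show ?case by simp
qed

text \<open>
  One step of Euler's transformation, solved for the alternating sum of the differences.
\<close>

lemma alternating_diff_sums:
  fixes g :: "nat \<Rightarrow> complex"
  assumes "(\<lambda>n. (-1) ^ n * g n) sums A"
  shows "(\<lambda>n. (-1) ^ n * (g n - g (Suc n))) sums (2 * A - g 0)"
proof -
  have "(\<lambda>n. (-1) ^ Suc n * g (Suc n)) sums (A - g 0)"
    using assms by (subst sums_Suc_iff) simp
  from sums_add[OF assms this] show ?thesis by (simp add: algebra_simps)
qed

lemma eta_sums:
  assumes "1 < Re s"
  shows "(\<lambda>n. (-1) ^ n * of_nat (Suc n) powr (-s)) sums ((1 - 2 powr (1 - s)) * riemann_zeta s)"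
proof -
  have "(\<lambda>n. of_nat (Suc n) powr (-s) - 2 * (if 2 dvd Suc n then of_nat (Suc n) powr (-s) else 0)) sums
     (riemann_zeta s - 2 * (of_nat 2 powr (-s) * riemann_zeta s))"
    by (intro sums_diff sums_mult sums_zeta_multiples riemann_zeta_sums assms) auto
  also have "(\<lambda>n. of_nat (Suc n) powr (-s) - 2 * (if 2 dvd Suc n then of_nat (Suc n) powr (-s) else 0))
     = (\<lambda>n. (-1) ^ n * of_nat (Suc n) powr (-s))"
    by (auto simp: fun_eq_iff simp del: of_nat_Suc)
  also have "riemann_zeta s - 2 * (of_nat 2 powr (-s) * riemann_zeta s) = (1 - 2 powr (1 - s)) * riemann_zeta s"
    using powr_add[of "2::complex" 1 "-s"] by (simp add: algebra_simps)
  finally show ?thesis .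
qed

text \<open>
  The remainder of the eta series from \<open>N\<close> on after \<open>k\<close> steps of Euler's transformation, without the
  factor \<open>\<plusminus>2\<^sup>-\<^sup>k\<close>.
\<close>

definition eta_tail :: "nat \<Rightarrow> nat \<Rightarrow> complex \<Rightarrow> complex" where
  "eta_tail k N s = (\<Sum>n. (-1) ^ n * powr_diff_iter k s (of_nat (N + n)))"

lemma norm_powr_diff_iter_nat_le:
  assumes "0 \<le> Re s" "N \<ge> 1" "k \<ge> 1"
  shows "norm ((-1) ^ n * powr_diff_iter k s (of_nat (N + n)))
     \<le> (norm s + real k) ^ k * real N powr (1 - real k) * real (Suc n) powr (- Re s - 1)"
proof -
  have "norm ((-1) ^ n * powr_diff_iter k s (of_nat (N + n))) \<le> (norm s + real k) ^ k * real (N + n) powr (- Re s - real k)"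
    using norm_powr_diff_iter_le[of "real (N + n)" s k] assms by (simp add: norm_mult norm_power)
  also have "- Re s - real k = (1 - real k) + (- Re s - 1)" by simp
  also have "real (N + n) powr ((1 - real k) + (- Re s - 1)) = real (N + n) powr (1 - real k) * real (N + n) powr (- Re s - 1)"
    by (rule powr_add)
  also have "\<dots> \<le> real N powr (1 - real k) * real (Suc n) powr (- Re s - 1)"
    using assms by (intro mult_mono powr_mono2') auto
  finally show ?thesis by (simp add: mult_left_mono mult.assoc)
qed

lemma eta_tail_holomorphic_sums:
  assumes "N \<ge> 1" "k \<ge> 1"
  shows "eta_tail k N holomorphic_on {s. 0 < Re s}"
    and "0 < Re s \<Longrightarrow> (\<lambda>n. (-1) ^ n * powr_diff_iter k s (of_nat (N + n))) sums eta_tail k N s"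
proof -
  have hol: "(\<lambda>s. powr_diff_iter k' s (of_nat m)) holomorphic_on A" if "m \<ge> 1" for k' m A
    using that
  proof (induction k' arbitrary: m)
    case 0
    then show ?case by (auto intro!: holomorphic_intros)
  next
    case (Suc k')
    have "(\<lambda>s. powr_diff_iter k' s (of_nat m + 1)) holomorphic_on A"
      using Suc.IH[of "Suc m"] by (simp add: add.commute)
    then show ?case using Suc by (auto intro!: holomorphic_intros)
  qed
  define C where "C r = (r + real k) ^ k * real N powr (1 - real k)" for r
  have h: "(\<lambda>s. (-1) ^ n * powr_diff_iter k s (of_nat (N + n))) holomorphic_on {s. 0 < Re s}" for n
    using assms by (intro holomorphic_intros hol) auto
  have b: "norm ((-1) ^ n * powr_diff_iter k s (of_nat (N + n))) \<le> C r * real (Suc n) powr (- Re s + 0 - 1)"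
    if "0 < Re s" "norm s \<le> r" for r n s
  proof -
    have "norm ((-1) ^ n * powr_diff_iter k s (of_nat (N + n)))
       \<le> (norm s + real k) ^ k * real N powr (1 - real k) * real (Suc n) powr (- Re s - 1)"
      using that assms by (intro norm_powr_diff_iter_nat_le) auto
    also have "\<dots> \<le> C r * real (Suc n) powr (- Re s - 1)"
      unfolding C_def using that by (intro mult_right_mono power_mono) auto
    finally show ?thesis by simp
  qed
  note * = sums_of_bound_holomorphic[where g = "\<lambda>n s. (-1) ^ n * powr_diff_iter k s (of_nat (N + n))" and c = 0 and C = C, OF h b]
  show "eta_tail k N holomorphic_on {s. 0 < Re s}"
    unfolding eta_tail_def[abs_def] by (rule *(1)) (auto simp: C_def)
  show "0 < Re s \<Longrightarrow> (\<lambda>n. (-1) ^ n * powr_diff_iter k s (of_nat (N + n))) sums eta_tail k N s"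
    unfolding eta_tail_def by (rule *(2)) (auto simp: C_def)
qed

lemma eta_tail_rec:
  assumes "0 < Re s" "N \<ge> 1" "k \<ge> 1"
  shows "eta_tail k N s = powr_diff_iter k s (of_nat N) / 2 + eta_tail (Suc k) N s / 2"
proof -
  have "(\<lambda>n. (-1) ^ n * (powr_diff_iter k s (of_nat (N + n)) - powr_diff_iter k s (of_nat (N + Suc n))))
      sums (2 * eta_tail k N s - powr_diff_iter k s (of_nat (N + 0)))"
    using assms by (intro alternating_diff_sums eta_tail_holomorphic_sums) auto
  moreover have "powr_diff_iter k s (of_nat (N + n)) - powr_diff_iter k s (of_nat (N + Suc n)) = powr_diff_iter (Suc k) s (of_nat (N + n))" for n
    by (simp add: add_ac)
  moreover have "(\<lambda>n. (-1) ^ n * powr_diff_iter (Suc k) s (of_nat (N + n))) sums eta_tail (Suc k) N s"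
    using assms by (intro eta_tail_holomorphic_sums) auto
  ultimately have "2 * eta_tail k N s - powr_diff_iter k s (of_nat N) = eta_tail (Suc k) N s"
    by (simp only: add_0_right) (rule sums_unique2)
  then show ?thesis by (simp add: field_simps)
qed

text \<open>
  One step of the transformation already yields a remainder that converges absolutely for
  \<open>Re s > 0\<close>. The formula is therefore valid there by analytic continuation, and further steps are
  pure algebra.
\<close>

lemma eta_formula_1:
  assumes "0 < Re s" "s \<noteq> 1"
  shows "(1 - 2 powr (1 - s)) * riemann_zeta s
    = (\<Sum>n<M. (-1) ^ n * of_nat (Suc n) powr (-s)) + (-1) ^ M * (of_nat (Suc M) powr (-s) / 2 + eta_tail 1 (Suc M) s / 2)"
proof -
  define F where "F s = (\<Sum>n<M. (-1) ^ n * of_nat (Suc n) powr (-s)) + (-1) ^ M * (of_nat (Suc M) powr (-s) / 2 + eta_tail 1 (Suc M) s / 2)" for s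
  have "F s = (1 - 2 powr (1 - s)) * riemann_zeta s"
  proof (rule zeta_continuation_unique[where F = F and G = "\<lambda>s. (1 - 2 powr (1 - s)) * riemann_zeta s"])
    show "F holomorphic_on {s. 0 < Re s}"
      unfolding F_def[abs_def] by (intro holomorphic_intros eta_tail_holomorphic_sums) (auto simp del: of_nat_Suc)
    show "(\<lambda>s. (1 - 2 powr (1 - s)) * riemann_zeta s) holomorphic_on - {1}"
      by (intro holomorphic_intros riemann_zeta_holomorphic) auto
    fix s :: complex assume s: "1 < Re s"
    define E where "E = (1 - 2 powr (1 - s)) * riemann_zeta s"
    define S where "S = (\<Sum>n<M. (-1) ^ n * of_nat (Suc n) powr (-s))"
    have "(\<lambda>n. (-1) ^ (n + M) * of_nat (Suc (n + M)) powr (-s)) sums (E - S)"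
      unfolding E_def S_def by (intro sums_split_initial_segment eta_sums s)
    from sums_mult[OF this, of "(-1) ^ M"]
    have "(\<lambda>n. (-1) ^ n * of_nat (Suc M + n) powr (-s)) sums ((-1) ^ M * (E - S))"
      by (simp add: power_add mult_ac add_ac flip: power_mult_distrib)
    from alternating_diff_sums[OF this]
    have "(\<lambda>n. (-1) ^ n * (of_nat (Suc M + n) powr (-s) - of_nat (Suc M + Suc n) powr (-s))) sums
       (2 * ((-1) ^ M * (E - S)) - of_nat (Suc M + 0) powr (-s))" .
    moreover have "of_nat (Suc M + n) powr (-s) - of_nat (Suc M + Suc n) powr (-s) = powr_diff_iter 1 s (of_nat (Suc M + n))" for n
      by (simp add: add_ac)
    moreover have "(\<lambda>n. (-1) ^ n * powr_diff_iter 1 s (of_nat (Suc M + n))) sums eta_tail 1 (Suc M) s"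
      using s by (intro eta_tail_holomorphic_sums) auto
    ultimately have "2 * ((-1) ^ M * (E - S)) - of_nat (Suc M) powr (-s) = eta_tail 1 (Suc M) s"
      by (simp only: add_0_right) (rule sums_unique2)
    then have "(-1) ^ M * (E - S) = of_nat (Suc M) powr (-s) / 2 + eta_tail 1 (Suc M) s / 2"
      by (metis (no_types) add_diff_cancel_right' add_divide_distrib diff_add_cancel nonzero_mult_div_cancel_left add.commute zero_neq_numeral)
    then have "(-1) ^ M * ((-1) ^ M * (E - S)) = (-1) ^ M * (of_nat (Suc M) powr (-s) / 2 + eta_tail 1 (Suc M) s / 2)"
      by (rule arg_cong)
    then have "E - S = (-1) ^ M * (of_nat (Suc M) powr (-s) / 2 + eta_tail 1 (Suc M) s / 2)"
      by (simp flip: power_mult_distrib mult.assoc)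
    then show "F s = (1 - 2 powr (1 - s)) * riemann_zeta s"
      unfolding F_def E_def[symmetric] S_def[symmetric] by (simp add: algebra_simps)
  qed (use assms in auto)
  then show ?thesis by (simp add: F_def)
qed

lemma eta_tail_1_eq:
  assumes "0 < Re s" "N \<ge> 1"
  shows "of_nat N powr (-s) / 2 + eta_tail 1 N s / 2
     = (\<Sum>j\<le>k. powr_diff_iter j s (of_nat N) / 2 ^ Suc j) + eta_tail (Suc k) N s / 2 ^ Suc k"
proof (induction k)
  case (Suc k)
  then show ?case using eta_tail_rec[OF assms, of "Suc k"] by (simp add: field_simps)
qed simp

text \<open>
  Once \<open>M\<close> exceeds \<open>|s|\<close>, the boundary terms of the transformation form a geometric series with ratio
  \<open>1/2\<close>, and the remainder is of size \<open>|s| (|s| / M)\<^sup>k\<close>.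
\<close>

lemma eta_approx:
  assumes "0 < Re s" "s \<noteq> 1" "norm s + real (Suc k) \<le> real (Suc M)"
  shows "norm ((1 - 2 powr (1 - s)) * riemann_zeta s)
    \<le> norm (\<Sum>n<M. (-1) ^ n * of_nat (Suc n) powr (-s)) + 1
       + ((norm s + real (Suc k)) / 2) ^ Suc k * real (Suc M) powr (- real k) * (\<Sum>n. real (Suc n) powr (- Re s - 1))"
proof -
  have sm: "summable (\<lambda>n. real (Suc n) powr (- Re s - 1))" using assms by (subst summable_Suc_powr) simp
  have A: "norm (\<Sum>j\<le>k. powr_diff_iter j s (of_nat (Suc M)) / 2 ^ Suc j) \<le> 1"
  proof -
    have "norm (powr_diff_iter j s (of_nat (Suc M)) / 2 ^ Suc j) \<le> (1/2) ^ Suc j" if "j \<le> k" for j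
    proof -
      have "norm (powr_diff_iter j s (of_real (real (Suc M)))) \<le> (norm s + real j) ^ j * real (Suc M) powr (- Re s - real j)"
        using assms by (intro norm_powr_diff_iter_le) auto
      also have "\<dots> \<le> real (Suc M) ^ j * real (Suc M) powr (- real j)"
        using assms that by (intro mult_mono power_mono powr_mono) auto
      also have "\<dots> = 1" by (simp add: powr_minus powr_realpow del: of_nat_Suc)
      finally show ?thesis by (simp add: norm_divide norm_power divide_simps)
    qed
    then have "norm (\<Sum>j\<le>k. powr_diff_iter j s (of_nat (Suc M)) / 2 ^ Suc j) \<le> (\<Sum>j\<le>k. (1/2) ^ Suc j)"
      by (intro sum_norm_le) auto
    also have "(\<Sum>j\<le>k. (1/2::real) ^ Suc j) = 1 - (1/2) ^ Suc k"
      by (induction k) auto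
    finally have "norm (\<Sum>j\<le>k. powr_diff_iter j s (of_nat (Suc M)) / 2 ^ Suc j) \<le> 1 - (1/2) ^ Suc k" .
    moreover have "(0::real) \<le> (1/2) ^ Suc k" by simp
    ultimately show ?thesis by linarith
  qed
  have B: "norm (eta_tail (Suc k) (Suc M) s) \<le> (norm s + real (Suc k)) ^ Suc k * real (Suc M) powr (- real k) * (\<Sum>n. real (Suc n) powr (- Re s - 1))"
  proof -
    have "norm (\<Sum>n. (-1) ^ n * powr_diff_iter (Suc k) s (of_nat (Suc M + n)))
      \<le> (\<Sum>n. (norm s + real (Suc k)) ^ Suc k * real (Suc M) powr (1 - real (Suc k)) * real (Suc n) powr (- Re s - 1))"
      using assms by (intro norm_suminf_le norm_powr_diff_iter_nat_le summable_mult sm) auto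
    also have "\<dots> = (norm s + real (Suc k)) ^ Suc k * real (Suc M) powr (1 - real (Suc k)) * (\<Sum>n. real (Suc n) powr (- Re s - 1))"
      by (rule suminf_mult[OF sm])
    finally show ?thesis unfolding eta_tail_def by simp
  qed
  have "(1 - 2 powr (1 - s)) * riemann_zeta s = (\<Sum>n<M. (-1) ^ n * of_nat (Suc n) powr (-s))
      + (-1) ^ M * ((\<Sum>j\<le>k. powr_diff_iter j s (of_nat (Suc M)) / 2 ^ Suc j) + eta_tail (Suc k) (Suc M) s / 2 ^ Suc k)"
    unfolding eta_formula_1[OF assms(1,2), of M] using eta_tail_1_eq[OF assms(1), of "Suc M" k] by simp
  also have "norm \<dots> \<le> norm (\<Sum>n<M. (-1) ^ n * of_nat (Suc n) powr (-s))
      + (norm (\<Sum>j\<le>k. powr_diff_iter j s (of_nat (Suc M)) / 2 ^ Suc j) + norm (eta_tail (Suc k) (Suc M) s / 2 ^ Suc k))"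
    by (rule order.trans[OF norm_triangle_ineq add_left_mono])
       (simp add: norm_mult norm_power norm_triangle_ineq del: power_Suc sum.atMost_Suc)
  also have "norm (eta_tail (Suc k) (Suc M) s / 2 ^ Suc k) = norm (eta_tail (Suc k) (Suc M) s) / 2 ^ Suc k"
    by (simp add: norm_divide norm_power)
  also have "\<dots> \<le> (norm s + real (Suc k)) ^ Suc k * real (Suc M) powr (- real k) * (\<Sum>n. real (Suc n) powr (- Re s - 1)) / 2 ^ Suc k"
    by (intro divide_right_mono B) auto
  also have "\<dots> = ((norm s + real (Suc k)) / 2) ^ Suc k * real (Suc M) powr (- real k) * (\<Sum>n. real (Suc n) powr (- Re s - 1))"
    by (simp add: power_divide)
  finally show ?thesis using A by linarith
qed

section \<open>Mean squares on the critical line\<close>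

text \<open>
  On the critical line \<open>|2\<^sup>1\<^sup>-\<^sup>s| = \<surd>2\<close>, so the factor between eta and zeta is bounded away from \<open>0\<close>.
\<close>

lemma zeta_half_line_bound:
  "norm (riemann_zeta (Complex (1/2) t)) \<le> 5/2 * norm ((1 - 2 powr (1 - Complex (1/2) t)) * riemann_zeta (Complex (1/2) t))"
proof -
  have "norm (2 powr (1 - Complex (1/2) t)) = 2 powr (1/2)"
    using norm_powr_real_powr[of 2 "1 - Complex (1/2) t"] by simp
  also have "\<dots> = sqrt 2" by (rule powr_half_sqrt) auto
  finally have "1.4 \<le> norm (2 powr (1 - Complex (1/2) t))"
    using real_le_rsqrt[of "1.4" 2] by (simp add: power2_eq_square)
  then have "2/5 \<le> norm (1 - 2 powr (1 - Complex (1/2) t))"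
    using norm_triangle_ineq3[of "2 powr (1 - Complex (1/2) t)" 1] by (simp add: norm_minus_commute)
  then have "2/5 * norm (riemann_zeta (Complex (1/2) t)) \<le> norm (1 - 2 powr (1 - Complex (1/2) t)) * norm (riemann_zeta (Complex (1/2) t))"
    by (intro mult_right_mono) auto
  then show ?thesis by (simp add: norm_mult)
qed

lemma of_nat_powr_half_line:
  assumes "n \<ge> 1"
  shows "of_nat n powr (- Complex (1/2) t) = of_real (real n powr (-1/2)) * cis (- (t * ln (real n)))"
proof -
  have "of_nat n powr (- Complex (1/2) t) = exp (- Complex (1/2) t * of_real (ln (real n)))"
    using assms by (simp add: powr_def Ln_of_nat)
  also have "- Complex (1/2) t * of_real (ln (real n)) = of_real (- 1/2 * ln (real n)) + \<i> * of_real (- (t * ln (real n)))"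
    by (simp add: complex_eq_iff)
  also have "exp \<dots> = of_real (exp (- 1/2 * ln (real n))) * cis (- (t * ln (real n)))"
    by (simp only: exp_add cis_conv_exp exp_of_real)
  also have "exp (- 1/2 * ln (real n)) = real n powr (-1/2)"
    using assms by (simp add: powr_def)
  finally show ?thesis .
qed

lemma continuous_on_zeta_half_line: "continuous_on A (\<lambda>t. riemann_zeta (Complex (1/2) t))"
proof -
  have "continuous_on A (\<lambda>t. Complex (1/2) t)"
    unfolding complex_eq_cancel_iff2 by (auto simp: complex_eq intro!: continuous_intros)
  then show ?thesis
    by (rule continuous_on_compose2[OF holomorphic_on_imp_continuous_on[OF riemann_zeta_holomorphic]])
       (auto simp: complex_eq_iff)
qed

lemma dirichlet_poly_half_line_mean_square:
  fixes b :: "nat \<Rightarrow> complex"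
  assumes "0 \<le> T" "\<And>n. norm (b n) \<le> 1"
  shows "(\<lambda>t. (norm (\<Sum>n=1..N. b n * of_nat n powr (- Complex (1/2) t)))\<^sup>2) integrable_on {0..T}"
    and "integral {0..T} (\<lambda>t. (norm (\<Sum>n=1..N. b n * of_nat n powr (- Complex (1/2) t)))\<^sup>2)
      \<le> (T + 4 * real N * harm N) * harm N"
proof -
  define a where "a n = b n * of_real (real n powr (-1/2))" for n
  have eq: "(\<Sum>n=1..N. b n * of_nat n powr (- Complex (1/2) t)) = (\<Sum>n=1..N. a n * cis (- (t * ln (real n))))" for t
    by (intro sum.cong refl) (simp add: a_def of_nat_powr_half_line)
  show "(\<lambda>t. (norm (\<Sum>n=1..N. b n * of_nat n powr (- Complex (1/2) t)))\<^sup>2) integrable_on {0..T}"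
    unfolding eq by (rule dirichlet_poly_mean_square(1)[OF assms(1)])
  have "(\<Sum>n=1..N. (norm (a n))\<^sup>2) \<le> harm N"
    unfolding harm_def
  proof (intro sum_mono)
    fix n assume n: "n \<in> {1..N}"
    have "(norm (a n))\<^sup>2 = (norm (b n))\<^sup>2 * (real n powr (-1/2))\<^sup>2" by (simp add: a_def norm_mult power_mult_distrib)
    also have "\<dots> \<le> 1 * (real n powr (-1/2))\<^sup>2" using assms(2)[of n] by (intro mult_right_mono) (auto simp: power_le_one)
    also have "(real n powr (-1/2))\<^sup>2 = inverse (real n)"
    proof -
      have "(real n powr (-1/2))\<^sup>2 = real n powr (-1/2 + -1/2)" unfolding power2_eq_square by (rule powr_add[symmetric])
      then show ?thesis using n by (simp add: powr_minus)
    qed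
    finally show "(norm (a n))\<^sup>2 \<le> inverse (real n)" by simp
  qed
  then show "integral {0..T} (\<lambda>t. (norm (\<Sum>n=1..N. b n * of_nat n powr (- Complex (1/2) t)))\<^sup>2)
      \<le> (T + 4 * real N * harm N) * harm N"
    unfolding eq using assms(1) harm_nonneg[of N]
    by (intro order.trans[OF dirichlet_poly_mean_square(2)[OF assms(1)]] mult_left_mono add_nonneg_nonneg mult_nonneg_nonneg) auto
qed

lemma harm_le_ln: "n \<ge> 1 \<Longrightarrow> harm n \<le> ln (real n) + 1"
  using euler_mascheroni_sequence_decreasing[of 1 n] by (simp add: harm_expand)

text \<open>
  The eta function is approximated by a polynomial of length \<open>M = T\<^sup>1\<^sup>+\<^sup>\<delta>\<close>. The remainder after \<open>k\<close> steps is
  of size \<open>T (T / M)\<^sup>k = T\<^sup>1\<^sup>-\<^sup>k\<^sup>\<delta>\<close>, which is bounded as soon as \<open>k \<delta> \<ge> 1\<close>.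
\<close>

lemma zeta_half_line_mean_square:
  assumes "0 < \<epsilon>"
  shows "\<exists>C. \<forall>\<^sub>F T in at_top. integral {0..T} (\<lambda>t. (norm (riemann_zeta (Complex (1/2) t)))\<^sup>2) \<le> C * T powr (1 + \<epsilon>)"
proof -
  let ?Z = "\<lambda>t. (norm (riemann_zeta (Complex (1/2) t)))\<^sup>2"
  define \<delta> where "\<delta> = \<epsilon> / 2"
  have \<delta>: "\<delta> > 0" using assms by (simp add: \<delta>_def)
  define k where "k = nat \<lceil>1 / \<delta>\<rceil>"
  have k: "1 \<le> real k * \<delta>"
  proof -
    have "1 / \<delta> \<le> real k" unfolding k_def by (rule real_nat_ceiling_ge)
    then show ?thesis using \<delta> by (simp add: field_simps)
  qed
  define K where "K = (\<Sum>n. real (Suc n) powr (-3/2))"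
  have K: "K \<ge> 0" unfolding K_def by (intro suminf_nonneg) (subst summable_Suc_powr, auto)
  define M where "M T = nat \<lceil>T powr (1 + \<delta>)\<rceil>" for T :: real
  have main: "integral {0..T} ?Z
      \<le> 25/2 * ((T + 8 * T powr (1 + \<delta>) * (ln (2 * T powr (1 + \<delta>)) + 1)) * (ln (2 * T powr (1 + \<delta>)) + 1) + T * (1 + K)\<^sup>2)"
    if T: "T \<ge> 1" "T + 1/2 + real (Suc k) \<le> 2 * T" "2 * T \<le> T powr (1 + \<delta>)" for T
  proof -
    define D where "D t = (\<Sum>n=1..M T. (-1) ^ (n + 1) * of_nat n powr (- Complex (1/2) t))" for t
    have M: "T powr (1 + \<delta>) \<le> real (M T)" "real (M T) \<le> 2 * T powr (1 + \<delta>)"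
    proof -
      show "T powr (1 + \<delta>) \<le> real (M T)" unfolding M_def by (rule real_nat_ceiling_ge)
      have "real (M T) \<le> T powr (1 + \<delta>) + 1" unfolding M_def by (simp add: of_nat_ceiling)
      then show "real (M T) \<le> 2 * T powr (1 + \<delta>)" using T by linarith
    qed
    have M1: "M T \<ge> 1" using M T by (cases "M T = 0") auto
    have harm: "harm (M T) \<le> ln (2 * T powr (1 + \<delta>)) + 1"
    proof -
      have "ln (real (M T)) \<le> ln (2 * T powr (1 + \<delta>))" using M M1 by (intro ln_mono) auto
      then show ?thesis using harm_le_ln[OF M1] by linarith
    qed
    have ptw: "(norm (riemann_zeta (Complex (1/2) t)))\<^sup>2 \<le> 25/2 * ((norm (D t))\<^sup>2 + (1 + K)\<^sup>2)" if t: "t \<in> {0..T}" for t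
    proof -
      define s where "s = Complex (1/2) t"
      have "norm s \<le> \<bar>Re s\<bar> + \<bar>Im s\<bar>" by (rule cmod_le)
      then have ns: "norm s + real (Suc k) \<le> 2 * T" using t T by (simp add: s_def)
      have "norm ((1 - 2 powr (1 - s)) * riemann_zeta s)
        \<le> norm (\<Sum>n<M T. (-1) ^ n * of_nat (Suc n) powr (-s)) + 1
          + ((norm s + real (Suc k)) / 2) ^ Suc k * real (Suc (M T)) powr (- real k) * (\<Sum>n. real (Suc n) powr (- Re s - 1))"
      proof (rule eta_approx)
        show "norm s + real (Suc k) \<le> real (Suc (M T))" using ns T M by linarith
      qed (auto simp: s_def complex_eq_iff)
      also have "(\<Sum>n<M T. (-1) ^ n * of_nat (Suc n) powr (-s)) = D t"
        unfolding D_def s_def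
        using sum.shift_bounds_Suc_ivl[of "\<lambda>n. (-1) ^ (n + 1) * of_nat n powr (- Complex (1/2) t)" 0 "M T"]
        by (simp add: lessThan_atLeast0 atLeastLessThanSuc_atLeastAtMost)
      also have "(\<Sum>n. real (Suc n) powr (- Re s - 1)) = K" by (simp add: K_def s_def)
      also have "((norm s + real (Suc k)) / 2) ^ Suc k * real (Suc (M T)) powr (- real k) \<le> 1"
      proof -
        have "((norm s + real (Suc k)) / 2) ^ Suc k * real (Suc (M T)) powr (- real k)
          \<le> T ^ Suc k * (T powr (1 + \<delta>)) powr (- real k)"
          using ns T M by (intro mult_mono power_mono powr_mono2') auto
        also have "\<dots> = T powr (1 - real k * \<delta>)"
        proof -
          have "T ^ Suc k = T powr (1 + real k)" using T powr_realpow[of T "Suc k"] by simp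
          then show ?thesis using T by (simp only: powr_powr) (simp add: algebra_simps flip: powr_add)
        qed
        also have "\<dots> \<le> T powr 0" using k T by (intro powr_mono) auto
        finally show ?thesis using T by simp
      qed
      then have "((norm s + real (Suc k)) / 2) ^ Suc k * real (Suc (M T)) powr (- real k) * K \<le> 1 * K"
        using K by (intro mult_right_mono)
      finally have "norm (riemann_zeta s) \<le> 5/2 * (norm (D t) + (1 + K))"
        using zeta_half_line_bound[of t] unfolding s_def by simp
      then have "(norm (riemann_zeta s))\<^sup>2 \<le> (5/2 * (norm (D t) + (1 + K)))\<^sup>2" by (intro power_mono) auto
      also have "\<dots> = 25/4 * (norm (D t) + (1 + K))\<^sup>2" unfolding power_mult_distrib by (simp add: power_divide)
      also have "(norm (D t) + (1 + K))\<^sup>2 \<le> 2 * ((norm (D t))\<^sup>2 + (1 + K)\<^sup>2)"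
        using sum_squares_bound[of "norm (D t)" "1 + K"] by (simp add: power2_sum)
      finally show ?thesis by (simp add: s_def)
    qed
    have Dint: "(\<lambda>t. (norm (D t))\<^sup>2) integrable_on {0..T}"
      "integral {0..T} (\<lambda>t. (norm (D t))\<^sup>2) \<le> (T + 4 * real (M T) * harm (M T)) * harm (M T)"
      unfolding D_def using T by (intro dirichlet_poly_half_line_mean_square; simp add: norm_power)+
    have "integral {0..T} ?Z
       \<le> integral {0..T} (\<lambda>t. 25/2 * ((norm (D t))\<^sup>2 + (1 + K)\<^sup>2))"
    proof (rule integral_le[OF _ _ ptw])
      show "?Z integrable_on {0..T}"
        by (intro integrable_continuous_real continuous_intros continuous_on_zeta_half_line)
      show "(\<lambda>t. 25/2 * ((norm (D t))\<^sup>2 + (1 + K)\<^sup>2)) integrable_on {0..T}"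
        by (intro integrable_on_mult_right integrable_add Dint integrable_const_ivl)
    qed
    also have "\<dots> = 25/2 * (integral {0..T} (\<lambda>t. (norm (D t))\<^sup>2) + T * (1 + K)\<^sup>2)"
      using Dint T by (subst integral_mult_right, subst integral_add) (auto intro!: integrable_const_ivl)
    also have "\<dots> \<le> 25/2 * ((T + 4 * real (M T) * harm (M T)) * harm (M T) + T * (1 + K)\<^sup>2)"
      using Dint by simp
    also have "(T + 4 * real (M T) * harm (M T)) * harm (M T)
       \<le> (T + 4 * (2 * T powr (1 + \<delta>)) * (ln (2 * T powr (1 + \<delta>)) + 1)) * (ln (2 * T powr (1 + \<delta>)) + 1)"
      using harm M T harm_nonneg[of "M T"]
      by (intro mult_mono add_mono add_nonneg_nonneg mult_nonneg_nonneg) (auto intro: order.trans[OF harm_nonneg harm])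
    finally show ?thesis by simp
  qed
  have "\<forall>\<^sub>F T in at_top. 25/2 * ((T + 8 * T powr (1 + \<delta>) * (ln (2 * T powr (1 + \<delta>)) + 1)) * (ln (2 * T powr (1 + \<delta>)) + 1) + T * (1 + K)\<^sup>2)
      \<le> 1 * T powr (1 + 2 * \<delta>)"
    using \<delta> by real_asymp
  moreover have "\<forall>\<^sub>F T in at_top. 2 * T \<le> T powr (1 + \<delta>)" using \<delta> by real_asymp
  moreover have "\<forall>\<^sub>F T in at_top. T + 1/2 + real (Suc k) \<le> 2 * T" by real_asymp
  ultimately have "\<forall>\<^sub>F T in at_top. integral {0..T} ?Z \<le> 1 * T powr (1 + \<epsilon>)"
    using eventually_ge_at_top[of 1]
  proof eventually_elim
    case (elim T)
    then show ?case using main[of T] unfolding \<delta>_def by simp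
  qed
  then show ?thesis by blast
qed

section \<open>Simultaneous approximation\<close>

lemma cos_ge_half: "\<bar>x\<bar> \<le> pi / 3 \<Longrightarrow> 1/2 \<le> cos x"
  using cos_monotone_0_pi_le[of "\<bar>x\<bar>" "pi / 3"] by (simp add: cos_60)

lemma cos_diff_ge_half_of_floor_eq:
  fixes x y :: real
  assumes "\<lfloor>6 * frac x\<rfloor> = \<lfloor>6 * frac y\<rfloor>"
  shows "1/2 \<le> cos (2 * pi * (x - y))"
proof -
  define \<theta> where "\<theta> = frac x - frac y"
  define n where "n = \<lfloor>x\<rfloor> - \<lfloor>y\<rfloor>"
  have "x - y = of_int n + \<theta>" by (simp add: n_def \<theta>_def frac_def)
  then have "cos (2 * pi * (x - y)) = cos (2 * pi * \<theta>)"
    using cos_int_2pin[of n] sin_int_2pin[of n] by (simp add: distrib_left cos_add)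
  moreover have "\<bar>\<theta>\<bar> \<le> 1/6"
    using assms unfolding \<theta>_def by linarith
  then have "\<bar>2 * pi * \<theta>\<bar> \<le> pi / 3" by (simp add: abs_mult field_simps)
  ultimately show ?thesis using cos_ge_half by simp
qed

text \<open>
  Sort the integers below \<open>J\<close> into \<open>6\<^sup>|\<^sup>P\<^sup>|\<close> boxes according to the position of each \<open>j \<omega>\<close> modulo \<open>2\<pi>\<close> and subtract
  the least element of a largest box. Boxes of width \<open>\<pi>/3\<close> are what keeps the cosines above \<open>1/2\<close>.
\<close>

lemma simultaneous_cos_ge_half:
  fixes P :: "real set"
  assumes "finite P"
  shows "\<exists>S\<subseteq>{0..<J}. J \<le> card S * 6 ^ card P \<and> (\<forall>j\<in>S. \<forall>\<omega>\<in>P. 1/2 \<le> cos (real j * \<omega>))"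
proof (cases "J = 0")
  case False
  define f where "f j = (\<lambda>\<omega>\<in>P. nat \<lfloor>6 * frac (real j * \<omega> / (2 * pi))\<rfloor>)" for j :: nat
  define B where "B = (P \<rightarrow>\<^sub>E {0..<6::nat})"
  have range: "\<lfloor>6 * frac x\<rfloor> < 6" "0 \<le> \<lfloor>6 * frac x\<rfloor>" for x :: real
    using frac_lt_1[of x] frac_ge_0[of x] by (auto simp: floor_less_iff)
  have nat6: "nat \<lfloor>6 * frac x\<rfloor> < 6" for x :: real
    using range[of x] by linarith
  have "f \<in> {0..<J} \<rightarrow> B" unfolding f_def B_def using nat6 by auto
  moreover have "finite B" unfolding B_def using assms by (intro finite_PiE) auto
  moreover have "card B = 6 ^ card P" unfolding B_def using assms by (simp add: card_PiE)
  moreover have "B \<noteq> {}" unfolding B_def by (simp add: PiE_eq_empty_iff)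
  ultimately obtain y where y: "y \<in> B" "J \<le> card (f -` {y} \<inter> {0..<J}) * 6 ^ card P"
    using pigeonhole_card[of f "{0..<J}" B] by auto
  define A where "A = f -` {y} \<inter> {0..<J}"
  have A: "finite A" "A \<noteq> {}" using y False by (auto simp: A_def)
  define j0 where "j0 = Min A"
  have j0: "j0 \<in> A" "\<And>j. j \<in> A \<Longrightarrow> j0 \<le> j" using A by (auto simp: j0_def)
  define S where "S = (\<lambda>j. j - j0) ` A"
  have "card S = card A" unfolding S_def
    using j0 by (intro card_image) (auto simp: inj_on_def dest: le_Suc_ex eq_diff_iff)
  moreover have "S \<subseteq> {0..<J}" unfolding S_def by (auto simp: A_def)
  moreover have "1/2 \<le> cos (real j * \<omega>)" if j: "j \<in> S" and \<omega>: "\<omega> \<in> P" for j \<omega>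
  proof -
    obtain i where i: "i \<in> A" "j = i - j0" using j by (auto simp: S_def)
    have "f i \<omega> = f j0 \<omega>" using i j0 by (simp add: A_def)
    then have "\<lfloor>6 * frac (real i * \<omega> / (2 * pi))\<rfloor> = \<lfloor>6 * frac (real j0 * \<omega> / (2 * pi))\<rfloor>"
      using \<omega> by (simp add: f_def eq_nat_nat_iff)
    from cos_diff_ge_half_of_floor_eq[OF this]
    have "1/2 \<le> cos (real i * \<omega> - real j0 * \<omega>)" by (simp add: right_diff_distrib)
    then show ?thesis using i j0 by (simp add: of_nat_diff left_diff_distrib)
  qed
  ultimately show ?thesis using y(2) by (intro exI[of _ S]) (auto simp: A_def)
qed (intro exI[of _ "{}"], simp)

section \<open>The Borel-Caratheodory inequality\<close>

text \<open>
  With \<open>g = f - f c\<close> and \<open>B > sup Re g\<close>, the map \<open>g / (2B - g)\<close> sends the disc into the unit disc and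
  fixes the centre, so Schwarz's lemma applies. The summand \<open>1\<close> makes \<open>B\<close> strictly larger than the
  supremum.
\<close>

lemma Borel_Caratheodory_bound:
  fixes f :: "complex \<Rightarrow> complex"
  assumes hol: "f holomorphic_on ball c R" and r: "0 \<le> r" "r < R"
    and Re: "\<And>z. z \<in> ball c R \<Longrightarrow> Re (f z) \<le> A" and A: "0 \<le> A" and z: "norm (z - c) \<le> r"
  shows "norm (f z) \<le> norm (f c) + 2 * r / (R - r) * (A + norm (f c) + 1)"
proof -
  define B where "B = A + norm (f c) + 1"
  have B: "B > 0" using A by (simp add: B_def add_nonneg_pos)
  define g where "g w = f (c + of_real R * w) - f c" for w
  have inball: "c + of_real R * w \<in> ball c R" if "w \<in> ball 0 1" for w
    using that r by (simp add: dist_norm norm_mult)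
  have Reg: "Re (g w) < B" if "w \<in> ball 0 1" for w
    using Re[OF inball[OF that]] abs_Re_le_cmod[of "f c"] by (simp add: g_def B_def)
  have gh: "g holomorphic_on ball 0 1"
    unfolding g_def
    by (intro holomorphic_intros holomorphic_on_compose_gen[OF _ hol, unfolded o_def]) (use inball in auto)
  have ne: "of_real (2 * B) - g w \<noteq> 0" if "w \<in> ball 0 1" for w
  proof
    assume "of_real (2 * B) - g w = 0"
    then have "Re (g w) = 2 * B" by (simp add: complex_eq_iff)
    then show False using Reg[OF that] B by simp
  qed
  define h where "h w = g w / (of_real (2 * B) - g w)" for w
  have hh: "h holomorphic_on ball 0 1"
    unfolding h_def by (intro holomorphic_intros gh) (use ne in auto)
  have h0: "h 0 = 0" by (simp add: h_def g_def)
  have h1: "norm (h w) < 1" if "norm w < 1" for w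
  proof -
    have w: "w \<in> ball 0 1" using that by simp
    have "0 < 4 * B * (B - Re (g w))" using B Reg[OF w] by simp
    also have "\<dots> = (norm (of_real (2 * B) - g w))\<^sup>2 - (norm (g w))\<^sup>2"
      unfolding cmod_power2 by (simp add: power2_eq_square algebra_simps)
    finally have "norm (g w) < norm (of_real (2 * B) - g w)"
      by (auto intro: power2_less_imp_less)
    then show ?thesis using ne[OF w] by (simp add: h_def norm_divide)
  qed
  define w where "w = (z - c) / of_real R"
  have nw: "norm w \<le> r / R" using z r by (simp add: w_def norm_divide divide_right_mono)
  then have w1: "norm w < 1" using r by (auto intro: order.strict_trans1)
  have hw: "norm (h w) \<le> norm w" by (rule Schwarz_Lemma(1)[OF hh h0 h1 w1])
  have gw: "g w = f z - f c" using r by (simp add: g_def w_def)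
  have "g w * (1 + h w) = of_real (2 * B) * h w"
    using ne[of w] w1 by (simp add: h_def field_simps)
  then have "norm (g w) * norm (1 + h w) = 2 * B * norm (h w)"
    using B by (metis norm_mult norm_of_real abs_of_pos zero_less_mult_iff zero_less_numeral)
  moreover have "1 - norm w \<le> norm (1 + h w)"
    using norm_diff_ineq[of 1 "h w"] hw by simp
  ultimately have "norm (g w) * (1 - norm w) \<le> 2 * B * norm w"
    using hw B by (smt (verit) mult_left_mono norm_ge_zero)
  moreover have "norm (g w) * (1 - r / R) \<le> norm (g w) * (1 - norm w)"
    using nw by (intro mult_left_mono) auto
  moreover have "2 * B * norm w \<le> 2 * B * (r / R)" using nw B by (intro mult_left_mono) auto
  ultimately have "norm (g w) * (1 - r / R) \<le> 2 * B * (r / R)" by linarith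
  then have "norm (g w) * ((1 - r / R) * R) \<le> 2 * B * (r / R * R)"
    using mult_right_mono[of "norm (g w) * (1 - r / R)" "2 * B * (r / R)" R] r by (simp only: mult.assoc)
  moreover have "(1 - r / R) * R = R - r" "r / R * R = r" using r by (simp_all add: left_diff_distrib)
  ultimately have "norm (g w) * (R - r) \<le> 2 * B * r" by simp
  then have "norm (g w) \<le> 2 * r / (R - r) * B" using r by (simp add: field_simps)
  moreover have "norm (f z) \<le> norm (f c) + norm (f z - f c)" using norm_triangle_ineq[of "f c" "f z - f c"] by simp
  ultimately show ?thesis by (simp add: gw B_def)
qed

section \<open>A Fejer kernel with modulated transform\<close>

text \<open>
  This is \<open>(1 - cos (a u)) / u\<^sup>2\<close>, written with \<open>sinc\<close> so that it is continuous at \<open>u = 0\<close>. Its integral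
  over the real line is \<open>\<pi> |a|\<close>.
\<close>

definition vers_quot :: "real \<Rightarrow> real \<Rightarrow> real" where
  "vers_quot a u = a\<^sup>2 / 2 * (sinc (a * u / 2))\<^sup>2"

lemma one_minus_cos: "1 - cos x = 2 * (sin (x / 2))\<^sup>2" for x :: real
  using cos_double_sin[of "x / 2"] by simp

lemma vers_quot_eq: "u \<noteq> 0 \<Longrightarrow> vers_quot a u = (1 - cos (a * u)) / u\<^sup>2"
  by (cases "a = 0") (auto simp: vers_quot_def one_minus_cos power_divide power_mult_distrib)

lemma vers_quot_bounds: "0 \<le> vers_quot a u" "u \<noteq> 0 \<Longrightarrow> vers_quot a u \<le> 2 / u\<^sup>2"
proof -
  show "0 \<le> vers_quot a u" by (simp add: vers_quot_def)
  assume "u \<noteq> 0"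
  then show "vers_quot a u \<le> 2 / u\<^sup>2"
    unfolding vers_quot_eq[OF \<open>u \<noteq> 0\<close>] using cos_ge_minus_one[of "a * u"] by (intro divide_right_mono) auto
qed

lemma continuous_on_sinc': "continuous_on A f \<Longrightarrow> continuous_on A (\<lambda>x. sinc (f x :: real))"
  by (rule continuous_on_compose2[of UNIV sinc]) (auto intro: continuous_on_sinc continuous_intros)

definition vers_primitive :: "real \<Rightarrow> real \<Rightarrow> real" where
  "vers_primitive a u = a * Si (a * u) - a * sin (a * u / 2) * sinc (a * u / 2)"

lemma vers_primitive_eq: "vers_primitive a u = a * Si (a * u) - (1 - cos (a * u)) / u"
  by (cases "u = 0"; cases "a = 0") (auto simp: vers_primitive_def one_minus_cos power2_eq_square)

lemma vers_primitive_deriv: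
  assumes "u \<noteq> 0"
  shows "(vers_primitive a has_real_derivative vers_quot a u) (at u)"
proof -
  have S: "((\<lambda>u. Si (a * u)) has_real_derivative sinc (a * u) * a) (at u)"
    by (rule DERIV_chain2[OF DERIV_Si]) (auto intro!: derivative_eq_intros)
  have D: "((\<lambda>u. (1 - cos (a * u)) / u) has_real_derivative
     ((a * sin (a * u)) * u - (1 - cos (a * u)) * 1) / (u * u)) (at u)"
    using assms by (auto intro!: derivative_eq_intros simp: mult_ac)
  have "((\<lambda>u. a * Si (a * u) - (1 - cos (a * u)) / u) has_real_derivative
     a * (sinc (a * u) * a) - ((a * sin (a * u)) * u - (1 - cos (a * u)) * 1) / (u * u)) (at u)"
    by (intro DERIV_diff DERIV_cmult S D)
  also have "a * (sinc (a * u) * a) - ((a * sin (a * u)) * u - (1 - cos (a * u)) * 1) / (u * u) = vers_quot a u"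
  proof (cases "a = 0")
    case False
    then have "sinc (a * u) * a = sin (a * u) / u" using assms by simp
    then show ?thesis
      using assms by (simp only: vers_quot_eq[OF assms]) (simp add: power2_eq_square diff_divide_distrib)
  qed (use assms in \<open>simp add: vers_quot_eq\<close>)
  finally show ?thesis by (simp add: vers_primitive_eq[abs_def])
qed

lemma continuous_on_vers_primitive: "continuous_on A (vers_primitive a)"
proof -
  have "continuous_on A (\<lambda>u. Si (a * u))"
    by (rule continuous_on_compose2[of UNIV Si])
       (auto intro!: continuous_intros continuous_at_imp_continuous_on isCont_Si)
  then show ?thesis unfolding vers_primitive_def
    by (intro continuous_intros continuous_on_sinc') auto
qed

lemma has_integral_vers_quot:
  assumes "0 \<le> H"
  shows "(vers_quot a has_integral 2 * vers_primitive a H) {-H..H}"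
proof -
  have "(vers_quot a has_integral vers_primitive a H - vers_primitive a (-H)) {-H..H}"
    by (rule fundamental_theorem_of_calculus_interior_strong[of "{0}"])
       (use assms in \<open>auto intro: continuous_on_vers_primitive vers_primitive_deriv
          simp flip: has_real_derivative_iff_has_vector_derivative\<close>)
  moreover have "vers_primitive a (-H) = - vers_primitive a H"
    using Si_neg[of "a * H"] Si_neg[of "- (a * H)"]
    by (cases "0 \<le> a * H") (simp_all add: vers_primitive_eq)
  ultimately show ?thesis by simp
qed

lemma vers_primitive_tendsto: "((\<lambda>H. 2 * vers_primitive a H) \<longlongrightarrow> pi * \<bar>a\<bar>) at_top"
proof -
  have bnd: "((\<lambda>H. (1 - cos (a * H)) / H) \<longlongrightarrow> 0) at_top"
  proof (rule Lim_null_comparison)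
    show "\<forall>\<^sub>F H in at_top. norm ((1 - cos (a * H)) / H) \<le> 2 / H"
      using eventually_gt_at_top[of 0]
    proof eventually_elim
      case (elim H)
      then show ?case using cos_ge_minus_one[of "a * H"] cos_le_one[of "a * H"]
        by (simp add: divide_right_mono)
    qed
    show "((\<lambda>H. 2 / H) \<longlongrightarrow> 0) (at_top :: real filter)" by real_asymp
  qed
  have Si: "((\<lambda>H. a * Si (a * H)) \<longlongrightarrow> \<bar>a\<bar> * (pi / 2)) at_top"
  proof -
    have pos: "((\<lambda>H. Si (b * H)) \<longlongrightarrow> pi / 2) at_top" if "b > 0" for b :: real
      by (rule filterlim_compose[OF Si_at_top]) (use that in real_asymp)
    consider "a = 0" | "a > 0" | "a < 0" by linarith
    then show ?thesis
    proof cases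
      case 2
      then show ?thesis using tendsto_mult_left[OF pos[of a], of a] by simp
    next
      case 3
      have "\<forall>\<^sub>F H in at_top. (-a) * Si ((-a) * H) = a * Si (a * H)"
        using eventually_ge_at_top[of 0]
      proof eventually_elim
        case (elim H)
        then show ?case using 3 Si_neg[of "- (a * H)"] by (simp add: mult_nonpos_nonneg)
      qed
      then show ?thesis using tendsto_mult_left[OF pos[of "-a"], of "-a"] 3
        by (auto elim!: Lim_transform_eventually)
    qed auto
  qed
  have "((\<lambda>H. 2 * (a * Si (a * H) - (1 - cos (a * H)) / H)) \<longlongrightarrow> 2 * (\<bar>a\<bar> * (pi / 2) - 0)) at_top"
    by (intro tendsto_intros Si bnd)
  then show ?thesis by (simp add: vers_primitive_eq[abs_def] mult_ac)
qed

text \<open>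
  In \<open>H\<close> the integral over \<open>[-H, H]\<close> increases to its limit, while adding \<open>4 / H\<close> makes it decrease.
\<close>

lemma vers_primitive_bounds:
  assumes "0 < H"
  shows "\<bar>2 * vers_primitive a H - pi * \<bar>a\<bar>\<bar> \<le> 4 / H"
proof -
  have mono1: "2 * vers_primitive a H \<le> 2 * vers_primitive a H'" if "H \<le> H'" for H'
    using that
  proof (rule DERIV_nonneg_imp_nondecreasing)
    fix x assume "H \<le> x" "x \<le> H'"
    then show "\<exists>y. ((\<lambda>x. 2 * vers_primitive a x) has_real_derivative y) (at x) \<and> 0 \<le> y"
      using vers_primitive_deriv[of x a] vers_quot_bounds(1)[of a x] assms
      by (intro exI[of _ "2 * vers_quot a x"]) (auto intro!: derivative_eq_intros)
  qed
  have mono2: "2 * vers_primitive a H' + 4 / H' \<le> 2 * vers_primitive a H + 4 / H" if "H \<le> H'" for H'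
    using that
  proof (rule DERIV_nonpos_imp_nonincreasing)
    fix x assume x: "H \<le> x" "x \<le> H'"
    have "((\<lambda>x. 2 * vers_primitive a x + 4 / x) has_real_derivative 2 * vers_quot a x - 4 / x\<^sup>2) (at x)"
      using vers_primitive_deriv[of x a] x assms by (auto intro!: derivative_eq_intros simp: power2_eq_square)
    moreover have "2 * vers_quot a x - 4 / x\<^sup>2 \<le> 0" using vers_quot_bounds(2)[of x a] x assms by simp
    ultimately show "\<exists>y. ((\<lambda>x. 2 * vers_primitive a x + 4 / x) has_real_derivative y) (at x) \<and> y \<le> 0" by blast
  qed
  have lim2: "((\<lambda>H. 2 * vers_primitive a H + 4 / H) \<longlongrightarrow> pi * \<bar>a\<bar> + 0) at_top"
    by (intro tendsto_add vers_primitive_tendsto) real_asymp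
  have "2 * vers_primitive a H \<le> pi * \<bar>a\<bar>"
    by (rule tendsto_lowerbound[OF vers_primitive_tendsto eventually_mono[OF eventually_ge_at_top[of H] mono1]]) auto
  moreover have "pi * \<bar>a\<bar> + 0 \<le> 2 * vers_primitive a H + 4 / H"
    by (rule tendsto_upperbound[OF lim2 eventually_mono[OF eventually_ge_at_top[of H] mono2]]) auto
  ultimately show ?thesis using assms by (simp add: abs_le_iff)
qed

text \<open>
  The Fourier transform of the squared kernel \<open>(sin (h u) / u)\<^sup>2\<close>: a triangle supported on \<open>[-2h, 2h]\<close>.
\<close>

definition fejer_hat :: "real \<Rightarrow> real \<Rightarrow> real" where
  "fejer_hat h \<xi> = pi / 2 * max 0 (2 * h - \<bar>\<xi>\<bar>)"

lemma fejer_eq_vers_quot: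
  "(h * sinc (h * u))\<^sup>2 * cos (\<xi> * u) = vers_quot (\<xi> + 2 * h) u / 4 + vers_quot (\<xi> - 2 * h) u / 4 - vers_quot \<xi> u / 2"
proof (cases "u = 0")
  case False
  have 1: "(h * sinc (h * u))\<^sup>2 = (sin (h * u))\<^sup>2 / u\<^sup>2" using False by (cases "h = 0") (auto simp: power_divide)
  have "cos ((\<xi> + 2 * h) * u) + cos ((\<xi> - 2 * h) * u) = 2 * cos (\<xi> * u) * cos (2 * (h * u))"
    by (simp add: algebra_simps cos_add cos_diff)
  also have "\<dots> = 2 * cos (\<xi> * u) * (1 - 2 * (sin (h * u))\<^sup>2)" by (simp only: cos_double_sin)
  also have "\<dots> = 2 * cos (\<xi> * u) - 4 * ((sin (h * u))\<^sup>2 * cos (\<xi> * u))" by (simp add: algebra_simps)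
  finally have 2: "(1 - cos ((\<xi> + 2 * h) * u)) / 4 + (1 - cos ((\<xi> - 2 * h) * u)) / 4 - (1 - cos (\<xi> * u)) / 2
      = (sin (h * u))\<^sup>2 * cos (\<xi> * u)" by argo
  have *: "A / 4 + B / 4 - C / 2 = s * c \<Longrightarrow> s / w * c = A / w / 4 + B / w / 4 - C / w / 2" for A B C s c w :: real
    by (cases "w = 0") (simp_all add: field_simps)
  show ?thesis unfolding vers_quot_eq[OF False] 1 by (rule *[OF 2])
next
  case True
  have "(\<xi> + 2 * h)\<^sup>2 / 2 / 4 + (\<xi> - 2 * h)\<^sup>2 / 2 / 4 - \<xi>\<^sup>2 / 2 / 2 = h\<^sup>2"
    by (simp add: power2_eq_square field_simps)
  then show ?thesis using True by (simp add: vers_quot_def)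
qed

lemma fejer_transform:
  assumes "0 < H" "0 \<le> h"
  shows "(\<lambda>u. (h * sinc (h * u))\<^sup>2 * cos (\<xi> * u)) integrable_on {-H..H}"
    and "\<bar>integral {-H..H} (\<lambda>u. (h * sinc (h * u))\<^sup>2 * cos (\<xi> * u)) - fejer_hat h \<xi>\<bar> \<le> 4 / H"
proof -
  define Q where "Q a = 2 * vers_primitive a H" for a
  have HI: "((\<lambda>u. (h * sinc (h * u))\<^sup>2 * cos (\<xi> * u)) has_integral Q (\<xi> + 2 * h) / 4 + Q (\<xi> - 2 * h) / 4 - Q \<xi> / 2) {-H..H}"
    unfolding fejer_eq_vers_quot Q_def using assms
    by (intro has_integral_diff has_integral_add has_integral_divide has_integral_vers_quot) auto
  then show "(\<lambda>u. (h * sinc (h * u))\<^sup>2 * cos (\<xi> * u)) integrable_on {-H..H}" by blast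
  have "fejer_hat h \<xi> = pi * \<bar>\<xi> + 2 * h\<bar> / 4 + pi * \<bar>\<xi> - 2 * h\<bar> / 4 - pi * \<bar>\<xi>\<bar> / 2"
  proof -
    have "max 0 (2 * h - \<bar>\<xi>\<bar>) = (\<bar>\<xi> + 2 * h\<bar> + \<bar>\<xi> - 2 * h\<bar> - 2 * \<bar>\<xi>\<bar>) / 2"
      using assms(2) by (simp add: max_def abs_if)
    then show ?thesis unfolding fejer_hat_def by (simp only:) (simp add: field_simps)
  qed
  moreover have "\<bar>Q a - pi * \<bar>a\<bar>\<bar> \<le> 4 / H" for a
    unfolding Q_def by (rule vers_primitive_bounds[OF assms(1)])
  note this[of "\<xi> + 2 * h"] this[of "\<xi> - 2 * h"] this[of \<xi>]
  ultimately show "\<bar>integral {-H..H} (\<lambda>u. (h * sinc (h * u))\<^sup>2 * cos (\<xi> * u)) - fejer_hat h \<xi>\<bar> \<le> 4 / H"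
    unfolding integral_unique[OF HI] by (simp add: abs_le_iff)
qed

text \<open>
  The factor \<open>1 - cos (l u)\<close> keeps the kernel nonnegative and subtracts from its transform half of
  its translates by \<open>\<plusminus>l\<close>. Beyond the support of the central triangle the transform is thus nonpositive.
\<close>

definition shifted_fejer :: "real \<Rightarrow> real \<Rightarrow> real \<Rightarrow> real" where
  "shifted_fejer h l u = (1 - cos (l * u)) * (h * sinc (h * u))\<^sup>2"

lemma shifted_fejer_nonneg: "0 \<le> shifted_fejer h l u"
  by (simp add: shifted_fejer_def)

lemma continuous_on_shifted_fejer: "continuous_on A (shifted_fejer h l)"
proof -
  have "continuous_on A (\<lambda>u. sinc (h * u))"
    by (rule continuous_on_sinc') (intro continuous_intros)
  then show ?thesis unfolding shifted_fejer_def
    by (rule continuous_on_mult[OF _ continuous_on_power[OF continuous_on_mult[OF continuous_on_const]], rotated])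
       (intro continuous_intros)
qed

lemma shifted_fejer_transform:
  assumes "0 < H" "0 \<le> h"
  shows "\<bar>integral {-H..H} (\<lambda>u. shifted_fejer h l u * cos (\<theta> + \<xi> * u))
      - cos \<theta> * (fejer_hat h \<xi> - fejer_hat h (\<xi> - l) / 2 - fejer_hat h (\<xi> + l) / 2)\<bar> \<le> 8 / H"
proof -
  define S where "S \<xi> = integral {-H..H} (\<lambda>u. (h * sinc (h * u))\<^sup>2 * cos (\<xi> * u))" for \<xi>
  have S: "((\<lambda>u. (h * sinc (h * u))\<^sup>2 * cos (\<xi> * u)) has_integral S \<xi>) {-H..H}" for \<xi>
    unfolding S_def by (rule integrable_integral[OF fejer_transform(1)[OF assms]])
  define Z where "Z = integral {-H..H} (\<lambda>u. shifted_fejer h l u * sin (\<xi> * u))"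
  have Z: "((\<lambda>u. shifted_fejer h l u * sin (\<xi> * u)) has_integral Z) {-H..H}"
    unfolding Z_def by (intro integrable_integral integrable_continuous_real continuous_intros continuous_on_shifted_fejer)
  have "((\<lambda>u. shifted_fejer h l (-u) * sin (\<xi> * (-u))) has_integral Z) {-H..H}"
    using Z by (subst (asm) has_integral_reflect_real[symmetric]) simp
  then have "((\<lambda>u. - (shifted_fejer h l u * sin (\<xi> * u))) has_integral Z) {-H..H}"
    by (simp add: shifted_fejer_def cong: if_cong)
  from has_integral_unique[OF has_integral_neg[OF Z] this] have Z0: "Z = 0" by simp
  have C: "((\<lambda>u. shifted_fejer h l u * cos (\<xi> * u)) has_integral S \<xi> - S (\<xi> - l) / 2 - S (\<xi> + l) / 2) {-H..H}"
  proof -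
    have "shifted_fejer h l u * cos (\<xi> * u) = (h * sinc (h * u))\<^sup>2 * cos (\<xi> * u)
       - (h * sinc (h * u))\<^sup>2 * cos ((\<xi> - l) * u) / 2 - (h * sinc (h * u))\<^sup>2 * cos ((\<xi> + l) * u) / 2" for u
    proof -
      have "cos ((\<xi> - l) * u) + cos ((\<xi> + l) * u) = 2 * cos (\<xi> * u) * cos (l * u)"
        by (simp add: left_diff_distrib distrib_right cos_add cos_diff)
      then have "F * cos ((\<xi> - l) * u) + F * cos ((\<xi> + l) * u) = F * (2 * cos (\<xi> * u) * cos (l * u))" for F
        by (simp only: distrib_left[symmetric])
      from this[of "(h * sinc (h * u))\<^sup>2"] show ?thesis
        unfolding shifted_fejer_def left_diff_distrib by argo
    qed
    then show ?thesis by (simp only:) (intro has_integral_diff has_integral_divide S)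
  qed
  have "((\<lambda>u. cos \<theta> * (shifted_fejer h l u * cos (\<xi> * u)) - sin \<theta> * (shifted_fejer h l u * sin (\<xi> * u)))
     has_integral cos \<theta> * (S \<xi> - S (\<xi> - l) / 2 - S (\<xi> + l) / 2) - sin \<theta> * Z) {-H..H}"
    by (intro has_integral_diff has_integral_mult_right C Z)
  then have "integral {-H..H} (\<lambda>u. shifted_fejer h l u * cos (\<theta> + \<xi> * u)) = cos \<theta> * (S \<xi> - S (\<xi> - l) / 2 - S (\<xi> + l) / 2)"
    unfolding Z0 cos_add right_diff_distrib[of "shifted_fejer h l _"] mult.left_commute[of "cos \<theta>"] mult.left_commute[of "sin \<theta>"]
    by (simp only: integral_unique mult_zero_right diff_0_right)
  moreover have "\<bar>(S \<xi> - S (\<xi> - l) / 2 - S (\<xi> + l) / 2) - (fejer_hat h \<xi> - fejer_hat h (\<xi> - l) / 2 - fejer_hat h (\<xi> + l) / 2)\<bar> \<le> 8 / H"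
    using fejer_transform(2)[OF assms, of \<xi>] fejer_transform(2)[OF assms, of "\<xi> - l"] fejer_transform(2)[OF assms, of "\<xi> + l"]
    unfolding S_def by (simp only: abs_le_iff) argo
  moreover have "\<bar>cos \<theta>\<bar> * \<bar>(S \<xi> - S (\<xi> - l) / 2 - S (\<xi> + l) / 2) - (fejer_hat h \<xi> - fejer_hat h (\<xi> - l) / 2 - fejer_hat h (\<xi> + l) / 2)\<bar>
     \<le> 1 * \<bar>(S \<xi> - S (\<xi> - l) / 2 - S (\<xi> + l) / 2) - (fejer_hat h \<xi> - fejer_hat h (\<xi> - l) / 2 - fejer_hat h (\<xi> + l) / 2)\<bar>"
    by (intro mult_right_mono) auto
  ultimately show ?thesis by (simp only: right_diff_distrib[symmetric] abs_mult mult_1)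
qed

section \<open>Zero density\<close>

text \<open>
  The integral over the left side, traversed upwards, is isolated; the other three sides are
  estimated trivially.
\<close>

lemma rectpath_integral_bound:
  fixes g :: "complex \<Rightarrow> complex"
  assumes ab: "a < b" "c < d"
    and I: "(g has_contour_integral I) (rectpath (Complex a c) (Complex b d))"
    and cont: "continuous_on (path_image (rectpath (Complex a c) (Complex b d))) g"
    and hor: "\<And>x. a \<le> x \<Longrightarrow> x \<le> b \<Longrightarrow> norm (g (Complex x c)) \<le> B1"
      "\<And>x. a \<le> x \<Longrightarrow> x \<le> b \<Longrightarrow> norm (g (Complex x d)) \<le> B1"
    and right: "\<And>v. c \<le> v \<Longrightarrow> v \<le> d \<Longrightarrow> norm (g (Complex b v)) \<le> B2"
  shows "norm (I + \<i> * integral {c..d} (\<lambda>v. g (Complex a v))) \<le> 2 * B1 * (b - a) + B2 * (d - c)"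
proof -
  define a1 a2 a3 a4 where "a1 = Complex a c" "a2 = Complex b c" "a3 = Complex b d" "a4 = Complex a d"
  note defs = this
  have img: "path_image (rectpath a1 a3) = {z. Re z \<in> {a, b} \<and> Im z \<in> {c..d}} \<union> {z. Im z \<in> {c, d} \<and> Re z \<in> {a..b}}"
    using ab by (subst path_image_rectpath) (auto simp: defs)
  have seg: "closed_segment a1 a2 = {z. Im z = c \<and> Re z \<in> {a..b}}" "closed_segment a2 a3 = {z. Re z = b \<and> Im z \<in> {c..d}}"
      "closed_segment a3 a4 = {z. Im z = d \<and> Re z \<in> {a..b}}" "closed_segment a4 a1 = {z. Re z = a \<and> Im z \<in> {c..d}}"
    using ab by (auto simp: defs closed_segment_same_Re closed_segment_same_Im closed_segment_eq_real_ivl)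
  have int: "g contour_integrable_on linepath a1 a2" "g contour_integrable_on linepath a2 a3"
      "g contour_integrable_on linepath a3 a4" "g contour_integrable_on linepath a4 a1"
    by (rule contour_integrable_continuous_linepath, rule continuous_on_subset[OF cont[folded defs]], use ab in \<open>auto simp: img seg\<close>)+
  have "I = contour_integral (rectpath a1 a3) g" using I unfolding defs by (simp add: contour_integral_unique)
  also have "rectpath a1 a3 = linepath a1 a2 +++ linepath a2 a3 +++ linepath a3 a4 +++ linepath a4 a1"
    by (simp add: rectpath_def defs Let_def)
  also have "contour_integral \<dots> g = contour_integral (linepath a1 a2) g + (contour_integral (linepath a2 a3) g
      + (contour_integral (linepath a3 a4) g + contour_integral (linepath a4 a1) g))"
    by (subst contour_integral_join contour_integrable_joinI | use int in \<open>auto intro!: contour_integrable_joinI valid_path_join\<close>)+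
  also have "contour_integral (linepath a4 a1) g = - contour_integral (linepath a1 a4) g"
    using int cont by (intro contour_integral_reverse_linepath continuous_on_subset[OF cont[folded defs]]) (use ab in \<open>auto simp: img seg\<close>)
  also have "contour_integral (linepath a1 a4) g = \<i> * integral {c..d} (\<lambda>v. g (Complex a v))"
    using ab by (intro contour_integral_linepath_same_Re) (auto simp: defs)
  finally have eq: "I + \<i> * integral {c..d} (\<lambda>v. g (Complex a v))
      = contour_integral (linepath a1 a2) g + contour_integral (linepath a2 a3) g + contour_integral (linepath a3 a4) g"
    by simp
  have B: "0 \<le> B1" "0 \<le> B2"
    using order.trans[OF norm_ge_zero hor(1)[of a]] order.trans[OF norm_ge_zero right[of c]] ab by simp_all
  have n1: "norm (contour_integral (linepath a1 a2) g) \<le> B1 * norm (a2 - a1)"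
    by (rule contour_integral_bound_linepath[OF int(1) B(1)]) (use hor(1)[of "Re _"] in \<open>auto simp: seg\<close>, metis complex_surj)
  have n2: "norm (contour_integral (linepath a2 a3) g) \<le> B2 * norm (a3 - a2)"
    by (rule contour_integral_bound_linepath[OF int(2) B(2)]) (use right[of "Im _"] in \<open>auto simp: seg\<close>, metis complex_surj)
  have n3: "norm (contour_integral (linepath a3 a4) g) \<le> B1 * norm (a4 - a3)"
    by (rule contour_integral_bound_linepath[OF int(3) B(1)]) (use hor(2)[of "Re _"] in \<open>auto simp: seg\<close>, metis complex_surj)
  have l: "norm (a2 - a1) = b - a" "norm (a3 - a2) = d - c" "norm (a4 - a3) = b - a"
    using ab by (auto simp: defs cmod_def)
  have "norm (I + \<i> * integral {c..d} (\<lambda>v. g (Complex a v)))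
     \<le> norm (contour_integral (linepath a1 a2) g) + norm (contour_integral (linepath a2 a3) g) + norm (contour_integral (linepath a3 a4) g)"
    unfolding eq by (intro order.trans[OF norm_triangle_ineq] add_right_mono norm_triangle_ineq)
  then show ?thesis using n1 n2 n3 unfolding l by (simp add: algebra_simps)
qed

definition mollifier :: "nat \<Rightarrow> complex \<Rightarrow> complex" where
  "mollifier X s = (\<Sum>d=1..X. of_real (moebius_mu d) * of_nat d powr (-s))"

text \<open>
  Equal to \<open>-1\<close> at zeros of zeta. For \<open>Re s > 1\<close> its Dirichlet series starts only after \<open>n = X\<close>.
\<close>

definition mollified_error :: "nat \<Rightarrow> complex \<Rightarrow> complex" where
  "mollified_error X s = riemann_zeta s * mollifier X s - 1"

lemma norm_of_nat_powr: "d \<ge> 1 \<Longrightarrow> norm (of_nat d powr s :: complex) = real d powr Re s"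
  using norm_Suc_powr[of "d - 1" s] by simp

lemma mollifier_holomorphic: "mollifier X holomorphic_on A"
  unfolding mollifier_def by (intro holomorphic_intros) auto

lemma norm_mollifier_le:
  assumes "0 \<le> Re s"
  shows "norm (mollifier X s) \<le> real X"
proof -
  have "norm (of_real (moebius_mu d) * of_nat d powr (-s) :: complex) \<le> 1" if "d \<in> {1..X}" for d
  proof -
    have "real d powr (- Re s) \<le> 1" using that assms powr_mono[of "- Re s" 0 "real d"] by simp
    then show ?thesis using that abs_moebius_mu_le[of d]
      by (auto simp: norm_mult norm_of_nat_powr intro: mult_le_one)
  qed
  then have "norm (mollifier X s) \<le> (\<Sum>d=1..X. 1)" unfolding mollifier_def by (intro sum_norm_le) auto
  then show ?thesis by simp
qed

text \<open>
  The coefficients are at most the number of divisors, hence at most \<open>n\<close>. The line \<open>Re s = 7\<close> is far enough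
  to the right for the saving \<open>X\<^sup>-\<^sup>4\<close> to beat the weight \<open>W\<^sup>1\<^sup>3\<^sup>/\<^sup>2\<close> with \<open>W = \<surd>X\<close> in the proof of
  \<open>zero_detection\<close>.
\<close>

lemma mollified_error_right:
  obtains K where "0 < K" "\<And>X s. 1 \<le> X \<Longrightarrow> Re s = 7 \<Longrightarrow> norm (mollified_error X s) \<le> K * real X powr (-4)"
proof -
  define K where "K = (\<Sum>n. real (Suc n) powr (-2))"
  have sm: "summable (\<lambda>n. real (Suc n) powr (-2))" by (subst summable_Suc_powr) simp
  have K: "0 < K" unfolding K_def by (intro suminf_pos sm) auto
  have "norm (mollified_error X s) \<le> K * real X powr (-4)" if X: "1 \<le> X" and s: "Re s = 7" for X s
  proof -
    define c where "c n = (\<Sum>d | d dvd Suc n \<and> d \<le> X. moebius_mu d)" for n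
    have c0: "c 0 = 1"
    proof -
      have "{d. d dvd Suc 0 \<and> d \<le> X} = {1}" using X by auto
      then show ?thesis by (simp add: c_def)
    qed
    have c1: "c n = 0" if "0 < n" "n < X" for n
    proof -
      have "{d. d dvd Suc n \<and> d \<le> X} = {d. d dvd Suc n}"
        using that by (auto intro: order.trans[OF dvd_imp_le])
      then show ?thesis using sum_moebius_mu_divisors[of "Suc n"] that by (simp add: c_def)
    qed
    have c2: "\<bar>c n\<bar> \<le> real (Suc n)" for n
    proof -
      have "\<bar>c n\<bar> \<le> (\<Sum>d | d dvd Suc n \<and> d \<le> X. 1)"
        unfolding c_def by (rule order.trans[OF sum_abs]) (intro sum_mono abs_moebius_mu_le)
      also have "\<dots> = real (card {d. d dvd Suc n \<and> d \<le> X})" by simp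
      also have "card {d. d dvd Suc n \<and> d \<le> X} \<le> card {1..Suc n}"
        by (intro card_mono) (auto dest: dvd_imp_le intro!: Suc_leI Nat.gr0I)
      finally show ?thesis by simp
    qed
    have 1: "(\<lambda>n. of_real (c n) * of_nat (Suc n) powr (-s)) sums (riemann_zeta s * mollifier X s)"
      unfolding c_def mollifier_def using s by (intro sums_zeta_times_dirichlet_poly) auto
    have 2: "(\<lambda>n. if n = 0 then 1 else 0) sums (1::complex)"
      using sums_single[of 0 "\<lambda>_. 1::complex"] by simp
    have 3: "(\<lambda>n. of_real (c n) * of_nat (Suc n) powr (-s) - (if n = 0 then 1 else 0)) sums mollified_error X s"
      unfolding mollified_error_def by (rule sums_diff[OF 1 2])
    have bnd: "norm (of_real (c n) * of_nat (Suc n) powr (-s) - (if n = 0 then 1 else 0)) \<le> real X powr (-4) * real (Suc n) powr (-2)" for n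
    proof (cases "n < X")
      case True
      then have "of_real (c n) * of_nat (Suc n) powr (-s) - (if n = 0 then 1 else 0) = (0::complex)"
        using c0 c1[of n] by auto
      then show ?thesis by simp
    next
      case False
      then have "norm (of_real (c n) * of_nat (Suc n) powr (-s) - (if n = 0 then 1 else 0)) = \<bar>c n\<bar> * real (Suc n) powr (-7)"
        using X s by (simp add: norm_mult norm_Suc_powr del: of_nat_Suc)
      also have "\<dots> \<le> real (Suc n) powr 1 * real (Suc n) powr (-7)"
        using c2[of n] by (intro mult_right_mono) auto
      also have "\<dots> = real (Suc n) powr (-4) * real (Suc n) powr (-2)"
        by (simp only: powr_add[symmetric]) simp
      also have "\<dots> \<le> real X powr (-4) * real (Suc n) powr (-2)"
        using False X by (intro mult_right_mono powr_mono2') auto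
      finally show ?thesis .
    qed
    have "norm (mollified_error X s) \<le> (\<Sum>n. real X powr (-4) * real (Suc n) powr (-2))"
      using norm_suminf_le[OF bnd summable_mult[OF sm]] 3 by (simp only: sums_iff)
    also have "\<dots> = real X powr (-4) * K" unfolding K_def by (rule suminf_mult[OF sm])
    finally show ?thesis by (simp add: mult.commute)
  qed
  then show ?thesis using that K by blast
qed

lemma continuous_on_mollified_error_half_line:
  "continuous_on A (\<lambda>t. mollified_error X (Complex (1/2) t))"
proof -
  have "continuous_on A (\<lambda>t. Complex (1/2) t)" by (auto simp: complex_eq intro!: continuous_intros)
  then have "continuous_on A (\<lambda>t. mollifier X (Complex (1/2) t))"
    by (rule continuous_on_compose2[OF holomorphic_on_imp_continuous_on[OF mollifier_holomorphic[of X UNIV]]]) auto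
  then show ?thesis unfolding mollified_error_def by (intro continuous_intros continuous_on_zeta_half_line)
qed

text \<open>
  Cauchy's formula for \<open>(\<zeta>M - 1) W\<^sup>s\<^sup>-\<^sup>\<rho> exp ((s - \<rho>)\<^sup>2) / (s - \<rho>)\<close> on the rectangle \<open>1/2 \<le> Re s \<le> 7\<close>,
  \<open>|Im (s - \<rho>)| \<le> H\<close>, with \<open>M\<close> of length \<open>T\<close> and \<open>W = \<surd>T\<close>. The Gaussian factor kills the horizontal
  sides and the mollifier the right side. On the left side \<open>|W\<^sup>s\<^sup>-\<^sup>\<rho>| \<le> T\<^sup>-\<^sup>\<eta>\<^sup>/\<^sup>2\<close>, so the integral of
  \<open>|\<zeta>M - 1|\<close> there must be at least of order \<open>T\<^sup>\<eta>\<^sup>/\<^sup>2\<close> to produce the value \<open>2\<pi>\<close>.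
\<close>

lemma zero_detection:
  assumes \<eta>: "0 < \<eta>"
  shows "\<forall>\<^sub>F T in at_top. \<forall>H \<rho>. ln T \<le> H \<longrightarrow> H \<le> sqrt T \<longrightarrow> riemann_zeta \<rho> = 0 \<longrightarrow> 1/2 + \<eta> \<le> Re \<rho> \<longrightarrow> Re \<rho> \<le> 2
     \<longrightarrow> H + 1 \<le> Im \<rho> \<longrightarrow> Im \<rho> \<le> T \<longrightarrow>
     \<eta> * T powr (\<eta> / 2) / 6 \<le> integral {Im \<rho> - H..Im \<rho> + H} (\<lambda>v. norm (mollified_error (nat \<lfloor>T\<rfloor>) (Complex (1/2) v)))"
proof -
  obtain K where K: "0 < K" "\<And>X s. 1 \<le> X \<Longrightarrow> Re s = 7 \<Longrightarrow> norm (mollified_error X s) \<le> K * real X powr (-4)"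
    by (rule mollified_error_right) blast
  obtain C where C: "0 < C" "\<And>s. 1/2 \<le> Re s \<Longrightarrow> 1 \<le> norm (s - 1) \<Longrightarrow> norm (riemann_zeta s) \<le> C * norm s"
    by (rule zeta_growth) blast
  have main: "\<eta> * T powr (\<eta> / 2) / 6 \<le> integral {Im \<rho> - H..Im \<rho> + H} (\<lambda>v. norm (mollified_error (nat \<lfloor>T\<rfloor>) (Complex (1/2) v)))"
    if T: "T \<ge> exp 1"
      and small: "13 * ((C * (7 + 2 * T) * T + 1) * T powr (13/4) * exp (43 - (ln T)\<^sup>2)) + K * (T/2) powr (-4) * T powr (13/4) * exp 43 * (2 * sqrt T) \<le> 1"
      and H: "ln T \<le> H" "H \<le> sqrt T" and \<rho>: "riemann_zeta \<rho> = 0" "1/2 + \<eta> \<le> Re \<rho>" "Re \<rho> \<le> 2" "H + 1 \<le> Im \<rho>" "Im \<rho> \<le> T"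
    for T H \<rho>
  proof -
    have T2: "T \<ge> 2" using T exp_ge_add_one_self[of 1] by linarith
    have lnT: "ln T \<ge> 1" using T T2 by (metis exp_gt_zero ln_exp ln_mono)
    have H1: "H \<ge> 1" using lnT H by linarith
    define X where "X = nat \<lfloor>T\<rfloor>"
    have X: "1 \<le> X" "real X \<le> T" "T / 2 \<le> real X" using T2 by (auto simp: X_def le_nat_iff le_floor_iff) linarith+
    define W where "W = sqrt T"
    have W: "W \<ge> 1" "W = T powr (1/2)" using T2 by (auto simp: W_def powr_half_sqrt)
    define F where "F = mollified_error X"
    let ?I = "integral {Im \<rho> - H..Im \<rho> + H} (\<lambda>v. norm (F (Complex (1/2) v)))"
    define E where "E = (\<lambda>s. of_real W powr (s - \<rho>) * exp ((s - \<rho>)\<^sup>2))"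
    have normE: "norm (E s) = W powr (Re s - Re \<rho>) * exp ((Re s - Re \<rho>)\<^sup>2 - (Im s - Im \<rho>)\<^sup>2)" for s
      using W(1) norm_of_real_powr[of W "s - \<rho>"] by (simp add: E_def norm_mult power2_eq_square)
    define S where "S = {s. 0 < Re s} \<inter> {s. 1/2 < Im s}"
    have S: "convex S" "open S" unfolding S_def
      by (intro convex_Int convex_halfspace_Re_gt convex_halfspace_Im_gt open_Int open_halfspace_Re_gt open_halfspace_Im_gt)+
    have holo: "(\<lambda>s. F s * E s) holomorphic_on S"
      unfolding F_def mollified_error_def E_def using W
      by (intro holomorphic_intros mollifier_holomorphic holomorphic_on_subset[OF riemann_zeta_holomorphic])
         (auto simp: S_def)
    define g where "g = (\<lambda>s. F s * E s / (s - \<rho>))"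
    define R where "R = rectpath (Complex (1/2) (Im \<rho> - H)) (Complex 7 (Im \<rho> + H))"
    have img: "path_image R \<subseteq> S - {\<rho>}"
      unfolding R_def using H1 \<rho> \<eta> by (subst path_image_rectpath) (auto simp: S_def)
    have \<rho>box: "\<rho> \<in> box (Complex (1/2) (Im \<rho> - H)) (Complex 7 (Im \<rho> + H))"
      using H1 \<rho> \<eta> by (simp add: in_box_complex_iff)
    have I: "(g has_contour_integral (- (2 * pi * \<i>))) R"
    proof -
      have "(g has_contour_integral (2 * pi * \<i> * winding_number R \<rho> * (F \<rho> * E \<rho>))) R"
        unfolding g_def
      proof (rule Cauchy_integral_formula_convex_simple[OF S(1) holo])
        show "\<rho> \<in> interior S" unfolding interior_open[OF S(2)] using \<rho> H1 \<eta> by (auto simp: S_def)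
      qed (use img in \<open>auto simp: R_def\<close>)
      moreover have "winding_number R \<rho> = 1" unfolding R_def by (rule winding_number_rectpath[OF \<rho>box])
      moreover have "F \<rho> = -1" using \<rho> by (simp add: F_def mollified_error_def)
      moreover have "E \<rho> = 1" using W(1) by (simp add: E_def)
      ultimately show ?thesis by simp
    qed
    have contg: "continuous_on (path_image R) g"
      unfolding g_def using img
      by (intro continuous_on_divide continuous_on_subset[OF holomorphic_on_imp_continuous_on[OF holo]] continuous_intros) auto
    have Fb: "norm (F s) \<le> C * (7 + 2 * T) * T + 1" if s: "1/2 \<le> Re s" "Re s \<le> 7" "1 \<le> Im s" "Im s \<le> 2 * T" for s
    proof -
      have "\<bar>Im (s - 1)\<bar> \<le> norm (s - 1)" by (rule abs_Im_le_cmod)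
      then have "norm (riemann_zeta s) \<le> C * norm s" using s by (intro C(2)) auto
      also have "norm s \<le> 7 + 2 * T" using cmod_le[of s] s by linarith
      finally have "norm (riemann_zeta s) \<le> C * (7 + 2 * T)" using C(1) by simp
      moreover have "norm (mollifier X s) \<le> T" using norm_mollifier_le[of s X] s X by linarith
      ultimately have "norm (riemann_zeta s * mollifier X s) \<le> C * (7 + 2 * T) * T"
        unfolding norm_mult using C(1) T2 by (intro mult_mono) auto
      then show ?thesis unfolding F_def mollified_error_def
        using norm_triangle_ineq4[of "riemann_zeta s * mollifier X s" 1] by simp
    qed
    \<comment> \<open>The rectangle reaches at most \<open>13/2\<close> to the right of \<open>\<rho>\<close>; this gives the exponents \<open>43 \<ge> (13/2)\<^sup>2\<close> and \<open>13/4\<close>.\<close>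
    have sq43: "(x - Re \<rho>)\<^sup>2 \<le> 43" if "1/2 \<le> x" "x \<le> 7" for x
    proof -
      have "\<bar>x - Re \<rho>\<bar> \<le> 13/2" using that \<rho> \<eta> unfolding abs_le_iff by argo
      then have "\<bar>x - Re \<rho>\<bar>\<^sup>2 \<le> (13/2)\<^sup>2" by (intro power_mono) auto
      then show ?thesis by (simp add: power2_eq_square)
    qed
    have Wb: "W powr (x - Re \<rho>) \<le> T powr (13/4)" if "1/2 \<le> x" "x \<le> 7" for x
    proof -
      have "W powr (x - Re \<rho>) \<le> W powr (13/2)" using W \<rho> \<eta> that by (intro powr_mono) auto
      then show ?thesis using T2 by (simp add: W powr_powr)
    qed
    \<comment> \<open>\<open>B1\<close> will bound the integrand on the horizontal sides and \<open>B2\<close> on the right side.\<close>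
    define B1 where "B1 = (C * (7 + 2 * T) * T + 1) * T powr (13/4) * exp (43 - (ln T)\<^sup>2)"
    define B2 where "B2 = K * (T/2) powr (-4) * T powr (13/4) * exp 43"
    have hor: "norm (g (Complex x v)) \<le> B1" if x: "1/2 \<le> x" "x \<le> 7" and v: "v = Im \<rho> - H \<or> v = Im \<rho> + H" for x v
    proof -
      have sqrtT: "sqrt T \<le> T" using T2 by (intro real_le_lsqrt) (auto simp: power2_eq_square)
      have "norm (E (Complex x v)) \<le> T powr (13/4) * exp (43 - (ln T)\<^sup>2)"
      proof -
        have "(ln T)\<^sup>2 \<le> H\<^sup>2" using H lnT by (intro power_mono) auto
        moreover have "(v - Im \<rho>)\<^sup>2 = H\<^sup>2" using v by auto
        ultimately show ?thesis unfolding normE using Wb[OF x] sq43[OF x] by (intro mult_mono) auto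
      qed
      moreover have "norm (F (Complex x v)) \<le> C * (7 + 2 * T) * T + 1"
        using x v \<rho> H H1 sqrtT by (intro Fb) auto
      ultimately have "norm (F (Complex x v)) * norm (E (Complex x v)) \<le> B1"
        unfolding B1_def mult.assoc using C(1) T2 by (intro mult_mono) auto
      moreover have "1 \<le> norm (Complex x v - \<rho>)"
        using abs_Im_le_cmod[of "Complex x v - \<rho>"] v H1 by auto
      moreover have "norm (F (Complex x v)) * norm (E (Complex x v)) / norm (Complex x v - \<rho>) \<le> norm (F (Complex x v)) * norm (E (Complex x v)) / 1"
        using \<open>1 \<le> norm (Complex x v - \<rho>)\<close> by (intro divide_left_mono) auto
      ultimately show ?thesis unfolding g_def norm_divide norm_mult by simp
    qed
    have right: "norm (g (Complex 7 v)) \<le> B2" if "Im \<rho> - H \<le> v" "v \<le> Im \<rho> + H" for v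
    proof -
      have "norm (E (Complex 7 v)) \<le> T powr (13/4) * exp 43"
        unfolding normE using Wb[of 7] sq43[of 7] by (intro mult_mono) (auto intro: order.trans[of _ "(7 - Re \<rho>)\<^sup>2"])
      moreover have "norm (F (Complex 7 v)) \<le> K * (T/2) powr (-4)"
      proof -
        have "norm (F (Complex 7 v)) \<le> K * real X powr (-4)" unfolding F_def using X by (intro K) auto
        also have "\<dots> \<le> K * (T/2) powr (-4)" using K X T2 by (intro mult_left_mono powr_mono2') auto
        finally show ?thesis .
      qed
      ultimately have "norm (F (Complex 7 v)) * norm (E (Complex 7 v)) \<le> B2"
        unfolding B2_def mult.assoc[of "K * (T/2) powr (-4)"] using K(1) T2 by (intro mult_mono) auto
      moreover have "1 \<le> norm (Complex 7 v - \<rho>)"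
        using abs_Re_le_cmod[of "Complex 7 v - \<rho>"] \<rho> by auto
      moreover have "norm (F (Complex 7 v)) * norm (E (Complex 7 v)) / norm (Complex 7 v - \<rho>) \<le> norm (F (Complex 7 v)) * norm (E (Complex 7 v)) / 1"
        using \<open>1 \<le> norm (Complex 7 v - \<rho>)\<close> by (intro divide_left_mono) auto
      ultimately show ?thesis unfolding g_def norm_divide norm_mult by simp
    qed
    define J where "J = integral {Im \<rho> - H..Im \<rho> + H} (\<lambda>v. g (Complex (1/2) v))"
    have "norm (- (2 * pi * \<i>) + \<i> * J) \<le> 2 * B1 * (7 - 1/2) + B2 * (Im \<rho> + H - (Im \<rho> - H))"
      unfolding J_def using H1 hor right
      by (intro rectpath_integral_bound[OF _ _ I[unfolded R_def] contg[unfolded R_def]]) auto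
    also have "\<dots> = 13 * B1 + B2 * (2 * H)" by simp
    also have "\<dots> \<le> 13 * B1 + B2 * (2 * sqrt T)"
      using H K(1) by (intro add_left_mono mult_left_mono) (auto simp: B2_def)
    also have "\<dots> \<le> 1" using small by (simp add: B1_def B2_def)
    finally have n1: "norm (- (2 * pi * \<i>) + \<i> * J) \<le> 1" .
    have "2 * pi = norm (2 * pi * \<i>)" by (simp add: norm_mult)
    also have "\<dots> \<le> norm (\<i> * J) + norm (- (2 * pi * \<i>) + \<i> * J)"
      using norm_triangle_ineq4[of "\<i> * J" "- (2 * pi * \<i>) + \<i> * J"] by simp
    finally have J5: "5 \<le> norm J" using n1 pi_gt3 by (simp add: norm_mult)
    \<comment> \<open>On the left side the Gaussian factor is at most \<open>exp (9/4) < 27\<close>, and \<open>|s - \<rho>| \<ge> \<eta>\<close>.\<close>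
    have "norm J \<le> integral {Im \<rho> - H..Im \<rho> + H} (\<lambda>v. 27 * T powr (- \<eta> / 2) / \<eta> * norm (F (Complex (1/2) v)))"
      unfolding J_def
    proof (rule integral_norm_bound_integral)
      have cline: "continuous_on {Im \<rho> - H..Im \<rho> + H} (\<lambda>v. Complex (1/2) v)"
        by (auto simp: complex_eq intro!: continuous_intros)
      have sub: "(\<lambda>v. Complex (1/2) v) ` {Im \<rho> - H..Im \<rho> + H} \<subseteq> path_image R"
        unfolding R_def using H1 by (subst path_image_rectpath) auto
      show "(\<lambda>v. g (Complex (1/2) v)) integrable_on {Im \<rho> - H..Im \<rho> + H}"
        by (intro integrable_continuous_real continuous_on_compose2[OF contg cline sub])
      show "(\<lambda>v. 27 * T powr (- \<eta> / 2) / \<eta> * norm (F (Complex (1/2) v))) integrable_on {Im \<rho> - H..Im \<rho> + H}"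
        unfolding F_def by (intro integrable_continuous_real continuous_intros continuous_on_mollified_error_half_line)
      fix v assume v: "v \<in> {Im \<rho> - H..Im \<rho> + H}"
      have "norm (E (Complex (1/2) v)) \<le> T powr (- \<eta> / 2) * 27"
      proof -
        have "W powr (1/2 - Re \<rho>) \<le> W powr (- \<eta>)" using W \<rho> by (intro powr_mono) auto
        also have "\<dots> = T powr (- \<eta> / 2)" using T2 by (simp add: W powr_powr)
        finally have "W powr (1/2 - Re \<rho>) \<le> T powr (- \<eta> / 2)" .
        moreover have "exp ((1/2 - Re \<rho>)\<^sup>2 - (v - Im \<rho>)\<^sup>2) \<le> 27"
        proof -
          have "\<bar>1/2 - Re \<rho>\<bar> \<le> 3/2" using \<rho> \<eta> unfolding abs_le_iff by argo
          then have "\<bar>1/2 - Re \<rho>\<bar>\<^sup>2 \<le> (3/2)\<^sup>2" by (intro power_mono) auto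
          moreover have "(3/2::real)\<^sup>2 \<le> 3" by (simp add: power2_eq_square)
          ultimately have "(1/2 - Re \<rho>)\<^sup>2 - (v - Im \<rho>)\<^sup>2 \<le> 3"
            using zero_le_power2[of "v - Im \<rho>"] unfolding power2_abs by linarith
          then have "exp ((1/2 - Re \<rho>)\<^sup>2 - (v - Im \<rho>)\<^sup>2) \<le> exp (3 :: real)" by simp
          also have "\<dots> = exp 1 ^ 3" by (simp flip: exp_of_nat_mult)
          also have "\<dots> \<le> 3 ^ 3" using exp_le by (intro power_mono) auto
          finally show ?thesis by simp
        qed
        ultimately show ?thesis unfolding normE by (intro mult_mono) auto
      qed
      moreover have "\<eta> \<le> norm (Complex (1/2) v - \<rho>)"
        using abs_Re_le_cmod[of "Complex (1/2) v - \<rho>"] \<rho> by auto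
      ultimately have "norm (F (Complex (1/2) v)) * norm (E (Complex (1/2) v)) / norm (Complex (1/2) v - \<rho>)
          \<le> norm (F (Complex (1/2) v)) * (T powr (- \<eta> / 2) * 27) / \<eta>"
        using \<eta> by (intro frac_le mult_left_mono) auto
      then show "norm (g (Complex (1/2) v)) \<le> 27 * T powr (- \<eta> / 2) / \<eta> * norm (F (Complex (1/2) v))"
        unfolding g_def norm_divide norm_mult by (simp add: mult_ac)
    qed
    also have "\<dots> = 27 * T powr (- \<eta> / 2) / \<eta> * ?I"
      by (rule integral_mult_right)
    finally have "5 \<le> 27 * T powr (- \<eta> / 2) / \<eta> * ?I"
      using J5 by linarith
    then have "\<eta> * T powr (\<eta> / 2) * 5 \<le> \<eta> * T powr (\<eta> / 2) * (27 * T powr (- \<eta> / 2) / \<eta> * ?I)"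
      using \<eta> by (intro mult_left_mono) auto
    also have "\<dots> = 27 * (T powr (\<eta> / 2) * T powr (- \<eta> / 2)) * ?I"
      using \<eta> by simp
    also have "T powr (\<eta> / 2) * T powr (- \<eta> / 2) = 1" using T2 by (simp flip: powr_add)
    finally have "\<eta> * T powr (\<eta> / 2) * 5 \<le> 27 * ?I" by simp
    moreover have "0 \<le> \<eta> * T powr (\<eta> / 2)" using \<eta> by simp
    ultimately show ?thesis unfolding F_def X_def by linarith
  qed
  have "\<forall>\<^sub>F T in at_top. 13 * ((C * (7 + 2 * T) * T + 1) * T powr (13/4) * exp (43 - (ln T)\<^sup>2)) \<le> 1/2"
    using C(1) by real_asymp
  moreover have "\<forall>\<^sub>F T in at_top. K * (T/2) powr (-4) * T powr (13/4) * exp 43 * (2 * sqrt T) \<le> 1/2"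
    using K(1) by real_asymp
  ultimately show ?thesis using eventually_ge_at_top[of "exp 1"]
  proof eventually_elim
    case (elim T)
    have "13 * ((C * (7 + 2 * T) * T + 1) * T powr (13/4) * exp (43 - (ln T)\<^sup>2)) + K * (T/2) powr (-4) * T powr (13/4) * exp 43 * (2 * sqrt T) \<le> 1"
      using elim by linarith
    then show ?case using main[OF elim(3)] by blast
  qed
qed

text \<open>
  \<open>|\<zeta>M| \<le> |\<zeta>|\<^sup>2 + |M|\<^sup>2\<close> separates the two factors; each has mean square \<open>O(T\<^sup>1\<^sup>+\<^sup>\<epsilon>)\<close>.
\<close>

lemma mollified_error_mean:
  assumes "0 < \<epsilon>"
  shows "\<exists>C. \<forall>\<^sub>F T in at_top. integral {0..T} (\<lambda>t. norm (mollified_error (nat \<lfloor>T\<rfloor>) (Complex (1/2) t))) \<le> C * T powr (1 + \<epsilon>)"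
proof -
  obtain C where C: "\<forall>\<^sub>F T in at_top. integral {0..T} (\<lambda>t. (norm (riemann_zeta (Complex (1/2) t)))\<^sup>2) \<le> C * T powr (1 + \<epsilon>)"
    using zeta_half_line_mean_square[OF assms] by blast
  have ev: "\<forall>\<^sub>F T in at_top. T + (T + 4 * T * (ln T + 1)) * (ln T + 1) \<le> 1 * T powr (1 + \<epsilon>)"
    using assms by real_asymp
  have "\<forall>\<^sub>F T in at_top. integral {0..T} (\<lambda>t. norm (mollified_error (nat \<lfloor>T\<rfloor>) (Complex (1/2) t))) \<le> (\<bar>C\<bar> + 1) * T powr (1 + \<epsilon>)"
    using C ev eventually_ge_at_top[of 1]
  proof eventually_elim
    case (elim T)
    let ?Z = "\<lambda>t. (norm (riemann_zeta (Complex (1/2) t)))\<^sup>2" and ?M = "\<lambda>X t. (norm (mollifier X (Complex (1/2) t)))\<^sup>2"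
    define X where "X = nat \<lfloor>T\<rfloor>"
    have X: "1 \<le> X" "real X \<le> T" using elim(3) by (auto simp: X_def le_nat_iff le_floor_iff)
    have harm: "0 \<le> (harm X :: real)" "harm X \<le> ln T + 1"
    proof -
      have "ln (real X) \<le> ln T" using X by (intro ln_mono) auto
      then show "harm X \<le> ln T + 1" using harm_le_ln[OF X(1)] by linarith
    qed (rule harm_nonneg)
    have M: "(?M X) integrable_on {0..T}"
      "integral {0..T} (?M X) \<le> (T + 4 * real X * harm X) * harm X"
      unfolding mollifier_def using elim(3) abs_moebius_mu_le
      by (intro dirichlet_poly_half_line_mean_square; simp)+
    have Z: "?Z integrable_on {0..T}"
      by (intro integrable_continuous_real continuous_intros continuous_on_zeta_half_line)
    have "integral {0..T} (\<lambda>t. norm (mollified_error X (Complex (1/2) t)))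
       \<le> integral {0..T} (\<lambda>t. 1 + ((norm (riemann_zeta (Complex (1/2) t)))\<^sup>2 + (norm (mollifier X (Complex (1/2) t)))\<^sup>2))"
    proof (rule integral_le)
      show "(\<lambda>t. norm (mollified_error X (Complex (1/2) t))) integrable_on {0..T}"
        by (intro integrable_continuous_real continuous_intros continuous_on_mollified_error_half_line)
      show "(\<lambda>t. 1 + ((norm (riemann_zeta (Complex (1/2) t)))\<^sup>2 + (norm (mollifier X (Complex (1/2) t)))\<^sup>2)) integrable_on {0..T}"
        by (intro integrable_add M Z integrable_const_ivl)
      fix t
      define x y where "x = norm (riemann_zeta (Complex (1/2) t))" "y = norm (mollifier X (Complex (1/2) t))"
      have "norm (mollified_error X (Complex (1/2) t)) \<le> x * y + 1"
        unfolding mollified_error_def x_y_def norm_mult[symmetric]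
        using norm_triangle_ineq4[of "riemann_zeta (Complex (1/2) t) * mollifier X (Complex (1/2) t)" 1] by simp
      moreover have "0 \<le> x * y" by (simp add: x_y_def)
      then have "x * y \<le> x\<^sup>2 + y\<^sup>2" using sum_squares_bound[of x y] by linarith
      ultimately show "norm (mollified_error X (Complex (1/2) t))
         \<le> 1 + ((norm (riemann_zeta (Complex (1/2) t)))\<^sup>2 + (norm (mollifier X (Complex (1/2) t)))\<^sup>2)"
        by (simp add: x_y_def)
    qed
    also have "\<dots> = T + (integral {0..T} ?Z
        + integral {0..T} (?M X))"
      using elim(3) by (subst integral_add integral_const_real | intro integrable_add M Z integrable_const_ivl)+ simp
    also have "\<dots> \<le> T + (C * T powr (1 + \<epsilon>) + (T + 4 * real X * harm X) * harm X)"
      using elim(1) M by simp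
    also have "(T + 4 * real X * harm X) * harm X \<le> (T + 4 * T * (ln T + 1)) * (ln T + 1)"
      using harm X elim(3) by (intro mult_mono add_mono) auto
    also have "C * T powr (1 + \<epsilon>) \<le> \<bar>C\<bar> * T powr (1 + \<epsilon>)" by (intro mult_right_mono) auto
    finally show ?case using elim(2) by (simp add: X_def algebra_simps)
  qed
  then show ?thesis by blast
qed

lemma sum_integral_consecutive:
  fixes \<phi> :: "real \<Rightarrow> real"
  assumes cont: "continuous_on UNIV \<phi>" and "0 \<le> \<Delta>"
  shows "(\<Sum>j\<in>{1..n}. integral {real j * \<Delta> - \<Delta> / 2..real j * \<Delta> + \<Delta> / 2} \<phi>) = integral {\<Delta> / 2..real n * \<Delta> + \<Delta> / 2} \<phi>"
proof (induction n)
  case (Suc n)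
  have "integral {\<Delta> / 2..real n * \<Delta> + \<Delta> / 2} \<phi> + integral {real n * \<Delta> + \<Delta> / 2..real (Suc n) * \<Delta> + \<Delta> / 2} \<phi>
      = integral {\<Delta> / 2..real (Suc n) * \<Delta> + \<Delta> / 2} \<phi>"
    using assms by (intro Henstock_Kurzweil_Integration.integral_combine integrable_continuous_real continuous_on_subset[OF cont])
                   (auto simp: algebra_simps)
  moreover have "real (Suc n) * \<Delta> - \<Delta> / 2 = real n * \<Delta> + \<Delta> / 2" by (simp add: algebra_simps)
  moreover have "(\<Sum>j\<in>{1..Suc n}. integral {real j * \<Delta> - \<Delta> / 2..real j * \<Delta> + \<Delta> / 2} \<phi>)
     = integral {\<Delta> / 2..real n * \<Delta> + \<Delta> / 2} \<phi> + integral {real (Suc n) * \<Delta> - \<Delta> / 2..real (Suc n) * \<Delta> + \<Delta> / 2} \<phi>"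
    using Suc by simp
  ultimately show ?case by (simp only:)
qed simp

definition zero_near :: "real \<Rightarrow> real \<Rightarrow> real \<Rightarrow> bool" where
  "zero_near \<alpha> t r \<longleftrightarrow> (\<exists>\<rho>. riemann_zeta \<rho> = 0 \<and> \<alpha> \<le> Re \<rho> \<and> Re \<rho> \<le> 2 \<and> \<bar>Im \<rho> - t\<bar> \<le> r)"

text \<open>
  The step \<open>4H + 2\<close> leaves room for the windows of half-width \<open>H\<close> around zeros near different
  multiples of it to be disjoint. Each such window carries \<open>T\<^sup>\<eta>\<^sup>/\<^sup>2\<close> of a total of \<open>T\<^sup>1\<^sup>+\<^sup>\<eta>\<^sup>/\<^sup>4\<close>.
\<close>

lemma zero_density:
  assumes \<eta>: "0 < \<eta>"
  shows "\<exists>C. \<forall>\<^sub>F T in at_top. \<forall>H J. ln T \<le> H \<longrightarrow> H \<le> sqrt T \<longrightarrow> real J * (4 * H + 2) \<le> T \<longrightarrow>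
     real (card {j\<in>{1..<J}. zero_near (1/2 + \<eta>) (real j * (4 * H + 2)) (H + 1)}) \<le> C * T powr (1 - \<eta> / 4)"
proof -
  obtain C where C: "\<forall>\<^sub>F T in at_top. integral {0..T} (\<lambda>t. norm (mollified_error (nat \<lfloor>T\<rfloor>) (Complex (1/2) t))) \<le> C * T powr (1 + \<eta> / 4)"
    using mollified_error_mean[of "\<eta> / 4"] \<eta> by auto
  have "\<forall>\<^sub>F T in at_top. \<forall>H J. ln T \<le> H \<longrightarrow> H \<le> sqrt T \<longrightarrow> real J * (4 * H + 2) \<le> T \<longrightarrow>
     real (card {j\<in>{1..<J}. zero_near (1/2 + \<eta>) (real j * (4 * H + 2)) (H + 1)}) \<le> 6 * C / \<eta> * T powr (1 - \<eta> / 4)"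
    using C zero_detection[OF \<eta>] eventually_ge_at_top[of 1]
  proof eventually_elim
    case (elim T)
    show ?case
    proof (intro allI impI)
      fix H J assume H: "ln T \<le> H" "H \<le> sqrt T" and J: "real J * (4 * H + 2) \<le> T"
      define \<Delta> where "\<Delta> = 4 * H + 2"
      have H0: "0 \<le> H" using H(1) elim(3) by (auto intro: order.trans[OF ln_ge_zero])
      then have \<Delta>: "0 < \<Delta>" by (simp add: \<Delta>_def)
      define \<phi> where "\<phi> = (\<lambda>t. norm (mollified_error (nat \<lfloor>T\<rfloor>) (Complex (1/2) t)))"
      have cont: "continuous_on A \<phi>" for A
        unfolding \<phi>_def by (intro continuous_intros continuous_on_mollified_error_half_line)
      have int: "\<phi> integrable_on {a..b}" for a b by (intro integrable_continuous_real cont)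
      define B where "B = {j\<in>{1..<J}. zero_near (1/2 + \<eta>) (real j * \<Delta>) (H + 1)}"
      have "\<eta> * T powr (\<eta> / 2) / 6 \<le> integral {real j * \<Delta> - \<Delta> / 2..real j * \<Delta> + \<Delta> / 2} \<phi>" if jB: "j \<in> B" for j
      proof -
        have j: "1 \<le> j" "j + 1 \<le> J" using jB by (auto simp: B_def)
        obtain \<rho> where \<rho>: "riemann_zeta \<rho> = 0" "1/2 + \<eta> \<le> Re \<rho>" "Re \<rho> \<le> 2" "\<bar>Im \<rho> - real j * \<Delta>\<bar> \<le> H + 1"
          using jB unfolding B_def zero_near_def by blast
        have "1 * \<Delta> \<le> real j * \<Delta>" using j \<Delta> by (intro mult_right_mono) auto
        then have low: "H + 1 \<le> Im \<rho>" using \<rho>(4) H0 \<Delta>_def by linarith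
        have "real (j + 1) * \<Delta> \<le> real J * \<Delta>" using j \<Delta> by (intro mult_right_mono) auto
        then have "real j * \<Delta> + \<Delta> \<le> T" using J by (simp add: \<Delta>_def algebra_simps)
        then have up: "Im \<rho> \<le> T" using \<rho>(4) H0 \<Delta>_def by linarith
        have "\<eta> * T powr (\<eta> / 2) / 6 \<le> integral {Im \<rho> - H..Im \<rho> + H} \<phi>"
          unfolding \<phi>_def using elim(2) H \<rho> low up by blast
        also have "\<dots> \<le> integral {real j * \<Delta> - \<Delta> / 2..real j * \<Delta> + \<Delta> / 2} \<phi>"
        proof (rule integral_subset_le[OF _ int int])
          have "real j * \<Delta> - \<Delta> / 2 \<le> Im \<rho> - H" "Im \<rho> + H \<le> real j * \<Delta> + \<Delta> / 2"
            using \<rho>(4) \<Delta>_def by linarith+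
          then show "{Im \<rho> - H..Im \<rho> + H} \<subseteq> {real j * \<Delta> - \<Delta> / 2..real j * \<Delta> + \<Delta> / 2}" by simp
        qed (simp add: \<phi>_def)
        finally show ?thesis .
      qed
      then have "real (card B) * (\<eta> * T powr (\<eta> / 2) / 6) \<le> (\<Sum>j\<in>B. integral {real j * \<Delta> - \<Delta> / 2..real j * \<Delta> + \<Delta> / 2} \<phi>)"
        using sum_mono[of B "\<lambda>_. \<eta> * T powr (\<eta> / 2) / 6"] by simp
      also have "\<dots> \<le> (\<Sum>j\<in>{1..J - 1}. integral {real j * \<Delta> - \<Delta> / 2..real j * \<Delta> + \<Delta> / 2} \<phi>)"
        by (intro sum_mono2) (auto simp: B_def \<phi>_def intro!: integral_nonneg int[unfolded \<phi>_def])
      also have "\<dots> = integral {\<Delta> / 2..real (J - 1) * \<Delta> + \<Delta> / 2} \<phi>"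
        using \<Delta> by (intro sum_integral_consecutive cont) auto
      also have "\<dots> \<le> integral {0..T} \<phi>"
      proof (cases "J = 0")
        case True
        then show ?thesis using elim(3) by (auto simp: \<phi>_def intro!: integral_nonneg int[unfolded \<phi>_def])
      next
        case False
        then have "real (J - 1) * \<Delta> + \<Delta> / 2 \<le> real J * \<Delta>" using \<Delta> by (simp add: of_nat_diff algebra_simps)
        then have "real (J - 1) * \<Delta> + \<Delta> / 2 \<le> T" using J by (simp add: \<Delta>_def)
        then show ?thesis using \<Delta> by (intro integral_subset_le int) (auto simp: \<phi>_def)
      qed
      also have "\<dots> \<le> C * T powr (1 + \<eta> / 4)" using elim(1) by (simp add: \<phi>_def)
      finally have "real (card B) * (\<eta> * T powr (\<eta> / 2) / 6) * (6 / \<eta> * T powr (- \<eta> / 2))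
         \<le> C * T powr (1 + \<eta> / 4) * (6 / \<eta> * T powr (- \<eta> / 2))"
        using \<eta> by (intro mult_right_mono) auto
      also have "real (card B) * (\<eta> * T powr (\<eta> / 2) / 6) * (6 / \<eta> * T powr (- \<eta> / 2))
         = real (card B) * (T powr (\<eta> / 2) * T powr (- \<eta> / 2))" using \<eta> by simp
      also have "T powr (\<eta> / 2) * T powr (- \<eta> / 2) = 1" using elim(3) by (simp flip: powr_add)
      also have "C * T powr (1 + \<eta> / 4) * (6 / \<eta> * T powr (- \<eta> / 2)) = 6 * C / \<eta> * (T powr (1 + \<eta> / 4) * T powr (- \<eta> / 2))"
        by simp
      also have "T powr (1 + \<eta> / 4) * T powr (- \<eta> / 2) = T powr (1 - \<eta> / 4)"
        by (simp flip: powr_add)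
      finally show "real (card {j\<in>{1..<J}. zero_near (1/2 + \<eta>) (real j * (4 * H + 2)) (H + 1)}) \<le> 6 * C / \<eta> * T powr (1 - \<eta> / 4)"
        by (simp add: B_def \<Delta>_def)
    qed
  qed
  then show ?thesis by blast
qed

section \<open>The logarithm of zeta on zero-free boxes\<close>

lemma norm_log_zeta_le:
  obtains K where "0 < K" "\<And>s. 2 \<le> Re s \<Longrightarrow> norm (log_zeta s) \<le> K"
proof -
  define K where "K = 4 * (\<Sum>n. 1 / real (Suc n) ^ 2)"
  have "summable (\<lambda>n. 1 / real (Suc n) ^ 2)" using inverse_power_summable[of 2, where 'a = real]
    by (subst summable_Suc_iff) (simp add: divide_inverse)
  then have K: "0 < K" unfolding K_def by (intro mult_pos_pos suminf_pos) auto
  have "norm (log_zeta s) \<le> K" if s: "2 \<le> Re s" for s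
  proof -
    have "norm (log_zeta s - of_real (log_zeta_coeff (Suc 0))) \<le> 4 * 2 powr (- Re s) * (\<Sum>n. 1 / real (Suc n) ^ 2)"
      using s log_zeta_coeff_bounds
      by (intro norm_series_tail_bound[where b = "\<lambda>n. of_real (log_zeta_coeff (Suc n))"] log_zeta_sums) auto
    also have "\<dots> = 2 powr (- Re s) * K" by (simp add: K_def)
    also have "\<dots> \<le> 1 * K" using K s powr_mono[of "- Re s" 0 2] by (intro mult_right_mono) auto
    finally show ?thesis by (simp add: log_zeta_coeff_def)
  qed
  then show ?thesis using that K by blast
qed

definition log_zeta_branch :: "real \<Rightarrow> real \<Rightarrow> real \<Rightarrow> (complex \<Rightarrow> complex) \<Rightarrow> bool" where
  "log_zeta_branch \<alpha> t r g \<longleftrightarrow> g holomorphic_on {s. \<alpha> < Re s \<and> \<bar>Im s - t\<bar> < r} \<and>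
     (\<forall>s. \<alpha> < Re s \<longrightarrow> \<bar>Im s - t\<bar> < r \<longrightarrow> exp (g s) = riemann_zeta s) \<and>
     (\<forall>s. 1 < Re s \<longrightarrow> \<bar>Im s - t\<bar> < r \<longrightarrow> g s = log_zeta s)"

text \<open>
  A logarithm exists on the convex zero-free box. To the right of \<open>1\<close> it differs from the Dirichlet
  series by a constant, which is normalised to \<open>0\<close> at \<open>2 + it\<close>.
\<close>

lemma log_zeta_branch_exists:
  assumes nz: "\<not> zero_near \<alpha> t r" and \<alpha>: "0 < \<alpha>" "\<alpha> < 1" and t: "0 < r" "1 \<le> t - r"
  obtains g where "log_zeta_branch \<alpha> t r g"
proof -
  define D where "D = {s. \<alpha> < Re s} \<inter> ({s. t - r < Im s} \<inter> {s. Im s < t + r})"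
  have D_iff: "s \<in> D \<longleftrightarrow> \<alpha> < Re s \<and> \<bar>Im s - t\<bar> < r" for s by (auto simp: D_def)
  have D_eq: "D = {s. \<alpha> < Re s \<and> \<bar>Im s - t\<bar> < r}" using D_iff by blast
  have D: "convex D" "open D" unfolding D_def
    by (intro convex_Int convex_halfspace_Re_gt convex_halfspace_Im_gt convex_halfspace_Im_lt
          open_Int open_halfspace_Re_gt open_halfspace_Im_gt open_halfspace_Im_lt)+
  have hol: "riemann_zeta holomorphic_on D"
    using t by (intro holomorphic_on_subset[OF riemann_zeta_holomorphic]) (auto simp: D_iff)
  have ne: "riemann_zeta s \<noteq> 0" if s: "s \<in> D" for s
  proof (cases "1 < Re s")
    case True
    then show ?thesis using exp_log_zeta[OF True] by (metis exp_not_eq_zero)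
  next
    case False
    then show ?thesis using nz s by (force simp: zero_near_def D_iff)
  qed
  define z0 where "z0 = Complex 2 t"
  have z0: "z0 \<in> D" "1 < Re z0" using \<alpha> t by (auto simp: z0_def D_iff)
  obtain g where g: "g holomorphic_on D" "\<And>s. s \<in> D \<Longrightarrow> exp (g s) = riemann_zeta s"
    using holomorphic_logarithm_exists[OF D hol ne z0(1)] by blast
  define G where "G s = g s + (log_zeta z0 - g z0)" for s
  have expG: "exp (G s) = riemann_zeta s" if s: "s \<in> D" for s
  proof -
    have "exp (log_zeta z0 - g z0) = 1"
      using exp_log_zeta[OF z0(2)] g(2)[OF z0(1)] ne[OF z0(1)] by (simp add: exp_diff)
    then show ?thesis using g(2)[OF s] by (simp add: G_def exp_add)
  qed
  have holG: "G holomorphic_on D" unfolding G_def by (intro holomorphic_intros g)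
  define D1 where "D1 = D \<inter> {s. 1 < Re s}"
  have D1: "convex D1" unfolding D1_def by (intro convex_Int D convex_halfspace_Re_gt)
  have "\<exists>c. \<forall>s\<in>D1. G s - log_zeta s = c"
  proof (rule has_field_derivative_zero_constant[OF D1])
    fix s assume "s \<in> D1"
    then have s: "s \<in> D" "1 < Re s" by (auto simp: D1_def)
    obtain l where l: "(log_zeta has_field_derivative l) (at s)" "(riemann_zeta has_field_derivative riemann_zeta s * l) (at s)"
      using log_zeta_derivs[OF s(2)] by blast
    have G': "(G has_field_derivative deriv G s) (at s)" by (rule holomorphic_derivI[OF holG D(2) s(1)])
    have "((\<lambda>s. exp (G s)) has_field_derivative exp (G s) * deriv G s) (at s)"
      by (rule DERIV_chain2[OF DERIV_exp G'])
    then have "(riemann_zeta has_field_derivative exp (G s) * deriv G s) (at s)"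
      by (rule has_field_derivative_transform_within_open[OF _ D(2) s(1)]) (use expG in auto)
    from DERIV_unique[OF this l(2)] have "deriv G s = l" using expG[OF s(1)] ne[OF s(1)] by simp
    then have "((\<lambda>s. G s - log_zeta s) has_field_derivative 0) (at s)"
      using DERIV_diff[OF G' l(1)] by simp
    then show "((\<lambda>s. G s - log_zeta s) has_field_derivative 0) (at s within D1)"
      by (rule has_field_derivative_at_within)
  qed
  then obtain c where c: "\<And>s. s \<in> D1 \<Longrightarrow> G s - log_zeta s = c" by blast
  have "c = 0" using c[of z0] z0 by (simp add: D1_def G_def)
  then have "G s = log_zeta s" if "1 < Re s" "\<bar>Im s - t\<bar> < r" for s
    using c[of s] that \<alpha> by (auto simp: D1_def D_iff)
  then show ?thesis using that[of G] holG expG D_iff unfolding log_zeta_branch_def D_eq by blast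
qed

text \<open>
  Borel-Caratheodory on discs centred on \<open>Re s = 4\<close>: polynomial growth of zeta bounds the real part
  of the logarithm by \<open>2 log T\<close>, and the Dirichlet series bounds its value at the centre. The discs have
  radius below \<open>4\<close>, whence the loss of \<open>4\<close> in the height of the box.
\<close>

lemma log_zeta_branch_bound:
  assumes \<sigma>: "1/2 \<le> \<alpha>" "\<alpha> < \<sigma>" "\<sigma> < 1"
  shows "\<exists>G. \<forall>\<^sub>F T in at_top. \<forall>t r g. log_zeta_branch \<alpha> t r g \<longrightarrow> 1 \<le> t - r \<longrightarrow> t + r \<le> T \<longrightarrow>
     (\<forall>s. \<sigma> \<le> Re s \<longrightarrow> Re s \<le> 4 \<longrightarrow> \<bar>Im s - t\<bar> \<le> r - 4 \<longrightarrow> norm (g s) \<le> G * ln T)"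
proof -
  obtain C where C: "0 < C" "\<And>s. 1/2 \<le> Re s \<Longrightarrow> 1 \<le> norm (s - 1) \<Longrightarrow> norm (riemann_zeta s) \<le> C * norm s"
    by (rule zeta_growth) blast
  obtain K where K: "0 < K" "\<And>s. 2 \<le> Re s \<Longrightarrow> norm (log_zeta s) \<le> K" by (rule norm_log_zeta_le) blast
  define Q where "Q = 2 * (4 - \<sigma>) / (\<sigma> - \<alpha>)"
  have Q: "0 \<le> Q" using \<sigma> by (simp add: Q_def)
  have main: "norm (g s) \<le> K + Q * (2 * ln T + K + 1)"
    if big: "C * (8 + T) \<le> T\<^sup>2" "1 \<le> T"
      and branch: "log_zeta_branch \<alpha> t r g"
      and t: "1 \<le> t - r" "t + r \<le> T" and s: "\<sigma> \<le> Re s" "Re s \<le> 4" "\<bar>Im s - t\<bar> \<le> r - 4" for T t r g s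
  proof -
    note g = branch[unfolded log_zeta_branch_def]
    define c where "c = Complex 4 (Im s)"
    have ball: "\<alpha> < Re z \<and> Re z < 8 \<and> \<bar>Im z - t\<bar> < r" if z: "z \<in> ball c (4 - \<alpha>)" for z
    proof -
      have "norm (z - c) < 4 - \<alpha>" using z by (simp add: dist_norm norm_minus_commute)
      then have "\<bar>Re z - 4\<bar> < 4 - \<alpha>" "\<bar>Im z - Im s\<bar> < 4 - \<alpha>"
        using abs_Re_le_cmod[of "z - c"] abs_Im_le_cmod[of "z - c"] by (auto simp: c_def)
      then show ?thesis using s(3) \<sigma> by linarith
    qed
    have "norm (g s) \<le> norm (g c) + 2 * (4 - \<sigma>) / ((4 - \<alpha>) - (4 - \<sigma>)) * (2 * ln T + norm (g c) + 1)"
    proof (rule Borel_Caratheodory_bound[where f = g and z = s and c = c and A = "2 * ln T" and r = "4 - \<sigma>" and R = "4 - \<alpha>"])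
      show "g holomorphic_on ball c (4 - \<alpha>)" by (rule holomorphic_on_subset[OF conjunct1[OF g]]) (use ball in auto)
      show "0 \<le> 4 - \<sigma>" "4 - \<sigma> < 4 - \<alpha>" using \<sigma> by auto
      show "0 \<le> 2 * ln T" using big by simp
      show "norm (s - c) \<le> 4 - \<sigma>" using s by (simp add: c_def cmod_def)
      fix z assume "z \<in> ball c (4 - \<alpha>)"
      then have z: "\<alpha> < Re z" "Re z < 8" "\<bar>Im z - t\<bar> < r" using ball by auto
      have ez: "exp (g z) = riemann_zeta z" using g z by blast
      have "1 \<le> norm (z - 1)" using abs_Im_le_cmod[of "z - 1"] z(3) t(1) by auto
      then have "norm (riemann_zeta z) \<le> C * norm z" using z \<sigma> by (intro C) auto
      also have "norm z \<le> 8 + T" using cmod_le[of z] z t \<sigma> by linarith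
      finally have "norm (riemann_zeta z) \<le> C * (8 + T)" using C(1) by simp
      then have "exp (Re (g z)) \<le> T\<^sup>2" using big unfolding ez[symmetric] by simp
      then have "Re (g z) \<le> ln (T\<^sup>2)" using big by (subst ln_ge_iff) auto
      then show "Re (g z) \<le> 2 * ln T" using big by (simp add: ln_realpow)
    qed
    also have "(4 - \<alpha>) - (4 - \<sigma>) = \<sigma> - \<alpha>" by simp
    also have "norm (g c) + 2 * (4 - \<sigma>) / (\<sigma> - \<alpha>) * (2 * ln T + norm (g c) + 1) \<le> K + Q * (2 * ln T + K + 1)"
    proof -
      have "g c = log_zeta c" using g s(3) by (simp add: c_def)
      then have "norm (g c) \<le> K" using K(2)[of c] by (simp add: c_def)
      then show ?thesis unfolding Q_def[symmetric] using Q by (intro add_mono mult_left_mono) auto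
    qed
    finally show ?thesis .
  qed
  have ev: "\<forall>\<^sub>F T in at_top. C * (8 + T) \<le> T\<^sup>2"
    "\<forall>\<^sub>F T in at_top. K + Q * (2 * ln T + K + 1) \<le> (2 * Q + 1) * ln T"
    using C(1) by real_asymp+
  show ?thesis
  proof (rule exI[of _ "2 * Q + 1"], use ev eventually_ge_at_top[of 1] in eventually_elim, intro allI impI)
    fix T t r g s
    assume "C * (8 + T) \<le> T\<^sup>2" "K + Q * (2 * ln T + K + 1) \<le> (2 * Q + 1) * ln T" "1 \<le> T"
      and "log_zeta_branch \<alpha> t r g" "1 \<le> t - r" "t + r \<le> T" "\<sigma> \<le> Re s" "Re s \<le> 4" "\<bar>Im s - t\<bar> \<le> r - 4"
    then show "norm (g s) \<le> (2 * Q + 1) * ln T" using main[of T t r g s] by linarith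
  qed
qed

section \<open>Averaging the logarithm of zeta\<close>

definition sinc_complex :: "real \<Rightarrow> complex \<Rightarrow> complex" where
  "sinc_complex h z = (if z = 0 then of_real h else sin (of_real h * z) / z)"

definition shifted_fejer_complex :: "real \<Rightarrow> real \<Rightarrow> complex \<Rightarrow> complex" where
  "shifted_fejer_complex h l z = (1 - cos (of_real l * z)) * (sinc_complex h z)\<^sup>2"

lemma sinc_complex_holomorphic: "sinc_complex h holomorphic_on UNIV"
proof -
  have "deriv (\<lambda>z. sin (complex_of_real h * z)) 0 = of_real h"
    by (rule DERIV_imp_deriv) (auto intro!: derivative_eq_intros)
  then have eq: "sinc_complex h = (\<lambda>z. if z = 0 then deriv (\<lambda>z. sin (of_real h * z)) 0 else (sin (of_real h * z) - sin (of_real h * 0)) / (z - 0))"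
    by (auto simp: sinc_complex_def fun_eq_iff)
  show ?thesis unfolding eq by (rule pole_lemma) (auto intro!: holomorphic_intros)
qed

lemma shifted_fejer_complex_holomorphic:
  assumes "f holomorphic_on A"
  shows "(\<lambda>s. shifted_fejer_complex h l (f s)) holomorphic_on A"
proof -
  have "(\<lambda>s. sinc_complex h (f s)) holomorphic_on A"
    using holomorphic_on_compose_gen[OF assms sinc_complex_holomorphic] by (simp add: o_def)
  then show ?thesis unfolding shifted_fejer_complex_def by (intro holomorphic_intros assms)
qed

lemma shifted_fejer_complex_of_real: "shifted_fejer_complex h l (of_real u) = of_real (shifted_fejer h l u)"
proof -
  have "cos (of_real l * of_real u) = complex_of_real (cos (l * u))" "sin (of_real h * of_real u) = complex_of_real (sin (h * u))"
    by (simp_all add: cos_of_real sin_of_real flip: of_real_mult)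
  then show ?thesis
    by (cases "u = 0"; cases "h = 0") (simp_all add: shifted_fejer_complex_def sinc_complex_def shifted_fejer_def)
qed

lemma norm_sin_cos_complex_le:
  "norm (sin z) \<le> exp \<bar>Im z\<bar>" "norm (cos z) \<le> exp \<bar>Im z\<bar>" for z :: complex
proof -
  have e: "norm (exp (\<i> * z)) \<le> exp \<bar>Im z\<bar>" "norm (exp (- (\<i> * z))) \<le> exp \<bar>Im z\<bar>" by auto
  have "norm (sin z) \<le> (norm (exp (\<i> * z)) + norm (exp (- (\<i> * z)))) / 2"
    unfolding sin_exp_eq' using norm_triangle_ineq4[of "exp (- (\<i> * z))" "exp (\<i> * z)"] by (simp add: norm_mult)
  also have "\<dots> \<le> (exp \<bar>Im z\<bar> + exp \<bar>Im z\<bar>) / 2" by (intro divide_right_mono add_mono e) auto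
  finally show "norm (sin z) \<le> exp \<bar>Im z\<bar>" by simp
  have "norm (cos z) \<le> (norm (exp (\<i> * z)) + norm (exp (- (\<i> * z)))) / 2"
    unfolding cos_exp_eq using norm_triangle_ineq[of "exp (\<i> * z)" "exp (- (\<i> * z))"] by (simp add: norm_divide)
  also have "\<dots> \<le> (exp \<bar>Im z\<bar> + exp \<bar>Im z\<bar>) / 2" by (intro divide_right_mono add_mono e) auto
  finally show "norm (cos z) \<le> exp \<bar>Im z\<bar>" by simp
qed

lemma norm_shifted_fejer_complex_le:
  assumes "0 \<le> h" "0 \<le> l" "z \<noteq> 0"
  shows "norm (shifted_fejer_complex h l z) \<le> 2 * exp ((l + 2 * h) * \<bar>Im z\<bar>) / (norm z)\<^sup>2"
proof -
  have "norm (1 - cos (of_real l * z)) \<le> 1 + exp (l * \<bar>Im z\<bar>)"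
    using norm_triangle_ineq4[of 1 "cos (of_real l * z)"] norm_sin_cos_complex_le(2)[of "of_real l * z"] assms
    by (simp add: abs_mult)
  also have "\<dots> \<le> 2 * exp (l * \<bar>Im z\<bar>)" using assms by simp
  finally have 1: "norm (1 - cos (of_real l * z)) \<le> 2 * exp (l * \<bar>Im z\<bar>)" .
  have "norm (sin (of_real h * z)) \<le> exp (h * \<bar>Im z\<bar>)"
    using norm_sin_cos_complex_le(1)[of "of_real h * z"] assms by (simp add: abs_mult)
  then have "norm (sinc_complex h z) \<le> exp (h * \<bar>Im z\<bar>) / norm z"
    using assms by (simp add: sinc_complex_def norm_divide divide_right_mono)
  then have 2: "(norm (sinc_complex h z))\<^sup>2 \<le> (exp (h * \<bar>Im z\<bar>) / norm z)\<^sup>2" by (intro power_mono) auto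
  have "norm (shifted_fejer_complex h l z) \<le> 2 * exp (l * \<bar>Im z\<bar>) * (exp (h * \<bar>Im z\<bar>) / norm z)\<^sup>2"
    unfolding shifted_fejer_complex_def norm_mult norm_power by (intro mult_mono 1 2) auto
  also have "\<dots> = 2 * (exp (l * \<bar>Im z\<bar>) * (exp (h * \<bar>Im z\<bar>))\<^sup>2) / (norm z)\<^sup>2"
    by (simp add: power_divide)
  also have "exp (l * \<bar>Im z\<bar>) * (exp (h * \<bar>Im z\<bar>))\<^sup>2 = exp ((l + 2 * h) * \<bar>Im z\<bar>)"
    by (simp add: algebra_simps power2_eq_square flip: exp_add)
  finally show ?thesis .
qed

lemma fejer_hat_bounds:
  assumes "0 \<le> h"
  shows "0 \<le> fejer_hat h \<xi>" "fejer_hat h \<xi> \<le> pi * h" "2 * h \<le> \<bar>\<xi>\<bar> \<Longrightarrow> fejer_hat h \<xi> = 0"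
    "\<bar>\<xi>\<bar> \<le> h \<Longrightarrow> pi * h / 2 \<le> fejer_hat h \<xi>"
proof -
  have "max 0 (2 * h - \<bar>\<xi>\<bar>) \<le> 2 * h" using assms by simp
  then have "pi / 2 * max 0 (2 * h - \<bar>\<xi>\<bar>) \<le> pi / 2 * (2 * h)" by (intro mult_left_mono) auto
  then show "fejer_hat h \<xi> \<le> pi * h" by (simp add: fejer_hat_def)
  assume "\<bar>\<xi>\<bar> \<le> h"
  then have "pi / 2 * h \<le> pi / 2 * max 0 (2 * h - \<bar>\<xi>\<bar>)" by (intro mult_left_mono) auto
  then show "pi * h / 2 \<le> fejer_hat h \<xi>" by (simp add: fejer_hat_def)
qed (auto simp: fejer_hat_def)

lemma of_nat_powr_vertical:
  assumes "n \<ge> 1"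
  shows "Re (of_nat n powr (- Complex \<sigma> v)) = real n powr (- \<sigma>) * cos (v * ln (real n))"
proof -
  have "of_nat n powr (- Complex \<sigma> v) = exp (- Complex \<sigma> v * of_real (ln (real n)))"
    using assms by (simp add: powr_def Ln_of_nat)
  then show ?thesis using assms by (simp add: Re_exp powr_def)
qed

text \<open>
  The \<open>n\<close>-th term is at most \<open>n\<^sup>-\<^sup>4\<close>, and \<open>(n + Z)\<^sup>4 \<ge> Z\<^sup>2 n\<^sup>2\<close>.
\<close>

lemma log_zeta_partial_sum_error:
  assumes "Re s = 4" "1 \<le> Z"
  shows "norm (log_zeta s - (\<Sum>n=1..Z. of_real (log_zeta_coeff n) * of_nat n powr (-s))) \<le> 2 / (real Z)\<^sup>2"
proof -
  define f where "f n = of_real (log_zeta_coeff (Suc n)) * of_nat (Suc n) powr (-s)" for n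
  have "(\<lambda>n. f (n + Z)) sums (log_zeta s - (\<Sum>n<Z. f n))"
    unfolding f_def using assms by (intro sums_split_initial_segment log_zeta_sums) auto
  moreover have "(\<Sum>n<Z. f n) = (\<Sum>n=1..Z. of_real (log_zeta_coeff n) * of_nat n powr (-s))"
    using sum.shift_bounds_Suc_ivl[of "\<lambda>n. of_real (log_zeta_coeff n) * of_nat n powr (-s)" 0 Z]
    by (simp add: f_def lessThan_atLeast0 atLeastLessThanSuc_atLeastAtMost)
  ultimately have eq: "log_zeta s - (\<Sum>n=1..Z. of_real (log_zeta_coeff n) * of_nat n powr (-s)) = (\<Sum>n. f (n + Z))"
    by (simp add: sums_iff)
  have bnd: "norm (f (n + Z)) \<le> 1 / (real Z)\<^sup>2 * (1 / (real n + 1)\<^sup>2)" for n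
  proof -
    have "norm (f (n + Z)) \<le> 1 * real (Suc (n + Z)) powr (-4)"
      unfolding f_def norm_mult norm_Suc_powr using assms log_zeta_coeff_bounds
      by (intro mult_mono) auto
    also have "\<dots> = real (Suc (n + Z)) powr (-2) * real (Suc (n + Z)) powr (-2)"
      by (simp only: powr_add[symmetric]) simp
    also have "\<dots> \<le> real Z powr (-2) * (real n + 1) powr (-2)"
      using assms by (intro mult_mono powr_mono2') auto
    also have "\<dots> = 1 / (real Z)\<^sup>2 * (1 / (real n + 1)\<^sup>2)"
      using assms by (simp add: powr_minus divide_inverse)
    finally show ?thesis .
  qed
  have sq: "(\<lambda>n. 1 / (real n + 1)\<^sup>2) sums (pi\<^sup>2 / 6)"
    using inverse_squares_sums by (simp add: add.commute)
  have "norm (\<Sum>n. f (n + Z)) \<le> (\<Sum>n. 1 / (real Z)\<^sup>2 * (1 / (real n + 1)\<^sup>2))"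
    using sq by (intro norm_suminf_le bnd summable_mult) (simp add: sums_iff)
  also have "\<dots> = 1 / (real Z)\<^sup>2 * (pi\<^sup>2 / 6)"
    using sums_mult[OF sq, of "1 / (real Z)\<^sup>2"] by (simp add: sums_iff)
  also have "\<dots> \<le> 1 / (real Z)\<^sup>2 * 2"
  proof (intro mult_left_mono)
    have "pi\<^sup>2 \<le> 3.2\<^sup>2" using pi_less_4 pi_approx by (intro power_mono) auto
    then show "pi\<^sup>2 / 6 \<le> 2" by (simp add: power2_eq_square)
  qed auto
  finally show ?thesis unfolding eq by simp
qed

text \<open>
  The averaging formula with \<open>Y = 4m\<close> and \<open>h = log 4\<close>, combined with a hypothetical lower bound \<open>-X\<close> for
  \<open>log |\<zeta>|\<close> on the segment. Instead of moving the kernel to a line of absolute convergence, the partial sum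
  \<open>P\<close> of \<open>log \<zeta>\<close> up to \<open>Z\<close> is subtracted first: \<open>(g - P) K\<close> is negligible on the right side of the
  rectangle because \<open>g - P\<close> is small there, and on the horizontal sides because \<open>K\<close> decays. So on the
  left side, where \<open>K\<close> is real and nonnegative, the average of \<open>g\<close> is that of \<open>P\<close>, which is evaluated term
  by term.

  The triangle around \<open>log Y\<close> is supported on \<open>[m/4, 64m]\<close> and at least half its maximum on \<open>(m, 16m]\<close>.
\<close>

lemma smoothed_log_zeta_inequality:
  fixes m Z :: nat
  assumes m: "4 \<le> m" "16 * m \<le> Z" and \<sigma>: "1/2 < \<sigma>" "\<sigma> < 1" "\<alpha> < \<sigma>" and r: "real Z < r"
    and branch: "log_zeta_branch \<alpha> t r g"
    and bnd: "\<And>s. \<sigma> \<le> Re s \<Longrightarrow> Re s \<le> 4 \<Longrightarrow> \<bar>Im s - t\<bar> \<le> real Z \<Longrightarrow> norm (g s) \<le> B"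
    and low: "\<And>v. \<bar>v - t\<bar> \<le> real Z \<Longrightarrow> - X \<le> Re (g (Complex \<sigma> v))" and X: "0 \<le> X"
    and cos: "\<And>n. primepow n \<Longrightarrow> n \<le> 64 * m \<Longrightarrow> 1/2 \<le> cos (t * ln (real n))"
    and err: "2 * exp ((ln (4 * real m) + 2 * ln 4) * (7/2)) * (7 * (B + real Z) / (real Z)\<^sup>2 + 4 / real Z) \<le> 1"
  shows "(\<Sum>n\<in>{m<..16*m}. log_zeta_coeff n * real n powr (-\<sigma>)) \<le> 200 * (X + 2)"
proof -
  define h where "h = ln (4 :: real)"
  define l where "l = ln (4 * real m)"
  \<comment> \<open>The exponential growth of the kernel off the real line, at distance at most \<open>4 - \<sigma> \<le> 7/2\<close>.\<close>
  define E where "E = exp ((l + 2 * h) * (7/2))"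
  have h: "4/3 \<le> h"
  proof -
    have "ln (4::real) = 2 * ln 2" using ln_realpow[of 2 2] by simp
    then show ?thesis using ln2_ge_two_thirds by (simp add: h_def)
  qed
  have ln16: "2 * h = ln 16" using ln_realpow[of 4 2] by (simp add: h_def)
  have l: "2 * h \<le> l" unfolding ln16 l_def using m by (intro ln_mono) auto
  have Z: "1 \<le> Z" using m by linarith
  define P where "P s = (\<Sum>n=1..Z. of_real (log_zeta_coeff n) * of_nat n powr (-s))" for s :: complex
  \<comment> \<open>The substitution \<open>s = \<sigma> + i(t + u)\<close>, so that the left side of the rectangle is the real line in \<open>u\<close>.\<close>
  define w where "w s = - \<i> * (s - Complex \<sigma> t)" for s :: complex
  define q where "q s = (g s - P s) * shifted_fejer_complex h l (w s)" for s
  define D where "D = {s. \<alpha> < Re s} \<inter> ({s. t - r < Im s} \<inter> {s. Im s < t + r})"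
  have D_eq: "D = {s. \<alpha> < Re s \<and> \<bar>Im s - t\<bar> < r}" by (auto simp: D_def)
  have D: "convex D" unfolding D_def
    by (intro convex_Int convex_halfspace_Re_gt convex_halfspace_Im_gt convex_halfspace_Im_lt)
  have holq: "q holomorphic_on D"
    unfolding q_def P_def w_def using branch unfolding log_zeta_branch_def D_eq[symmetric]
    by (intro holomorphic_intros shifted_fejer_complex_holomorphic) auto
  define R where "R = rectpath (Complex \<sigma> (t - real Z)) (Complex 4 (t + real Z))"
  have img: "path_image R \<subseteq> D"
    unfolding R_def using \<sigma> r Z by (subst path_image_rectpath) (auto simp: D_def)
  have I0: "(q has_contour_integral 0) R"
    by (rule Cauchy_theorem_convex_simple[OF holq D _ img]) (auto simp: R_def)
  have contq: "continuous_on (path_image R) q"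
    by (rule continuous_on_subset[OF holomorphic_on_imp_continuous_on[OF holq] img])
  have Pb: "norm (P s) \<le> real Z" if "0 \<le> Re s" for s
  proof -
    have "norm (of_real (log_zeta_coeff n) * of_nat n powr (-s) :: complex) \<le> 1" if n: "n \<in> {1..Z}" for n
    proof -
      have "real n powr (- Re s) \<le> 1" using n \<open>0 \<le> Re s\<close> powr_mono[of "- Re s" 0 "real n"] by simp
      then show ?thesis using n log_zeta_coeff_bounds[of n]
        by (auto simp: norm_mult norm_of_nat_powr intro: mult_le_one)
    qed
    then have "norm (P s) \<le> (\<Sum>n=1..Z. 1)" unfolding P_def by (intro sum_norm_le) auto
    then show ?thesis by simp
  qed
  have wRe: "Re (w (Complex x v)) = v - t" "Im (w (Complex x v)) = - (x - \<sigma>)" for x v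
    by (simp_all add: w_def)
  have Kb: "norm (shifted_fejer_complex h l (w (Complex x v))) \<le> 2 * E / c\<^sup>2"
    if "\<sigma> \<le> x" "x \<le> 4" "0 < c" "c \<le> norm (w (Complex x v))" for x v c
  proof -
    have "norm (shifted_fejer_complex h l (w (Complex x v))) \<le> 2 * exp ((l + 2 * h) * \<bar>Im (w (Complex x v))\<bar>) / (norm (w (Complex x v)))\<^sup>2"
      using that h l by (intro norm_shifted_fejer_complex_le) auto
    also have "\<dots> \<le> 2 * E / c\<^sup>2"
    proof (intro frac_le mult_left_mono power_mono)
      have "(l + 2 * h) * \<bar>Im (w (Complex x v))\<bar> \<le> (l + 2 * h) * (7/2)"
        using that \<sigma> h l unfolding wRe by (intro mult_left_mono) auto
      then show "exp ((l + 2 * h) * \<bar>Im (w (Complex x v))\<bar>) \<le> E" unfolding E_def by simp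
    qed (use that in \<open>auto simp: E_def\<close>)
    finally show ?thesis .
  qed
  have B0: "0 \<le> B" using order.trans[OF norm_ge_zero bnd[of "Complex \<sigma> t"]] \<sigma> by simp
  have hor: "norm (q (Complex x v)) \<le> (B + real Z) * (2 * E / (real Z)\<^sup>2)"
    if x: "\<sigma> \<le> x" "x \<le> 4" and v: "v = t - real Z \<or> v = t + real Z" for x v
  proof -
    have "norm (g (Complex x v) - P (Complex x v)) \<le> B + real Z"
      using bnd[of "Complex x v"] Pb[of "Complex x v"] x v \<sigma> norm_triangle_ineq4[of "g (Complex x v)" "P (Complex x v)"] by auto
    moreover have "real Z \<le> norm (w (Complex x v))"
      using abs_Re_le_cmod[of "w (Complex x v)"] v unfolding wRe by auto
    then have "norm (shifted_fejer_complex h l (w (Complex x v))) \<le> 2 * E / (real Z)\<^sup>2"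
      using Kb[OF x] Z by auto
    ultimately show ?thesis unfolding q_def norm_mult using B0 by (intro mult_mono) auto
  qed
  have right: "norm (q (Complex 4 v)) \<le> 2 / (real Z)\<^sup>2 * (2 * E)"
    if v: "t - real Z \<le> v" "v \<le> t + real Z" for v
  proof -
    have "g (Complex 4 v) = log_zeta (Complex 4 v)"
      using branch v r by (auto simp: log_zeta_branch_def)
    then have "norm (g (Complex 4 v) - P (Complex 4 v)) \<le> 2 / (real Z)\<^sup>2"
      unfolding P_def using log_zeta_partial_sum_error[of "Complex 4 v" Z] Z by simp
    moreover have "1 \<le> norm (w (Complex 4 v))"
      using abs_Im_le_cmod[of "w (Complex 4 v)"] \<sigma> unfolding wRe by auto
    then have "norm (shifted_fejer_complex h l (w (Complex 4 v))) \<le> 2 * E"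
      using Kb[of 4 1 v] \<sigma> by simp
    ultimately show ?thesis unfolding q_def norm_mult by (intro mult_mono) auto
  qed
  have "norm (0 + \<i> * integral {t - real Z..t + real Z} (\<lambda>v. q (Complex \<sigma> v)))
      \<le> 2 * ((B + real Z) * (2 * E / (real Z)\<^sup>2)) * (4 - \<sigma>) + 2 / (real Z)\<^sup>2 * (2 * E) * (t + real Z - (t - real Z))"
    using \<sigma> Z hor right I0 contq unfolding R_def
    by (intro rectpath_integral_bound) auto
  also have "\<dots> \<le> 2 * ((B + real Z) * (2 * E / (real Z)\<^sup>2)) * (7/2) + 2 / (real Z)\<^sup>2 * (2 * E) * (2 * real Z)"
    using \<sigma> B0 by (intro add_mono mult_left_mono) (auto simp: E_def)
  also have "\<dots> = 2 * E * (7 * (B + real Z) / (real Z)\<^sup>2 + 4 / real Z)"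
    using Z by (simp add: field_simps power2_eq_square)
  also have "\<dots> \<le> 1" using err by (simp add: E_def l_def h_def)
  finally have n1: "norm (integral {t - real Z..t + real Z} (\<lambda>v. q (Complex \<sigma> v))) \<le> 1"
    by (simp add: norm_mult)
  define K where "K = shifted_fejer h l"
  have contl: "continuous_on {t - real Z..t + real Z} (\<lambda>v. q (Complex \<sigma> v))"
  proof (rule continuous_on_compose2[OF contq])
    show "continuous_on {t - real Z..t + real Z} (Complex \<sigma>)"
      by (auto simp: complex_eq[abs_def] intro!: continuous_intros)
    show "Complex \<sigma> ` {t - real Z..t + real Z} \<subseteq> path_image R"
      unfolding R_def using \<sigma> by (subst path_image_rectpath) auto
  qed
  have "integral {- real Z..real Z} (\<lambda>u. q (Complex \<sigma> (u + t))) = integral {t - real Z..t + real Z} (\<lambda>v. q (Complex \<sigma> v))"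
    using integral_shift_Icc_real[of "- real Z" "real Z" "\<lambda>v. q (Complex \<sigma> v)" t] by (simp add: o_def add.commute)
  then have n2: "norm (integral {- real Z..real Z} (\<lambda>u. q (Complex \<sigma> (u + t)))) \<le> 1" using n1 by simp
  have contu: "continuous_on {- real Z..real Z} (\<lambda>u. q (Complex \<sigma> (u + t)))"
    by (rule continuous_on_compose2[OF contl]) (auto intro!: continuous_intros)
  then have int_q: "(\<lambda>u. q (Complex \<sigma> (u + t))) integrable_on {- real Z..real Z}" by (rule integrable_continuous_real)
  define a where "a n = log_zeta_coeff n * real n powr (- \<sigma>)" for n
  have a: "0 \<le> a n" "a n \<le> 1" if "1 \<le> n" for n
  proof -
    show "0 \<le> a n" using log_zeta_coeff_bounds by (simp add: a_def)
    have "real n powr (- \<sigma>) \<le> 1" using that \<sigma> powr_mono[of "-\<sigma>" 0 "real n"] by simp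
    then show "a n \<le> 1" unfolding a_def using log_zeta_coeff_bounds[of n] by (intro mult_le_one) auto
  qed
  have Req: "Re (q (Complex \<sigma> (u + t))) = Re (g (Complex \<sigma> (u + t))) * K u - (\<Sum>n=1..Z. a n * (K u * cos (t * ln (real n) + ln (real n) * u)))" for u
  proof -
    have "w (Complex \<sigma> (u + t)) = of_real u" using wRe[of \<sigma> "u + t"] by (simp add: complex_eq_iff)
    then have "Re (q (Complex \<sigma> (u + t))) = (Re (g (Complex \<sigma> (u + t))) - Re (P (Complex \<sigma> (u + t)))) * K u"
      by (simp add: q_def shifted_fejer_complex_of_real K_def)
    also have "Re (P (Complex \<sigma> (u + t))) = (\<Sum>n=1..Z. a n * cos (t * ln (real n) + ln (real n) * u))"
      unfolding P_def Re_sum a_def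
      by (intro sum.cong refl) (simp add: of_nat_powr_vertical algebra_simps)
    finally show ?thesis
      unfolding left_diff_distrib sum_distrib_right mult.assoc by (simp only: mult.commute[of _ "K u"])
  qed
  define I where "I n = integral {- real Z..real Z} (\<lambda>u. K u * cos (t * ln (real n) + ln (real n) * u))" for n :: nat
  have contK: "continuous_on A K" for A unfolding K_def by (rule continuous_on_shifted_fejer)
  have intI: "(\<lambda>u. K u * cos (t * ln (real n) + ln (real n) * u)) integrable_on {- real Z..real Z}" for n
    by (intro integrable_continuous_real continuous_intros contK)
  define J where "J = integral {- real Z..real Z} K"
  have J: "J \<le> pi * h + 8"
  proof -
    have "\<bar>J - (fejer_hat h 0 - fejer_hat h (- l) / 2 - fejer_hat h l / 2)\<bar> \<le> 8 / real Z"
      using shifted_fejer_transform[of "real Z" h l 0 0] Z h by (simp add: J_def K_def)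
    moreover have "8 / real Z \<le> 8 / 1" using Z by (intro divide_left_mono) auto
    ultimately show ?thesis using fejer_hat_bounds(1,2)[of h 0] fejer_hat_bounds(1)[of h l] fejer_hat_bounds(1)[of h "-l"] h by simp
  qed
  have Knn: "0 \<le> K u" for u by (simp add: K_def shifted_fejer_nonneg)
  \<comment> \<open>The real part of the small integral of \<open>(g - P) K\<close> along the left side. Here the sign of \<open>K\<close> is used.\<close>
  have step1: "- X * J - (\<Sum>n=1..Z. a n * I n) \<le> 1"
  proof -
    have "- X * J - (\<Sum>n=1..Z. a n * I n) = integral {- real Z..real Z} (\<lambda>u. - X * K u - (\<Sum>n=1..Z. a n * (K u * cos (t * ln (real n) + ln (real n) * u))))"
      unfolding J_def I_def
      by (subst integral_diff, (intro integrable_on_mult_right integrable_continuous_real contK integrable_sum intI finite_atLeastAtMost)+,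
          subst integral_sum, (intro finite_atLeastAtMost integrable_on_mult_right intI)+) (simp del: minus_mult_minus mult_minus_left)
    also have "\<dots> \<le> integral {- real Z..real Z} (\<lambda>u. Re (q (Complex \<sigma> (u + t))))"
    proof (rule integral_le)
      show "(\<lambda>u. - X * K u - (\<Sum>n=1..Z. a n * (K u * cos (t * ln (real n) + ln (real n) * u)))) integrable_on {- real Z..real Z}"
        by (intro integrable_diff integrable_on_mult_right integrable_continuous_real contK integrable_sum intI finite_atLeastAtMost)
      show "(\<lambda>u. Re (q (Complex \<sigma> (u + t)))) integrable_on {- real Z..real Z}"
        by (intro integrable_continuous_real continuous_intros contu)
      fix u assume u: "u \<in> {- real Z..real Z}"
      have "- X * K u \<le> Re (g (Complex \<sigma> (u + t))) * K u"
        using low[of "u + t"] u Knn by (intro mult_right_mono) auto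
      then show "- X * K u - (\<Sum>n=1..Z. a n * (K u * cos (t * ln (real n) + ln (real n) * u))) \<le> Re (q (Complex \<sigma> (u + t)))"
        unfolding Req by simp
    qed
    also have "\<dots> = Re (integral {- real Z..real Z} (\<lambda>u. q (Complex \<sigma> (u + t))))"
      using integral_linear[OF int_q bounded_linear_Re] by (simp add: o_def)
    also have "\<dots> \<le> 1" using n2 complex_Re_le_cmod order.trans by blast
    finally show ?thesis .
  qed
  \<comment> \<open>The transform of the kernel at \<open>log n\<close> involves three triangles of half-width \<open>log 16\<close>. The central one, \<open>f1\<close>, meets only \<open>n < 16\<close>; the one around \<open>- log Y\<close> is never met; the one around \<open>log Y\<close>, \<open>f2\<close>, lives where the cosine is at least \<open>1/2\<close>.\<close>
  have In: "a n * I n \<le> (if n < 16 then pi * h else 0) + 8 / real Z - a n * fejer_hat h (ln (real n) - l) / 4"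
    if n: "n \<in> {1..Z}" for n
  proof (cases "primepow n")
    case False
    then have "a n = 0" by (simp add: a_def log_zeta_coeff_def mangoldt_def)
    then show ?thesis using h by simp
  next
    case True
    define c where "c = cos (t * ln (real n))"
    define f1 f2 where "f1 = fejer_hat h (ln (real n))" "f2 = fejer_hat h (ln (real n) - l)"
    have c: "c \<le> 1" by (simp add: c_def)
    have f: "0 \<le> f1" "0 \<le> f2" using fejer_hat_bounds(1)[of h] h by (auto simp: f1_f2_def)
    have f3: "fejer_hat h (ln (real n) + l) = 0" 
    proof (rule fejer_hat_bounds(3))
      have "0 \<le> ln (real n)" using n by simp
      then show "2 * h \<le> \<bar>ln (real n) + l\<bar>" using l by linarith
    qed (use h in simp)
    have f1: "f1 \<le> (if n < 16 then pi * h else 0)"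
    proof (cases "n < 16")
      case False
      then have "2 * h \<le> ln (real n)" unfolding ln16 by (intro ln_mono) auto
      then show ?thesis using fejer_hat_bounds(3)[of h "ln (real n)"] h False by (simp add: f1_f2_def)
    qed (use fejer_hat_bounds(2)[of h] h in \<open>simp add: f1_f2_def\<close>)
    have f2c: "f2 / 2 \<le> c * f2"
    proof (cases "n \<le> 64 * m")
      case le: True
      have "1/2 \<le> c" unfolding c_def using cos[OF True le] .
      then show ?thesis using mult_right_mono[of "1/2" c f2] f by simp
    next
      case False
      have "ln (16 * (4 * real m)) \<le> ln (real n)" using False m by (intro ln_mono) auto
      moreover have "ln (16 * (4 * real m)) = ln 16 + l" unfolding l_def using m by (intro ln_mult_pos) auto
      ultimately have "2 * h \<le> \<bar>ln (real n) - l\<bar>" unfolding ln16 by linarith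
      then have "f2 = 0" using fejer_hat_bounds(3)[of h] h by (simp add: f1_f2_def)
      then show ?thesis by simp
    qed
    have "\<bar>I n - c * (f1 - f2 / 2 - 0 / 2)\<bar> \<le> 8 / real Z"
      using shifted_fejer_transform[of "real Z" h l "t * ln (real n)" "ln (real n)"] Z h f3
      unfolding I_def K_def c_def f1_f2_def by simp
    then have "I n \<le> c * (f1 - f2 / 2) + 8 / real Z" by simp
    also have "c * (f1 - f2 / 2) = c * f1 - c * f2 / 2" by (simp add: right_diff_distrib)
    also have "c * f1 \<le> 1 * f1" using c f by (intro mult_right_mono) auto
    finally have "I n \<le> f1 + 8 / real Z - f2 / 4" using f2c by linarith
    then have "a n * I n \<le> a n * (f1 + 8 / real Z - f2 / 4)" using a n by (intro mult_left_mono) auto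
    also have "\<dots> = a n * (f1 + 8 / real Z) - a n * f2 / 4" by (simp add: right_diff_distrib)
    also have "a n * (f1 + 8 / real Z) \<le> 1 * (f1 + 8 / real Z)"
      using a[of n] n f by (intro mult_right_mono add_nonneg_nonneg) auto
    finally show ?thesis using f1 by (simp add: f1_f2_def)
  qed
  define S where "S = (\<Sum>n\<in>{m<..16*m}. a n)"
  have A: "(\<Sum>n=1..Z. a n * I n) \<le> (\<Sum>n=1..Z. if n < 16 then pi * h else 0) + 8 - (\<Sum>n=1..Z. a n * fejer_hat h (ln (real n) - l)) / 4"
  proof -
    have "(\<Sum>n=1..Z. a n * I n) \<le> (\<Sum>n=1..Z. (if n < 16 then pi * h else 0) + 8 / real Z - a n * fejer_hat h (ln (real n) - l) / 4)"
    by (intro sum_mono In)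
  also have "\<dots> = (\<Sum>n=1..Z. if n < 16 then pi * h else 0) + 8 - (\<Sum>n=1..Z. a n * fejer_hat h (ln (real n) - l)) / 4"
      using Z by (simp add: sum.distrib sum_subtractf sum_divide_distrib)
    finally show ?thesis .
  qed
  have B: "(\<Sum>n=1..Z. if n < 16 then pi * h else 0) \<le> 16 * (pi * h)"
  proof -
    have "(\<Sum>n=1..Z. if n < 16 then pi * h else 0) = (\<Sum>n\<in>{n\<in>{1..Z}. n < 16}. pi * h)"
      by (rule sum.inter_filter[symmetric]) simp
    also have "\<dots> \<le> (\<Sum>n\<in>{..<16::nat}. pi * h)" by (rule sum_mono2) (use h in auto)
    finally show ?thesis by simp
  qed
  have C: "pi * h / 2 * S \<le> (\<Sum>n=1..Z. a n * fejer_hat h (ln (real n) - l))"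
  proof -
    have "pi * h / 2 * S = (\<Sum>n\<in>{m<..16*m}. a n * (pi * h / 2))" by (simp add: S_def sum_distrib_left mult.commute)
    also have "\<dots> \<le> (\<Sum>n\<in>{m<..16*m}. a n * fejer_hat h (ln (real n) - l))"
    proof (intro sum_mono mult_left_mono fejer_hat_bounds(4))
      fix n assume n: "n \<in> {m<..16*m}"
      have "l = ln 4 + ln (real m)" unfolding l_def using m by (intro ln_mult_pos) auto
      moreover have "ln (16 * real m) = ln 16 + ln (real m)" using m by (intro ln_mult_pos) auto
      moreover have "ln (real m) \<le> ln (real n)" using n m by (intro ln_mono) auto
      moreover have "ln (real n) \<le> ln (16 * real m)" using n m by (intro ln_mono) auto
      ultimately show "\<bar>ln (real n) - l\<bar> \<le> h" using ln16 by (simp add: h_def abs_le_iff)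
    qed (use h a in auto)
    also have "\<dots> \<le> (\<Sum>n=1..Z. a n * fejer_hat h (ln (real n) - l))"
      using m h a fejer_hat_bounds(1)[of h] by (intro sum_mono2 mult_nonneg_nonneg) auto
    finally show ?thesis .
  qed
  have main: "(\<Sum>n=1..Z. a n * I n) \<le> 16 * (pi * h) + 8 - pi * h * S / 8"
    using A B C by argo
  define p where "p = pi * h"
  have p: "4 \<le> p"
    using mult_mono[of 3 pi "4/3" h] pi_gt3 h by (simp add: p_def)
  have XJ: "X * J \<le> X * (p + 8)" using J X by (intro mult_left_mono) (auto simp: p_def)
  have "p * S \<le> 128 * p + 72 + 8 * (X * (p + 8))" using step1 main XJ unfolding p_def[symmetric] by simp
  also have "\<dots> \<le> p * (200 * (X + 2))"
  proof -
    have "72 \<le> 18 * p" using p by simp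
    moreover have "64 * X \<le> 16 * (p * X)" using mult_right_mono[OF p X] by linarith
    moreover have "0 \<le> p * X" using p X by simp
    ultimately show ?thesis using p by (simp add: algebra_simps)
  qed
  finally have "S \<le> 200 * (X + 2)" using p by simp
  then show ?thesis by (simp add: S_def a_def)
qed

section \<open>Large values of the negative logarithm\<close>

lemma eventually_powr_le_powr:
  fixes a b D :: real
  assumes "a < b" "0 < e"
  shows "\<forall>\<^sub>F T in at_top. D * T powr a \<le> e * T powr b"
  using assms by real_asymp

lemma sum_log_zeta_coeff_ge:
  assumes m: "1 \<le> m" "7 * real m \<le> chebyshev_psi (16 * m) - chebyshev_psi m" and \<sigma>: "0 \<le> \<sigma>"
  shows "7/16 * (16 * real m) powr (1 - \<sigma>) / ln (16 * real m) \<le> (\<Sum>n\<in>{m<..16*m}. log_zeta_coeff n * real n powr (-\<sigma>))"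
proof -
  have pos: "0 < ln (16 * real m)" using m by simp
  have split: "chebyshev_psi (16 * m) - chebyshev_psi m = (\<Sum>n\<in>{m<..16*m}. mangoldt n)"
  proof -
    have "{1..16*m} = {1..m} \<union> {m<..16*m}" by auto
    then have "chebyshev_psi (16 * m) = chebyshev_psi m + (\<Sum>n\<in>{m<..16*m}. mangoldt n)"
      unfolding chebyshev_psi_def by (simp add: sum.union_disjoint Int_def)
    then show ?thesis by simp
  qed
  have "7/16 * (16 * real m) powr (1 - \<sigma>) / ln (16 * real m) = 7 * real m * ((16 * real m) powr (-\<sigma>) / ln (16 * real m))"
    using m powr_add[of "16 * real m" 1 "-\<sigma>"] by simp
  also have "\<dots> \<le> (\<Sum>n\<in>{m<..16*m}. mangoldt n) * ((16 * real m) powr (-\<sigma>) / ln (16 * real m))"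
    using m(2) pos unfolding split by (intro mult_right_mono) auto
  also have "\<dots> = (\<Sum>n\<in>{m<..16*m}. mangoldt n / ln (16 * real m) * (16 * real m) powr (-\<sigma>))"
    by (simp add: sum_distrib_right sum_divide_distrib)
  also have "\<dots> \<le> (\<Sum>n\<in>{m<..16*m}. log_zeta_coeff n * real n powr (-\<sigma>))"
    unfolding log_zeta_coeff_def
  proof (intro sum_mono mult_mono)
    fix n assume n: "n \<in> {m<..16*m}"
    have "0 < ln (real n)" "ln (real n) \<le> ln (16 * real m)" using n m by (auto intro!: ln_mono)
    then show "mangoldt n / ln (16 * real m) \<le> mangoldt n / ln (real n)"
      using mangoldt_nonneg[of n] by (intro divide_left_mono) auto
    show "(16 * real m) powr (-\<sigma>) \<le> real n powr (-\<sigma>)" using n m \<sigma> by (intro powr_mono2') auto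
    show "0 \<le> mangoldt n / ln (real n)" using mangoldt_nonneg[of n] n m by simp
  qed auto
  finally show ?thesis .
qed

lemma card_Un_less_imp_ex:
  assumes "finite S" "finite A" "finite B" "real (card A) + real (card B) < real (card S)"
  shows "\<exists>x\<in>S. x \<notin> A \<and> x \<notin> B"
proof (rule ccontr)
  assume "\<not> (\<exists>x\<in>S. x \<notin> A \<and> x \<notin> B)"
  then have "card S \<le> card (A \<union> B)" using assms by (intro card_mono) auto
  also have "\<dots> \<le> card A + card B" by (rule card_Un_le)
  finally show False using assms by linarith
qed

text \<open>
  Counting among multiples of \<open>4H + 2\<close>: at least \<open>T\<^sup>1\<^sup>-\<^sup>\<kappa>\<^sup>/\<^sup>8 / 2\<close> of them make all cosines large, at most
  \<open>T\<^sup>\<beta> + 3\<close> are too small, and \<open>O(T\<^sup>1\<^sup>-\<^sup>\<eta>\<^sup>/\<^sup>4)\<close> are close to a zero. The hypotheses on \<open>\<kappa>\<close> make the first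
  number win.
\<close>

lemma good_point_exists:
  assumes \<eta>: "0 < \<eta>" and \<kappa>: "0 < \<kappa>" "\<kappa> < 2 * \<eta>" and \<beta>: "0 < \<beta>" "\<beta> < 1 - \<kappa>"
  shows "\<forall>\<^sub>F T in at_top. \<forall>H P. ln T \<le> H \<longrightarrow> H \<le> sqrt T \<longrightarrow> 4 * H + 2 \<le> T powr (\<kappa> / 16) \<longrightarrow> finite P \<longrightarrow>
     6 ^ card P \<le> T powr (\<kappa> / 16) \<longrightarrow>
     (\<exists>t. \<not> zero_near (1/2 + \<eta>) t (H + 1) \<and> T powr \<beta> + H + 1 \<le> t \<and> t + H + 1 \<le> T \<and> (\<forall>\<omega>\<in>P. 1/2 \<le> cos (t * \<omega>)))"
proof -
  obtain C where C: "\<forall>\<^sub>F T in at_top. \<forall>H J. ln T \<le> H \<longrightarrow> H \<le> sqrt T \<longrightarrow> real J * (4 * H + 2) \<le> T \<longrightarrow>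
     real (card {j\<in>{1..<J}. zero_near (1/2 + \<eta>) (real j * (4 * H + 2)) (H + 1)}) \<le> C * T powr (1 - \<eta> / 4)"
    using zero_density[OF \<eta>] by blast
  have e1: "\<forall>\<^sub>F T in at_top. 1 * T powr \<beta> \<le> 1/8 * T powr (1 - \<kappa> / 8)"
    using \<beta> \<kappa> by (intro eventually_powr_le_powr) auto
  have e2: "\<forall>\<^sub>F T in at_top. C * T powr (1 - \<eta> / 4) \<le> 1/8 * T powr (1 - \<kappa> / 8)"
    using \<eta> \<kappa> by (intro eventually_powr_le_powr) auto
  have e3: "\<forall>\<^sub>F T in at_top. 4 * T powr 0 \<le> 1/8 * T powr (1 - \<kappa> / 8)"
    using \<beta> \<kappa> by (intro eventually_powr_le_powr) auto
  show ?thesis using C e1 e2 e3 eventually_ge_at_top[of "exp 1"]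
  proof eventually_elim
    case (elim T)
    have T1: "1 \<le> T" using elim(5) exp_ge_add_one_self[of 1] by linarith
    have lnT: "1 \<le> ln T" using elim(5) by (metis exp_gt_zero ln_exp ln_mono)
    show ?case
    proof (intro allI impI)
      fix H and P :: "real set" assume H: "ln T \<le> H" "H \<le> sqrt T" "4 * H + 2 \<le> T powr (\<kappa> / 16)"
        and P: "finite P" "6 ^ card P \<le> T powr (\<kappa> / 16)"
      define \<Delta> where "\<Delta> = 4 * H + 2"
      have H1: "1 \<le> H" using lnT H by linarith
      have \<Delta>: "1 \<le> \<Delta>" "0 < \<Delta>" using H1 by (auto simp: \<Delta>_def)
      define J where "J = nat \<lfloor>T / \<Delta>\<rfloor>"
      have J: "real J \<le> T / \<Delta>" "T / \<Delta> - 1 \<le> real J"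
        using T1 \<Delta> by (auto simp: J_def)
      have JT: "real J * \<Delta> \<le> T" using J(1) \<Delta> by (simp add: field_simps)
      obtain S where S: "S \<subseteq> {0..<J}" "J \<le> card S * 6 ^ card ((*) \<Delta> ` P)" "\<forall>j\<in>S. \<forall>\<omega>\<in>(*) \<Delta> ` P. 1/2 \<le> cos (real j * \<omega>)"
        using simultaneous_cos_ge_half[of "(*) \<Delta> ` P" J] P by auto
      have cardS: "1/2 * T powr (1 - \<kappa> / 8) \<le> real (card S)"
      proof -
        have "T powr (1 - \<kappa> / 16) = T / T powr (\<kappa> / 16)" using T1 by (simp add: powr_diff)
        also have "\<dots> \<le> T / \<Delta>" using H(3) \<Delta> T1 by (intro divide_left_mono) (auto simp: \<Delta>_def)
        finally have "T powr (1 - \<kappa> / 16) - 1 \<le> real J" using J by linarith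
        moreover have "2 \<le> T powr (1 - \<kappa> / 16)"
        proof -
          have "T powr (1 - \<kappa> / 8) \<le> T powr (1 - \<kappa> / 16)" using T1 \<kappa> by (intro powr_mono) auto
          then show ?thesis using elim(4) T1 by simp
        qed
        ultimately have "1/2 * T powr (1 - \<kappa> / 16) \<le> real J" by linarith
        also have "\<dots> \<le> real (card S) * 6 ^ card ((*) \<Delta> ` P)"
          using S(2) by (metis of_nat_le_iff of_nat_mult of_nat_numeral of_nat_power)
        also have "\<dots> \<le> real (card S) * T powr (\<kappa> / 16)"
        proof (intro mult_left_mono)
          have "(6::real) ^ card ((*) \<Delta> ` P) \<le> 6 ^ card P"
            using card_image_le[OF P(1), of "(*) \<Delta>"] by (intro power_increasing) auto
          then show "(6::real) ^ card ((*) \<Delta> ` P) \<le> T powr (\<kappa> / 16)" using P(2) by linarith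
        qed auto
        finally have "1/2 * T powr (1 - \<kappa> / 16) * T powr (- \<kappa> / 16) \<le> real (card S) * T powr (\<kappa> / 16) * T powr (- \<kappa> / 16)"
          by (intro mult_right_mono) auto
        then show ?thesis using T1 by (simp add: mult.assoc flip: powr_add)
      qed
      define Bad where "Bad = {j\<in>{1..<J}. zero_near (1/2 + \<eta>) (real j * \<Delta>) (H + 1)}"
      \<comment> \<open>As \<open>\<Delta> \<ge> 1\<close>, every other \<open>j\<close> gives \<open>j \<Delta> \<ge> T\<^sup>\<beta> + \<Delta>\<close>, with \<open>\<Delta>\<close> exceeding the half-width \<open>H + 1\<close> of the box.\<close>
      define Low where "Low = {j::nat. real j < T powr \<beta> + 1}"
      have fin: "finite S" "finite Bad" "finite Low"
      proof -
        show "finite S" using S(1) finite_subset by blast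
        show "finite Bad" by (simp add: Bad_def)
        have "Low \<subseteq> {..nat \<lceil>T powr \<beta> + 1\<rceil>}" by (auto simp: Low_def) linarith
        then show "finite Low" by (rule finite_subset) simp
      qed
      have cB: "real (card Bad) \<le> C * T powr (1 - \<eta> / 4)"
        using elim(1) H JT unfolding Bad_def \<Delta>_def by blast
      have cL: "real (card Low) \<le> T powr \<beta> + 3"
      proof -
        have "Low \<subseteq> {..<nat \<lceil>T powr \<beta> + 1\<rceil>}" by (auto simp: Low_def) linarith
        then have "card Low \<le> nat \<lceil>T powr \<beta> + 1\<rceil>" using card_mono[of "{..<nat \<lceil>T powr \<beta> + 1\<rceil>}" Low] by simp
        moreover have "real (nat \<lceil>T powr \<beta> + 1\<rceil>) \<le> T powr \<beta> + 2" 
        proof -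
          have "0 \<le> \<lceil>T powr \<beta> + 1\<rceil>" using powr_ge_zero[of T \<beta>] by linarith
          then have "real (nat \<lceil>T powr \<beta> + 1\<rceil>) = of_int \<lceil>T powr \<beta> + 1\<rceil>" by (rule of_nat_nat)
          then show ?thesis by linarith
        qed
        ultimately show ?thesis by linarith
      qed
      have "real (card Bad) + real (card Low) < real (card S)"
        using cB cL cardS elim(2-4) T1 by simp
      then obtain j where j: "j \<in> S" "j \<notin> Bad" "j \<notin> Low"
        using card_Un_less_imp_ex[OF fin(1,2,3)] by blast
      define t where "t = real j * \<Delta>"
      have jl: "T powr \<beta> + 1 \<le> real j" using j(3) by (simp add: Low_def)
      then have j1: "1 \<le> j" using powr_ge_zero[of T \<beta>] by linarith
      have jJ: "j < J" using S(1) j(1) by auto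
      have "\<not> zero_near (1/2 + \<eta>) t (H + 1)" using j(2) j1 jJ by (auto simp: Bad_def t_def)
      moreover have "T powr \<beta> + H + 1 \<le> t"
      proof -
        have "(T powr \<beta> + 1) * \<Delta> \<le> t" unfolding t_def using jl \<Delta> by (intro mult_right_mono) auto
        moreover have "T powr \<beta> * 1 \<le> T powr \<beta> * \<Delta>" using \<Delta> by (intro mult_left_mono) auto
        ultimately show ?thesis using H1 by (simp add: distrib_right \<Delta>_def)
      qed
      moreover have "t + H + 1 \<le> T"
      proof -
        have "(real j + 1) * \<Delta> \<le> real J * \<Delta>" using jJ \<Delta> by (intro mult_right_mono) auto
        then have "t + \<Delta> \<le> T" using JT by (simp add: t_def distrib_right)
        then show ?thesis using H1 by (simp add: \<Delta>_def)
      qed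
      moreover have "\<forall>\<omega>\<in>P. 1/2 \<le> cos (t * \<omega>)" using S(3) j(1) by (auto simp: t_def mult.assoc)
      ultimately show "\<exists>t. \<not> zero_near (1/2 + \<eta>) t (H + 1) \<and> T powr \<beta> + H + 1 \<le> t \<and> t + H + 1 \<le> T \<and> (\<forall>\<omega>\<in>P. 1/2 \<le> cos (t * \<omega>))"
        by blast
    qed
  qed
qed

definition montgomery_size :: "real \<Rightarrow> real \<Rightarrow> real \<Rightarrow> real" where
  "montgomery_size \<sigma> \<kappa> T = \<kappa> powr (1 - \<sigma>) * ((ln T) powr (1 - \<sigma>) / (ln (ln T)) powr \<sigma>)"

text \<open>
  The choice \<open>m = \<lfloor>2\<^sup>-\<^sup>1\<^sup>5 \<kappa> log T log log T\<rfloor>\<close> makes the number of prime powers up to \<open>64m\<close> at most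
  \<open>\<kappa> log T / 32\<close>, so the pigeonhole loss \<open>6\<^sup>k\<close> is at most \<open>T\<^sup>\<kappa>\<^sup>/\<^sup>1\<^sup>6\<close>. The height \<open>Z = m\<^sup>8\<close> of the box
  exceeds the power \<open>m\<^sup>7\<^sup>/\<^sup>2\<close> by which the kernel grows off the real line, with enough to spare
  for the trivial bounds in the contour shift.
\<close>

lemma extreme_value_lower_bound:
  fixes c :: real
  assumes \<sigma>: "1/2 < \<sigma>" "\<sigma> < 1" and \<beta>: "0 < \<beta>" "\<beta> < 1" and \<kappa>: "0 < \<kappa>" "\<kappa> < \<sigma> - 1/2" "\<kappa> < 1 - \<beta>"
    and c: "0 < c" "c \<le> 1 / 2 ^ 27"
  shows "\<forall>\<^sub>F T in at_top. \<exists>t\<in>{T powr \<beta>..T}. neg_log_norm (riemann_zeta (Complex \<sigma> t)) \<ge> ereal (c * montgomery_size \<sigma> \<kappa> T)"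
proof -
  define \<eta> where "\<eta> = (\<sigma> - 1/2) / 2"
  have \<eta>: "0 < \<eta>" "\<kappa> < 2 * \<eta>" using \<sigma> \<kappa> unfolding \<eta>_def by argo+
  define \<alpha> where "\<alpha> = 1/2 + \<eta>"
  have \<alpha>: "1/2 \<le> \<alpha>" "\<alpha> < \<sigma>" using \<sigma> unfolding \<alpha>_def \<eta>_def by argo+
  obtain G where G: "\<forall>\<^sub>F T in at_top. \<forall>t r g. log_zeta_branch \<alpha> t r g \<longrightarrow> 1 \<le> t - r \<longrightarrow> t + r \<le> T \<longrightarrow>
     (\<forall>s. \<sigma> \<le> Re s \<longrightarrow> Re s \<le> 4 \<longrightarrow> \<bar>Im s - t\<bar> \<le> r - 4 \<longrightarrow> norm (g s) \<le> G * ln T)"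
    using log_zeta_branch_bound[OF \<alpha> \<sigma>(2)] by blast
  \<comment> \<open>All conditions on the size of \<open>T\<close> are expressed through \<open>M\<close>, whose asymptotics are elementary; \<open>m\<close> rounds it and loses at most a factor \<open>2\<close>.\<close>
  define M where "M T = \<kappa> / 2 ^ 15 * ln T * ln (ln T)" for T :: real
  define m where "m T = nat \<lfloor>M T\<rfloor>" for T
  have M_large: "\<forall>\<^sub>F T in at_top. x \<le> M T" for x unfolding M_def using \<kappa>(1) by real_asymp
  have m_large: "\<forall>\<^sub>F T in at_top. P (m T)" if P: "eventually P sequentially" for P
  proof -
    obtain N where N: "\<And>n. N \<le> n \<Longrightarrow> P n" using P by (auto simp: eventually_sequentially)
    show ?thesis using M_large[of "real N"]
    proof eventually_elim
      case (elim T)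
      then show ?case by (intro N) (simp add: m_def le_nat_floor)
    qed
  qed
  have err: "\<forall>\<^sub>F n in sequentially. 2 * exp ((ln (4 * real n) + 2 * ln 4) * (7/2)) * (7 * (\<bar>G\<bar> * (real n)\<^sup>2 + real n ^ 8) / (real n ^ 8)\<^sup>2 + 4 / real n ^ 8) \<le> 1"
    by real_asymp
  have card64: "\<forall>\<^sub>F n in sequentially. real (card {k\<in>{1..64*n}. primepow k}) \<le> 7 * real (64 * n) / ln (real (64 * n))"
  proof -
    obtain N where N: "\<And>x. N \<le> x \<Longrightarrow> real (card {k\<in>{1..x}. primepow k}) \<le> 7 * real x / ln (real x)"
      using card_primepow_le by (auto simp: eventually_sequentially)
    then show ?thesis unfolding eventually_sequentially by (intro exI[of _ N] allI impI N) simp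
  qed
  have ev1: "\<forall>\<^sub>F T in at_top. 2 * sqrt (ln T) \<le> M T" unfolding M_def using \<kappa>(1) by real_asymp
  have ev2: "\<forall>\<^sub>F T in at_top. 4 * (M T ^ 8 + 3) + 2 \<le> T powr (\<kappa> / 16)" unfolding M_def using \<kappa>(1) by real_asymp
  have ev3: "\<forall>\<^sub>F T in at_top. M T ^ 8 + 3 \<le> sqrt T" unfolding M_def using \<kappa>(1) by real_asymp
  have ev4: "\<forall>\<^sub>F T in at_top. 16 * M T \<le> (ln T)\<^sup>2" unfolding M_def using \<kappa>(1) by real_asymp
  have ev5: "\<forall>\<^sub>F T in at_top. 2 ^ 30 \<le> montgomery_size \<sigma> \<kappa> T" unfolding montgomery_size_def using \<kappa>(1) \<sigma> by real_asymp
  have good: "\<forall>\<^sub>F T in at_top. \<forall>H P. ln T \<le> H \<longrightarrow> H \<le> sqrt T \<longrightarrow> 4 * H + 2 \<le> T powr (\<kappa> / 16) \<longrightarrow> finite P \<longrightarrow>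
     6 ^ card P \<le> T powr (\<kappa> / 16) \<longrightarrow>
     (\<exists>t. \<not> zero_near \<alpha> t (H + 1) \<and> T powr \<beta> + H + 1 \<le> t \<and> t + H + 1 \<le> T \<and> (\<forall>\<omega>\<in>P. 1/2 \<le> cos (t * \<omega>)))"
    unfolding \<alpha>_def using \<eta> \<kappa> \<beta> by (intro good_point_exists) auto
  show ?thesis
    using G good ev1 ev2 ev3 ev4 ev5 M_large[of 8] m_large[OF err] m_large[OF card64] m_large[OF chebyshev_psi_16_diff]
      eventually_ge_at_top[of "exp (exp 1)"]
  proof eventually_elim
    case (elim T)
    define L where "L = ln T"
    define LL where "LL = ln L"
    have "exp 1 \<le> L" unfolding L_def using elim(12) by (metis exp_gt_zero ln_exp ln_mono)
    then have LL: "1 \<le> LL" unfolding LL_def by (metis exp_gt_zero ln_exp ln_mono)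
    have L: "1 \<le> L" using \<open>exp 1 \<le> L\<close> exp_ge_add_one_self[of 1] by linarith
    have T1: "1 \<le> T"
      using elim(12) exp_ge_add_one_self[of "exp 1"] exp_gt_zero[of "1::real"] by linarith
    then have T: "T powr a = exp (a * L)" for a by (simp add: powr_def L_def)
    define n where "n = m T"
    have n: "real n \<le> M T" "M T / 2 \<le> real n" "4 \<le> n"
      using elim(8) by (auto simp: n_def m_def le_nat_iff le_floor_iff) linarith+
    have Ln2: "L \<le> (real n)\<^sup>2"
    proof -
      have "sqrt L \<le> real n" using n(2) elim(3) by (simp add: L_def)
      then have "(sqrt L)\<^sup>2 \<le> (real n)\<^sup>2" using L by (intro power_mono) auto
      then show ?thesis using L by simp
    qed
    define Z where "Z = n ^ 8"
    have Z: "16 * n \<le> Z" "(real n)\<^sup>2 \<le> real Z"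
    proof -
      have "n ^ 2 \<le> n ^ 8" using n(3) by (intro power_increasing) auto
      then show "(real n)\<^sup>2 \<le> real Z" unfolding Z_def by (simp only: of_nat_le_iff flip: of_nat_power)
      have "n * 4 ^ 7 \<le> n * n ^ 7" using n(3) by (intro mult_left_mono power_mono) auto
      then have "16384 * n \<le> n * n ^ 7" by simp
      moreover have "n * n ^ 7 = Z" unfolding Z_def using power_Suc[of n 7] by simp
      ultimately show "16 * n \<le> Z" by linarith
    qed
    have ZM: "real Z \<le> M T ^ 8" unfolding Z_def of_nat_power using n(1) by (intro power_mono) auto
    define H where "H = real Z + 3"
    have H: "ln T \<le> H" "H \<le> sqrt T" "4 * H + 2 \<le> T powr (\<kappa> / 16)"
    proof -
      show "ln T \<le> H" using Ln2 Z(2) unfolding H_def L_def by linarith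
      show "H \<le> sqrt T" using ZM elim(5) unfolding H_def by linarith
      show "4 * H + 2 \<le> T powr (\<kappa> / 16)" unfolding H_def
        by (rule order.trans[OF _ elim(4)]) (intro add_right_mono mult_left_mono ZM, simp)
    qed
    define Q where "Q = {k\<in>{1..64*n}. primepow k}"
    define P where "P = (\<lambda>k. ln (real k)) ` Q"
    have finP: "finite P" by (simp add: P_def Q_def)
    have ln64: "LL / 2 \<le> ln (real (64 * n))"
    proof -
      have "LL / 2 = ln (sqrt L)" using L by (simp add: LL_def ln_sqrt)
      also have "\<dots> \<le> ln (real (64 * n))"
        using L n(2) elim(3) by (intro ln_mono) (auto simp: L_def)
      finally show ?thesis .
    qed
    \<comment> \<open>Here \<open>2\<^sup>1\<^sup>5\<close> is needed: \<open>7 \<cdot> 64 \<cdot> 2 = 896\<close> and \<open>896 log 6 / 2\<^sup>1\<^sup>5 \<le> 1/16\<close>.\<close>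
    have "6 ^ card P \<le> T powr (\<kappa> / 16)"
    proof -
      have "real (card P) \<le> real (card Q)" unfolding P_def by (simp add: card_image_le Q_def)
      also have "\<dots> \<le> 7 * real (64 * n) / ln (real (64 * n))" using elim(10) by (simp add: Q_def n_def)
      also have "\<dots> \<le> 7 * (64 * M T) / (LL / 2)"
        using n LL ln64 by (intro frac_le mult_left_mono) auto
      also have "\<dots> = 896 * (\<kappa> / 2 ^ 15) * L" using LL by (simp add: M_def L_def LL_def)
      finally have "real (card P) \<le> 896 * (\<kappa> / 2 ^ 15) * L" .
      moreover have "896 * (\<kappa> / 2 ^ 15) * L * 2 \<le> \<kappa> / 16 * L" using \<kappa> L by simp
      ultimately have "real (card P) * 2 \<le> \<kappa> / 16 * L" by linarith
      moreover have "ln 6 \<le> (2::real)"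
      proof -
        have "6 \<le> exp (2::real)" using exp_lower_Taylor_quadratic[of 2] exp_ge_add_one_self[of 1]
            mult_mono[of "5/2" "exp 1" "5/2" "exp (1::real)"] exp_lower_Taylor_quadratic[of 1] by (simp flip: exp_add)
        then show ?thesis using ln_mono[of 6 "exp 2"] by simp
      qed
      then have "real (card P) * ln 6 \<le> real (card P) * 2" by (intro mult_left_mono) auto
      ultimately have "exp (real (card P) * ln 6) \<le> exp (\<kappa> / 16 * L)" by simp
      moreover have "exp (real (card P) * ln 6) = 6 ^ card P" by (simp add: exp_of_nat_mult)
      ultimately show ?thesis by (simp add: T)
    qed
    then obtain t where t: "\<not> zero_near \<alpha> t (H + 1)" "T powr \<beta> + H + 1 \<le> t" "t + H + 1 \<le> T"
        "\<forall>\<omega>\<in>P. 1/2 \<le> cos (t * \<omega>)"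
      using elim(2) H finP by blast
    have r: "H + 1 = real Z + 4" by (simp add: H_def)
    have Tb: "1 \<le> T powr \<beta>" using T1 \<beta> by (simp add: ge_one_powr_ge_zero)
    obtain g where g: "log_zeta_branch \<alpha> t (real Z + 4) g"
    proof (rule log_zeta_branch_exists[OF t(1)[unfolded r]])
      show "0 < \<alpha>" "\<alpha> < 1" using \<alpha> \<sigma> by auto
      show "1 \<le> t - (real Z + 4)" using t(2) Tb by (simp add: H_def)
    qed auto
    have gb: "norm (g s) \<le> \<bar>G\<bar> * (real n)\<^sup>2" if "\<sigma> \<le> Re s" "Re s \<le> 4" "\<bar>Im s - t\<bar> \<le> real Z" for s
    proof -
      have "norm (g s) \<le> G * ln T"
      proof (rule elim(1)[rule_format, of t "real Z + 4" g s])
        show "1 \<le> t - (real Z + 4)" "t + (real Z + 4) \<le> T" using t(2,3) Tb by (auto simp: H_def)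
      qed (use g that in auto)
      also have "\<dots> \<le> \<bar>G\<bar> * L" unfolding L_def[symmetric] using L by (intro mult_right_mono) auto
      also have "\<dots> \<le> \<bar>G\<bar> * (real n)\<^sup>2" using Ln2 by (intro mult_left_mono) auto
      finally show ?thesis .
    qed
    define X where "X = c * montgomery_size \<sigma> \<kappa> T"
    have X: "0 \<le> X" using c elim(7) by (simp add: X_def)
    show ?case
    proof (rule ccontr)
      assume "\<not> (\<exists>v\<in>{T powr \<beta>..T}. ereal (c * montgomery_size \<sigma> \<kappa> T) \<le> neg_log_norm (riemann_zeta (Complex \<sigma> v)))"
      then have lt: "neg_log_norm (riemann_zeta (Complex \<sigma> v)) < ereal X" if "v \<in> {T powr \<beta>..T}" for v
        using that unfolding X_def by force
      have low: "- X \<le> Re (g (Complex \<sigma> v))" if v: "\<bar>v - t\<bar> \<le> real Z" for v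
      proof -
        have "v \<in> {T powr \<beta>..T}" using v t(2,3) by (auto simp: H_def)
        moreover have e: "exp (g (Complex \<sigma> v)) = riemann_zeta (Complex \<sigma> v)" 
          using g v \<alpha> by (auto simp: log_zeta_branch_def)
        ultimately have "ereal (- ln (norm (exp (g (Complex \<sigma> v))))) < ereal X"
          using lt[of v] by (simp add: neg_log_norm_def flip: e)
        then show ?thesis by simp
      qed
      have cos: "1/2 \<le> cos (t * ln (real k))" if "primepow k" "k \<le> 64 * n" for k
        using t(4) that primepow_gt_Suc_0[of k] by (auto simp: P_def Q_def)
      have err': "2 * exp ((ln (4 * real n) + 2 * ln 4) * (7/2)) * (7 * (\<bar>G\<bar> * (real n)\<^sup>2 + real Z) / (real Z)\<^sup>2 + 4 / real Z) \<le> 1"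
        using elim(9) by (simp add: n_def Z_def)
      have "(\<Sum>k\<in>{n<..16*n}. log_zeta_coeff k * real k powr (-\<sigma>)) \<le> 200 * (X + 2)"
        by (rule smoothed_log_zeta_inequality[OF n(3) Z(1) \<sigma> \<alpha>(2) _ g gb low X cos err']) auto
      moreover have "7/16 * (16 * real n) powr (1 - \<sigma>) / ln (16 * real n) \<le> (\<Sum>k\<in>{n<..16*n}. log_zeta_coeff k * real k powr (-\<sigma>))"
        using n(3) \<sigma> elim(11) by (intro sum_log_zeta_coeff_ge) (auto simp: n_def)
      \<comment> \<open>The factor \<open>(2\<^sup>-\<^sup>1\<^sup>2)\<^sup>1\<^sup>-\<^sup>\<sigma>\<close> lost by scaling \<open>\<kappa> log T log log T\<close> down to \<open>16m\<close> is bounded below uniformly in \<open>\<sigma>\<close>; this makes the final constant absolute.\<close>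
      moreover have "7 / 2 ^ 17 * montgomery_size \<sigma> \<kappa> T \<le> 7/16 * (16 * real n) powr (1 - \<sigma>) / ln (16 * real n)"
      proof -
        have "(1 / 2 ^ 12) powr 1 \<le> (1 / 2 ^ 12 :: real) powr (1 - \<sigma>)" using \<sigma> by (intro powr_mono') auto
        then have "1 / 2 ^ 12 * (\<kappa> * L * LL) powr (1 - \<sigma>) \<le> (1 / 2 ^ 12) powr (1 - \<sigma>) * (\<kappa> * L * LL) powr (1 - \<sigma>)"
          by (intro mult_right_mono) auto
        also have "\<dots> = (1 / 2 ^ 12 * (\<kappa> * L * LL)) powr (1 - \<sigma>)"
          by (rule powr_mult[symmetric])
        also have "\<dots> \<le> (16 * real n) powr (1 - \<sigma>)"
          using \<sigma> \<kappa> L LL n(2) by (intro powr_mono2) (auto simp: M_def L_def LL_def)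
        finally have A: "1 / 2 ^ 12 * (\<kappa> * L * LL) powr (1 - \<sigma>) \<le> (16 * real n) powr (1 - \<sigma>)" .
        have B: "ln (16 * real n) \<le> 2 * LL"
        proof -
          have "ln (16 * real n) \<le> ln (L\<^sup>2)" using n elim(6) by (intro ln_mono) (auto simp: L_def)
          then show ?thesis using L by (simp add: LL_def ln_realpow)
        qed
        have "montgomery_size \<sigma> \<kappa> T = (\<kappa> * L * LL) powr (1 - \<sigma>) / LL"
        proof -
          have "LL powr (1 - \<sigma>) / LL = 1 / LL powr \<sigma>" using LL by (simp add: powr_diff)
          then have "(\<kappa> powr (1 - \<sigma>) * L powr (1 - \<sigma>)) * (LL powr (1 - \<sigma>) / LL) = montgomery_size \<sigma> \<kappa> T"
            by (simp add: montgomery_size_def L_def LL_def)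
          then show ?thesis using \<kappa> L LL by (simp add: powr_mult)
        qed
        then have "7 / 2 ^ 17 * montgomery_size \<sigma> \<kappa> T = 7/16 * (1 / 2 ^ 12 * (\<kappa> * L * LL) powr (1 - \<sigma>)) / (2 * LL)"
          by simp
        also have "\<dots> \<le> 7/16 * (16 * real n) powr (1 - \<sigma>) / ln (16 * real n)"
          using A B n(3) by (intro frac_le mult_left_mono) auto
        finally show ?thesis .
      qed
      ultimately have "7 / 2 ^ 17 * montgomery_size \<sigma> \<kappa> T \<le> 200 * (X + 2)" by linarith
      moreover have "X \<le> 1 / 2 ^ 27 * montgomery_size \<sigma> \<kappa> T" unfolding X_def using c elim(7) by (intro mult_right_mono) auto
      ultimately show False using elim(7) by simp
    qed
  qed
qed


theorem corollary1p2:
  shows "\<exists>c::real. 0 < c \<and>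
    (\<forall>\<sigma> \<beta> \<kappa> :: real. 1/2 < \<sigma> \<longrightarrow> \<sigma> < 1 \<longrightarrow> 0 < \<beta> \<longrightarrow> \<beta> < 1 \<longrightarrow>
       0 < \<kappa> \<longrightarrow> \<kappa> < min (\<sigma> - 1/2) (1 - \<beta>) \<longrightarrow>
       (\<exists>\<upsilon> :: real \<Rightarrow> real.
          (\<forall>x\<in>{1/2<..<1}. 0 < \<upsilon> x \<and>
             \<upsilon> x > c * min 1 ((exp 2 - exp 1) * (\<bar>ln (2 * x - 1)\<bar> / (\<bar>ln (2 * x - 1)\<bar> + 1)))) \<and>
          (\<forall>\<^sub>F T in at_top. \<exists>t\<in>{T powr \<beta>..T}.
             neg_log_norm (riemann_zeta (Complex \<sigma> t)) \<ge>
             ereal (\<upsilon> \<sigma> * (\<kappa> powr (1 - \<sigma>) / sqrt \<bar>ln (2 * \<sigma> - 1)\<bar>) *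
                    ((ln T) powr (1 - \<sigma>) / (ln (ln T)) powr \<sigma>)))))"
proof -
  \<comment> \<open>Chosen such that \<open>2 c \<cdot> 9 \<le> 2\<^sup>-\<^sup>2\<^sup>7\<close>, the constant admitted by \<open>extreme_value_lower_bound\<close>.\<close>
  define c :: real where "c = 1 / 2 ^ 32"
  define l where "l x = \<bar>ln (2 * x - 1)\<bar>" for x :: real
  define \<upsilon> where "\<upsilon> x = 2 * c * min 1 ((exp 2 - exp 1) * (l x / (l x + 1)))" for x
  have c: "0 < c" by (simp add: c_def)
  have e: "(0::real) < exp 2 - exp 1" "exp 2 - exp 1 \<le> (9::real)"
  proof -
    have "exp 2 = exp 1 * exp (1::real)" by (simp flip: exp_add)
    also have "\<dots> \<le> 3 * 3" using exp_le by (intro mult_mono) auto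
    finally show "exp 2 - exp 1 \<le> (9::real)" using exp_gt_zero[of "1::real"] by linarith
  qed simp
  have l: "0 < l x" if "x \<in> {1/2<..<1}" for x using that by (auto simp: l_def)
  have \<upsilon>: "0 < \<upsilon> x" "\<upsilon> x > c * min 1 ((exp 2 - exp 1) * (l x / (l x + 1)))" if "x \<in> {1/2<..<1}" for x
  proof -
    have "0 < min 1 ((exp 2 - exp 1) * (l x / (l x + 1)))"
      using l[OF that] e by (simp add: add_pos_pos)
    then have "0 < c * min 1 ((exp 2 - exp 1) * (l x / (l x + 1)))" using c by (intro mult_pos_pos)
    moreover have "0 < 2 * y \<and> y < 2 * y" if "0 < y" for y :: real using that by simp
    ultimately show "0 < \<upsilon> x" "\<upsilon> x > c * min 1 ((exp 2 - exp 1) * (l x / (l x + 1)))"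
      unfolding \<upsilon>_def mult.assoc[of 2 c] by blast+
  qed
  have bound: "\<upsilon> x / sqrt (l x) \<le> 1 / 2 ^ 27" if "x \<in> {1/2<..<1}" for x
  proof -
    have "min 1 ((exp 2 - exp 1) * (l x / (l x + 1))) \<le> 9 * sqrt (l x)"
    proof (cases "1 \<le> l x")
      case True
      then have "1 \<le> sqrt (l x)" by simp
      then show ?thesis by linarith
    next
      case False
      have "l x / (l x + 1) \<le> l x / 1" using l[OF that] by (intro divide_left_mono) auto
      also have "l x = sqrt (l x) * sqrt (l x)" using l[OF that] by simp
      also have "\<dots> \<le> sqrt (l x) * 1" using False l[OF that] by (intro mult_left_mono) auto
      finally have "(exp 2 - exp 1) * (l x / (l x + 1)) \<le> 9 * sqrt (l x)"
        using e l[OF that] by (intro mult_mono) auto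
      then show ?thesis by linarith
    qed
    then have "\<upsilon> x \<le> 2 * c * (9 * sqrt (l x))" unfolding \<upsilon>_def using c by (intro mult_left_mono) auto
    then have "\<upsilon> x / sqrt (l x) \<le> 2 * c * 9" using l[OF that] by (simp add: divide_le_eq)
    also have "\<dots> \<le> 1 / 2 ^ 27" by (simp add: c_def)
    finally show ?thesis .
  qed
  show ?thesis
  proof (intro exI[of _ c] conjI allI impI c exI[of _ \<upsilon>] ballI)
    fix x :: real assume "x \<in> {1/2<..<1}"
    then show "0 < \<upsilon> x"
      "\<upsilon> x > c * min 1 ((exp 2 - exp 1) * (\<bar>ln (2 * x - 1)\<bar> / (\<bar>ln (2 * x - 1)\<bar> + 1)))"
      using \<upsilon>[of x] by (simp_all only: l_def)
  next
    fix \<sigma> \<beta> \<kappa> :: real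
    assume *: "1/2 < \<sigma>" "\<sigma> < 1" "0 < \<beta>" "\<beta> < 1" "0 < \<kappa>" "\<kappa> < min (\<sigma> - 1/2) (1 - \<beta>)"
    then have \<sigma>: "\<sigma> \<in> {1/2<..<1}" by simp
    have eq: "\<upsilon> \<sigma> * (\<kappa> powr (1 - \<sigma>) / sqrt \<bar>ln (2 * \<sigma> - 1)\<bar>) * ((ln T) powr (1 - \<sigma>) / (ln (ln T)) powr \<sigma>)
        = \<upsilon> \<sigma> / sqrt (l \<sigma>) * montgomery_size \<sigma> \<kappa> T" for T
      by (simp add: montgomery_size_def l_def)
    show "\<forall>\<^sub>F T in at_top. \<exists>t\<in>{T powr \<beta>..T}. neg_log_norm (riemann_zeta (Complex \<sigma> t)) \<ge>
        ereal (\<upsilon> \<sigma> * (\<kappa> powr (1 - \<sigma>) / sqrt \<bar>ln (2 * \<sigma> - 1)\<bar>) * ((ln T) powr (1 - \<sigma>) / (ln (ln T)) powr \<sigma>))"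
      unfolding eq using * \<upsilon>(1)[OF \<sigma>] bound[OF \<sigma>] l[OF \<sigma>]
      by (intro extreme_value_lower_bound) auto
  qed
qed

end
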